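(* Let $(M,J,g)$ be a connected compact LCK manifold with corresponding Lee form $\theta$, and let $\{\nabla^t\}_{t\in\mathbb{R}}$ be the family of associated Gauduchon connections. If $\nabla^t\theta=0$ for some $t\in\mathbb{R}$ then either: (a) $\theta=0$, i.e. $(M,J,g)$ is Kähler (and therefore $\nabla^t=\nabla^g$ for all $t$), or (b) $(M,J,g)$ is Vaisman and $t=-1$ (so that $\nabla^{-1}=\nabla^b$ is the Bismut connection).
   Context: All manifolds have real dimension $\ge 4$. A Hermitian manifold $(M,J,g)$ with fundamental $2$-form $\omega(X,Y)=g(JX,Y)$ and Levi-Civita connection $\nabla^g$ is locally conformally Kähler (LCK) if there is a closed $1$-form $\theta$ (the Lee form; it is unique, and $\theta=0$ is allowed, which is the Kähler case) with $d\omega=\theta\wedge\omega$; it is Vaisman if moreover $\nabla^g\theta=0$. The Gauduchon connections $\nabla^t$, $t\in\mathbb{R}$, are the Hermitian connections defined by $$g(\nabla^t_XY,Z)=g(\nabla^g_XY,Z)-\frac{t-1}{4}\,d\omega(JX,JY,JZ)-\frac{t+1}{4}\,d\omega(JX,Y,Z).$$ The Bismut connection is $\nabla^b=\nabla^{-1}$. *)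

theory Defs
  imports "HOL-Analysis.Analysis"
begin

section \<open>Smooth manifolds\<close>

primrec Ck_on :: "nat \<Rightarrow> 'a::real_normed_vector set \<Rightarrow> ('a \<Rightarrow> 'b::real_normed_vector) \<Rightarrow> bool" where
  "Ck_on 0 S f \<longleftrightarrow> continuous_on S f"
| "Ck_on (Suc k) S f \<longleftrightarrow> (\<forall>x\<in>S. f differentiable (at x)) \<and>
     (\<forall>v. Ck_on k S (\<lambda>x. frechet_derivative f (at x) v))"

text \<open>Only used on open sets of a Euclidean space, where this is the usual notion of
  a map of class C-infinity.\<close>

definition smooth_on :: "'a::real_normed_vector set \<Rightarrow> ('a \<Rightarrow> 'b::real_normed_vector) \<Rightarrow> bool" where
  "smooth_on S f \<longleftrightarrow> (\<forall>k. Ck_on k S f)"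

text \<open>The manifold is the whole type \<open>'m\<close> (Hausdorff and second countable by its sort).
  A chart is a pair of its domain and its coordinate map; the model space \<open>'e\<close> plays the
  role of real n-space with \<open>n = DIM('e)\<close>.\<close>

type_synonym ('m, 'e) atlas = "('m set \<times> ('m \<Rightarrow> 'e)) set"

definition is_chart :: "'m::topological_space set \<Rightarrow> ('m \<Rightarrow> 'e::euclidean_space) \<Rightarrow> bool" where
  "is_chart U \<phi> \<longleftrightarrow> open U \<and> open (\<phi> ` U) \<and> homeomorphism U (\<phi> ` U) \<phi> (inv_into U \<phi>)"

definition smooth_atlas ::
  "('m::{t2_space,second_countable_topology}, 'e::euclidean_space) atlas \<Rightarrow> bool" where
  "smooth_atlas A \<longleftrightarrow>
     (\<forall>(U, \<phi>)\<in>A. is_chart U \<phi>) \<and>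
     (\<Union>(U, \<phi>)\<in>A. U) = UNIV \<and>
     (\<forall>(U, \<phi>)\<in>A. \<forall>(V, \<psi>)\<in>A. smooth_on (\<phi> ` (U \<inter> V)) (\<psi> \<circ> inv_into U \<phi>))"

definition smooth_fun :: "('m, 'e::euclidean_space) atlas \<Rightarrow> ('m \<Rightarrow> real) \<Rightarrow> bool" where
  "smooth_fun A f \<longleftrightarrow> (\<forall>(U, \<phi>)\<in>A. smooth_on (\<phi> ` U) (f \<circ> inv_into U \<phi>))"


section \<open>Tangent vectors and vector fields\<close>

type_synonym 'm tvec = "('m \<Rightarrow> real) \<Rightarrow> real"
type_synonym 'm vfield = "'m \<Rightarrow> 'm tvec"

text \<open>Tangent vectors at \<open>p\<close> are the derivations at \<open>p\<close> of the algebra of smooth functions.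
  They are set to zero on non-smooth arguments, so that two tangent vectors are equal as
  HOL functions iff they agree on all smooth functions.\<close>

definition tangent_space :: "('m, 'e::euclidean_space) atlas \<Rightarrow> 'm \<Rightarrow> 'm tvec set" where
  "tangent_space A p = {v.
     (\<forall>f h. smooth_fun A f \<longrightarrow> smooth_fun A h \<longrightarrow> v (\<lambda>x. f x + h x) = v f + v h) \<and>
     (\<forall>c f. smooth_fun A f \<longrightarrow> v (\<lambda>x. c * f x) = c * v f) \<and>
     (\<forall>f h. smooth_fun A f \<longrightarrow> smooth_fun A h \<longrightarrow> v (\<lambda>x. f x * h x) = f p * v h + v f * h p) \<and>
     (\<forall>f. \<not> smooth_fun A f \<longrightarrow> v f = 0)}"

definition tv_add :: "'m tvec \<Rightarrow> 'm tvec \<Rightarrow> 'm tvec" where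
  "tv_add u v = (\<lambda>f. u f + v f)"

definition tv_scale :: "real \<Rightarrow> 'm tvec \<Rightarrow> 'm tvec" where
  "tv_scale c v = (\<lambda>f. c * v f)"

definition deriv_along :: "'m vfield \<Rightarrow> ('m \<Rightarrow> real) \<Rightarrow> 'm \<Rightarrow> real" where
  "deriv_along X f = (\<lambda>p. X p f)"

definition vector_field :: "('m, 'e::euclidean_space) atlas \<Rightarrow> 'm vfield \<Rightarrow> bool" where
  "vector_field A X \<longleftrightarrow> (\<forall>p. X p \<in> tangent_space A p) \<and>
     (\<forall>f. smooth_fun A f \<longrightarrow> smooth_fun A (deriv_along X f))"

definition vf_add :: "'m vfield \<Rightarrow> 'm vfield \<Rightarrow> 'm vfield" where
  "vf_add X Y = (\<lambda>p. tv_add (X p) (Y p))"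

definition vf_scale :: "('m \<Rightarrow> real) \<Rightarrow> 'm vfield \<Rightarrow> 'm vfield" where
  "vf_scale f X = (\<lambda>p. tv_scale (f p) (X p))"

definition lie_bracket :: "'m vfield \<Rightarrow> 'm vfield \<Rightarrow> 'm vfield" where
  "lie_bracket X Y = (\<lambda>p f. X p (deriv_along Y f) - Y p (deriv_along X f))"


section \<open>Tensor fields and differential forms\<close>

text \<open>Tensor fields are given pointwise; only their values on the tangent spaces matter.
  A tensor field is smooth iff it is smooth on all smooth vector fields.\<close>

type_synonym 'm form1 = "'m \<Rightarrow> 'm tvec \<Rightarrow> real"
type_synonym 'm form2 = "'m \<Rightarrow> 'm tvec \<Rightarrow> 'm tvec \<Rightarrow> real"
type_synonym 'm endo = "'m \<Rightarrow> 'm tvec \<Rightarrow> 'm tvec"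

definition on_field :: "'m endo \<Rightarrow> 'm vfield \<Rightarrow> 'm vfield" where
  "on_field J X = (\<lambda>p. J p (X p))"

definition eval1 :: "'m form1 \<Rightarrow> 'm vfield \<Rightarrow> 'm \<Rightarrow> real" where
  "eval1 \<theta> X = (\<lambda>p. \<theta> p (X p))"

definition eval2 :: "'m form2 \<Rightarrow> 'm vfield \<Rightarrow> 'm vfield \<Rightarrow> 'm \<Rightarrow> real" where
  "eval2 b X Y = (\<lambda>p. b p (X p) (Y p))"

definition linear_form_at ::
  "('m, 'e::euclidean_space) atlas \<Rightarrow> 'm \<Rightarrow> ('m tvec \<Rightarrow> real) \<Rightarrow> bool" where
  "linear_form_at A p l \<longleftrightarrow>
     (\<forall>u\<in>tangent_space A p. \<forall>v\<in>tangent_space A p. l (tv_add u v) = l u + l v) \<and>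
     (\<forall>c. \<forall>u\<in>tangent_space A p. l (tv_scale c u) = c * l u)"

definition one_form :: "('m, 'e::euclidean_space) atlas \<Rightarrow> 'm form1 \<Rightarrow> bool" where
  "one_form A \<theta> \<longleftrightarrow> (\<forall>p. linear_form_at A p (\<theta> p)) \<and>
     (\<forall>X. vector_field A X \<longrightarrow> smooth_fun A (eval1 \<theta> X))"

definition zero_form :: "('m, 'e::euclidean_space) atlas \<Rightarrow> 'm form1 \<Rightarrow> bool" where
  "zero_form A \<theta> \<longleftrightarrow> (\<forall>p. \<forall>v\<in>tangent_space A p. \<theta> p v = 0)"

text \<open>Exterior derivatives (invariant formula) and wedge product, in the normalisation without
  factorials, e.g. \<open>(\<alpha> \<and> \<beta>)(X, Y) = \<alpha>(X) \<beta>(Y) - \<alpha>(Y) \<beta>(X)\<close> for 1-forms.\<close>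

definition ext_d1 :: "'m form1 \<Rightarrow> 'm vfield \<Rightarrow> 'm vfield \<Rightarrow> 'm \<Rightarrow> real" where
  "ext_d1 \<theta> X Y p =
     X p (eval1 \<theta> Y) - Y p (eval1 \<theta> X) - eval1 \<theta> (lie_bracket X Y) p"

definition ext_d2 :: "'m form2 \<Rightarrow> 'm vfield \<Rightarrow> 'm vfield \<Rightarrow> 'm vfield \<Rightarrow> 'm \<Rightarrow> real" where
  "ext_d2 \<omega> X Y Z p =
     X p (eval2 \<omega> Y Z) + Y p (eval2 \<omega> Z X) + Z p (eval2 \<omega> X Y)
     - eval2 \<omega> (lie_bracket X Y) Z p
     - eval2 \<omega> (lie_bracket Y Z) X p
     - eval2 \<omega> (lie_bracket Z X) Y p"

definition wedge12 ::
  "'m form1 \<Rightarrow> 'm form2 \<Rightarrow> 'm vfield \<Rightarrow> 'm vfield \<Rightarrow> 'm vfield \<Rightarrow> 'm \<Rightarrow> real" where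
  "wedge12 \<theta> \<omega> X Y Z p =
     eval1 \<theta> X p * eval2 \<omega> Y Z p + eval1 \<theta> Y p * eval2 \<omega> Z X p + eval1 \<theta> Z p * eval2 \<omega> X Y p"

definition closed_form1 :: "('m, 'e::euclidean_space) atlas \<Rightarrow> 'm form1 \<Rightarrow> bool" where
  "closed_form1 A \<theta> \<longleftrightarrow>
     (\<forall>X Y p. vector_field A X \<longrightarrow> vector_field A Y \<longrightarrow> ext_d1 \<theta> X Y p = 0)"

definition riemannian_metric :: "('m, 'e::euclidean_space) atlas \<Rightarrow> 'm form2 \<Rightarrow> bool" where
  "riemannian_metric A g \<longleftrightarrow>
     (\<forall>p. \<forall>u\<in>tangent_space A p. linear_form_at A p (g p u)) \<and>
     (\<forall>p. \<forall>u\<in>tangent_space A p. \<forall>v\<in>tangent_space A p. g p u v = g p v u) \<and>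
     (\<forall>p. \<forall>u\<in>tangent_space A p. u \<noteq> (\<lambda>f. 0) \<longrightarrow> g p u u > 0) \<and>
     (\<forall>X Y. vector_field A X \<longrightarrow> vector_field A Y \<longrightarrow> smooth_fun A (eval2 g X Y))"


section \<open>Connections\<close>

type_synonym 'm connection = "'m vfield \<Rightarrow> 'm vfield \<Rightarrow> 'm vfield"

text \<open>\<open>D X Y\<close> is the covariant derivative of \<open>Y\<close> in direction \<open>X\<close>. Equality of vector
  fields is HOL equality, see the remark on \<open>tangent_space\<close>.\<close>

definition affine_connection :: "('m, 'e::euclidean_space) atlas \<Rightarrow> 'm connection \<Rightarrow> bool" where
  "affine_connection A D \<longleftrightarrow>
     (\<forall>X Y. vector_field A X \<longrightarrow> vector_field A Y \<longrightarrow> vector_field A (D X Y)) \<and>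
     (\<forall>X X' Y. vector_field A X \<longrightarrow> vector_field A X' \<longrightarrow> vector_field A Y \<longrightarrow>
        D (vf_add X X') Y = vf_add (D X Y) (D X' Y)) \<and>
     (\<forall>f X Y. smooth_fun A f \<longrightarrow> vector_field A X \<longrightarrow> vector_field A Y \<longrightarrow>
        D (vf_scale f X) Y = vf_scale f (D X Y)) \<and>
     (\<forall>X Y Y'. vector_field A X \<longrightarrow> vector_field A Y \<longrightarrow> vector_field A Y' \<longrightarrow>
        D X (vf_add Y Y') = vf_add (D X Y) (D X Y')) \<and>
     (\<forall>f X Y. smooth_fun A f \<longrightarrow> vector_field A X \<longrightarrow> vector_field A Y \<longrightarrow>
        D X (vf_scale f Y) = vf_add (vf_scale (deriv_along X f) Y) (vf_scale f (D X Y)))"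

definition levi_civita ::
  "('m, 'e::euclidean_space) atlas \<Rightarrow> 'm form2 \<Rightarrow> 'm connection \<Rightarrow> bool" where
  "levi_civita A g D \<longleftrightarrow> affine_connection A D \<and>
     (\<forall>X Y. vector_field A X \<longrightarrow> vector_field A Y \<longrightarrow>
        D X Y = vf_add (D Y X) (lie_bracket X Y)) \<and>
     (\<forall>X Y Z p. vector_field A X \<longrightarrow> vector_field A Y \<longrightarrow> vector_field A Z \<longrightarrow>
        X p (eval2 g Y Z) = eval2 g (D X Y) Z p + eval2 g Y (D X Z) p)"

definition cov_deriv1 ::
  "'m connection \<Rightarrow> 'm form1 \<Rightarrow> 'm vfield \<Rightarrow> 'm vfield \<Rightarrow> 'm \<Rightarrow> real" where
  "cov_deriv1 D \<theta> X Y p = X p (eval1 \<theta> Y) - eval1 \<theta> (D X Y) p"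

definition parallel_form1 ::
  "('m, 'e::euclidean_space) atlas \<Rightarrow> 'm connection \<Rightarrow> 'm form1 \<Rightarrow> bool" where
  "parallel_form1 A D \<theta> \<longleftrightarrow>
     (\<forall>X Y p. vector_field A X \<longrightarrow> vector_field A Y \<longrightarrow> cov_deriv1 D \<theta> X Y p = 0)"


section \<open>Hermitian, Kaehler, LCK and Vaisman manifolds\<close>

definition almost_complex_structure ::
  "('m, 'e::euclidean_space) atlas \<Rightarrow> 'm endo \<Rightarrow> bool" where
  "almost_complex_structure A J \<longleftrightarrow>
     (\<forall>p. \<forall>u\<in>tangent_space A p. J p u \<in> tangent_space A p) \<and>
     (\<forall>p. \<forall>u\<in>tangent_space A p. \<forall>v\<in>tangent_space A p.
        J p (tv_add u v) = tv_add (J p u) (J p v)) \<and>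
     (\<forall>p c. \<forall>u\<in>tangent_space A p. J p (tv_scale c u) = tv_scale c (J p u)) \<and>
     (\<forall>p. \<forall>u\<in>tangent_space A p. J p (J p u) = tv_scale (-1) u) \<and>
     (\<forall>X. vector_field A X \<longrightarrow> vector_field A (on_field J X))"

definition nijenhuis :: "'m endo \<Rightarrow> 'm vfield \<Rightarrow> 'm vfield \<Rightarrow> 'm vfield" where
  "nijenhuis J X Y = (\<lambda>p f.
     lie_bracket X Y p f
     + on_field J (lie_bracket (on_field J X) Y) p f
     + on_field J (lie_bracket X (on_field J Y)) p f
     - lie_bracket (on_field J X) (on_field J Y) p f)"

definition complex_structure :: "('m, 'e::euclidean_space) atlas \<Rightarrow> 'm endo \<Rightarrow> bool" where
  "complex_structure A J \<longleftrightarrow> almost_complex_structure A J \<and>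
     (\<forall>X Y. vector_field A X \<longrightarrow> vector_field A Y \<longrightarrow> nijenhuis J X Y = (\<lambda>p f. 0))"

definition hermitian ::
  "('m, 'e::euclidean_space) atlas \<Rightarrow> 'm endo \<Rightarrow> 'm form2 \<Rightarrow> bool" where
  "hermitian A J g \<longleftrightarrow> complex_structure A J \<and> riemannian_metric A g \<and>
     (\<forall>p. \<forall>u\<in>tangent_space A p. \<forall>v\<in>tangent_space A p. g p (J p u) (J p v) = g p u v)"

definition fundamental_form :: "'m endo \<Rightarrow> 'm form2 \<Rightarrow> 'm form2" where
  "fundamental_form J g = (\<lambda>p u v. g p (J p u) v)"

definition kaehler ::
  "('m, 'e::euclidean_space) atlas \<Rightarrow> 'm endo \<Rightarrow> 'm form2 \<Rightarrow> bool" where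
  "kaehler A J g \<longleftrightarrow> hermitian A J g \<and>
     (\<forall>X Y Z p. vector_field A X \<longrightarrow> vector_field A Y \<longrightarrow> vector_field A Z \<longrightarrow>
        ext_d2 (fundamental_form J g) X Y Z p = 0)"

definition lee_form ::
  "('m, 'e::euclidean_space) atlas \<Rightarrow> 'm endo \<Rightarrow> 'm form2 \<Rightarrow> 'm form1 \<Rightarrow> bool" where
  "lee_form A J g \<theta> \<longleftrightarrow> one_form A \<theta> \<and> closed_form1 A \<theta> \<and>
     (\<forall>X Y Z p. vector_field A X \<longrightarrow> vector_field A Y \<longrightarrow> vector_field A Z \<longrightarrow>
        ext_d2 (fundamental_form J g) X Y Z p = wedge12 \<theta> (fundamental_form J g) X Y Z p)"

definition lck ::
  "('m, 'e::euclidean_space) atlas \<Rightarrow> 'm endo \<Rightarrow> 'm form2 \<Rightarrow> bool" where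
  "lck A J g \<longleftrightarrow> hermitian A J g \<and> (\<exists>\<theta>. lee_form A J g \<theta>)"

text \<open>Since the Lee form (in real dimension at least 4) and the Levi-Civita connection are
  unique, the two existential quantifiers just name them.\<close>

definition vaisman ::
  "('m, 'e::euclidean_space) atlas \<Rightarrow> 'm endo \<Rightarrow> 'm form2 \<Rightarrow> bool" where
  "vaisman A J g \<longleftrightarrow> hermitian A J g \<and>
     (\<exists>\<theta> D. lee_form A J g \<theta> \<and> levi_civita A g D \<and> parallel_form1 A D \<theta>)"


section \<open>Gauduchon connections\<close>

text \<open>\<open>Dg\<close> is the Levi-Civita connection. As \<open>g\<close> is non-degenerate, the formula determines
  \<open>D X Y\<close> for all vector fields \<open>X\<close> and \<open>Y\<close>.\<close>

definition gauduchon_connection ::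
  "('m, 'e::euclidean_space) atlas \<Rightarrow> 'm endo \<Rightarrow> 'm form2 \<Rightarrow> 'm connection \<Rightarrow> real \<Rightarrow>
   'm connection \<Rightarrow> bool" where
  "gauduchon_connection A J g Dg t D \<longleftrightarrow> affine_connection A D \<and>
     (\<forall>X Y Z p. vector_field A X \<longrightarrow> vector_field A Y \<longrightarrow> vector_field A Z \<longrightarrow>
        eval2 g (D X Y) Z p = eval2 g (Dg X Y) Z p
          - (t - 1) / 4 * ext_d2 (fundamental_form J g)
              (on_field J X) (on_field J Y) (on_field J Z) p
          - (t + 1) / 4 * ext_d2 (fundamental_form J g) (on_field J X) Y Z p)"

definition bismut_connection ::
  "('m, 'e::euclidean_space) atlas \<Rightarrow> 'm endo \<Rightarrow> 'm form2 \<Rightarrow> 'm connection \<Rightarrow>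
   'm connection \<Rightarrow> bool" where
  "bismut_connection A J g Dg D \<longleftrightarrow> gauduchon_connection A J g Dg (-1) D"

end

theory Submission
  imports Defs "HOL-Real_Asymp.Real_Asymp"
begin

text \<open>Let \<open>T\<close> be the vector field dual to \<open>\<theta>\<close>. Inserting \<open>Z = T\<close> into the defining formula of
  \<open>\<nabla>\<^sup>t\<close> and using \<open>d\<omega> = \<theta> \<and> \<omega>\<close>, the term with factor \<open>t - 1\<close> cancels, and \<open>\<nabla>\<^sup>t\<theta> = 0\<close> becomes
  \<open>\<nabla>\<^sup>g\<theta> = (t + 1)/4 (|\<theta>|\<^sup>2 g - \<theta> \<otimes> \<theta> - J\<theta> \<otimes> J\<theta>)\<close>. For \<open>t = -1\<close> this says that the manifold is Vaisman.
  Otherwise, taking traces, \<open>div T = (t + 1)/4 (n - 2) |\<theta>|\<^sup>2\<close> has a constant sign, so that the divergence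
  theorem on the compact manifold forces \<open>\<theta> = 0\<close>. The Riemannian measure is only needed as a functional
  on functions supported in a single chart, where it has density \<open>|det g|\<^sup>1\<^sup>/\<^sup>2\<close>; the divergence of \<open>T\<close> in a chart
  is read off from \<open>L\<^sub>T g = 2 \<nabla>\<^sup>g\<theta>\<close> and Jacobi's formula.\<close>

section \<open>Calculus of smooth functions\<close>

text \<open>The divergence theorem is reached without a global integral. For a partition of unity
  \<open>\<rho> i\<close> subordinate to charts \<open>c i\<close> put d_i = div
  (\<open>\<rho> i\<close> T). Each d_i has integral 0 in its own chart, and the d_i add up to div T
  because T annihilates the constant 1. A product \<open>\<rho> i\<close> * d_j is supported in the
  overlap of two charts, where both chart integrals agree; exchanging the charts in the double sum
  shows that the chart integrals of \<open>\<rho> i\<close> * div T add up to 0. No Christoffel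
  symbols occur: the bracket of T with a coordinate field has the negated partial derivatives of the
  components of T as components, so L_T g yields the derivative of the Gram matrix along T, and of
  this Jacobi's formula keeps only a trace. The number n - 2 arises because the two rank one terms
  of the formula come from T and JT, which have the same length. Tangent vectors act on functions on
  the whole manifold. Hence coordinates and coordinate fields are multiplied by a bump function, and
  identities are read off only where the bump is 1.\<close>

abbreviation dderiv :: "('a::real_normed_vector \<Rightarrow> 'b::real_normed_vector) \<Rightarrow> 'a \<Rightarrow> 'a \<Rightarrow> 'b" where
  "dderiv f v x \<equiv> frechet_derivative f (at x) v"

section \<open>Functions of class C^k on open sets: locality and algebra\<close>

lemma frechet_derivative_cong_open:
  assumes "open S" "x \<in> S" "\<And>y. y \<in> S \<Longrightarrow> f y = g y"
  shows "frechet_derivative f (at x) = frechet_derivative g (at x)"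
proof -
  have "(f has_derivative D) (at x) \<longleftrightarrow> (g has_derivative D) (at x)" for D
    using has_derivative_transform_within_open[of f D x UNIV S g]
      has_derivative_transform_within_open[of g D x UNIV S f] assms by auto
  then show ?thesis by (simp add: frechet_derivative_def)
qed

lemma differentiable_cong_open:
  assumes "open S" "x \<in> S" "\<And>y. y \<in> S \<Longrightarrow> f y = g y"
  shows "f differentiable (at x) \<longleftrightarrow> g differentiable (at x)"
proof -
  have "(f has_derivative D) (at x) \<longleftrightarrow> (g has_derivative D) (at x)" for D
    using has_derivative_transform_within_open[of f D x UNIV S g]
      has_derivative_transform_within_open[of g D x UNIV S f] assms by auto
  then show ?thesis by (simp add: differentiable_def)
qed

lemma Ck_on_cong:
  assumes "open S" "\<And>y. y \<in> S \<Longrightarrow> f y = g y"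
  shows "Ck_on k S f \<longleftrightarrow> Ck_on k S g"
  using assms
proof (induction k arbitrary: f g)
  case 0 then show ?case by (auto cong: continuous_on_cong)
next
  case (Suc k)
  have "Ck_on k S (dderiv f v) \<longleftrightarrow> Ck_on k S (dderiv g v)" for v
  proof (rule Suc.IH[OF Suc.prems(1)])
    show "dderiv f v y = dderiv g v y" if "y \<in> S" for y
      using frechet_derivative_cong_open[OF Suc.prems(1) that, of f g] Suc.prems(2) by simp
  qed
  moreover have "f differentiable (at x) \<longleftrightarrow> g differentiable (at x)" if "x \<in> S" for x
    by (rule differentiable_cong_open[OF Suc.prems(1) that Suc.prems(2)])
  ultimately show ?case by simp
qed

lemma Ck_on_mono: "Ck_on k S f \<Longrightarrow> T \<subseteq> S \<Longrightarrow> Ck_on k T f"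
  by (induction k arbitrary: f) (auto intro: continuous_on_subset)

lemma Ck_on_SucD: "Ck_on (Suc k) S f \<Longrightarrow> Ck_on k S f"
proof (induction k arbitrary: f)
  case 0
  then show ?case
    by (simp add: continuous_at_imp_continuous_on differentiable_imp_continuous_within)
next
  case (Suc k)
  then show ?case by (simp del: Ck_on.simps(1)) 
qed

text \<open>\<open>frechet_derivative\<close> is a choice term; on an open set any explicit
  derivative \<open>D\<close> may stand in for it. The inductions on the class exhibit a
  \<open>D\<close> whose building blocks fall under the induction hypothesis.\<close>

lemma Ck_on_SucI:
  assumes "open S" "\<And>x. x \<in> S \<Longrightarrow> (f has_derivative (\<lambda>v. D v x)) (at x)" "\<And>v. Ck_on k S (D v)"
  shows "Ck_on (Suc k) S f"
proof -
  have "dderiv f v x = D v x" if "x \<in> S" for x v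
    using frechet_derivative_at[OF assms(2)[OF that]] by metis
  then have "Ck_on k S (dderiv f v)" for v
    using Ck_on_cong[OF assms(1), of "dderiv f v" "D v" k] assms(3)[of v] by simp
  moreover have "f differentiable at x" if "x \<in> S" for x using assms(2)[OF that] differentiable_def by blast
  ultimately show ?thesis by simp
qed

lemma Ck_on_SucE:
  assumes "Ck_on (Suc k) S f"
  shows "\<And>x. x \<in> S \<Longrightarrow> (f has_derivative (\<lambda>v. dderiv f v x)) (at x)" "\<And>v. Ck_on k S (dderiv f v)"
  using assms frechet_derivative_works unfolding Ck_on.simps by blast+

lemma Ck_on_const: "Ck_on k S (\<lambda>x. c)"
  by (induction k arbitrary: c) auto

lemma dderiv_mult:
  fixes f g :: "'a::real_normed_vector \<Rightarrow> real"
  assumes "f differentiable at x" "g differentiable at x"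
  shows "dderiv (\<lambda>x. f x * g x) v x = f x * dderiv g v x + dderiv f v x * g x"
  using frechet_derivative_at[OF has_derivative_mult[OF frechet_derivative_works[THEN iffD1, OF assms(1)] frechet_derivative_works[THEN iffD1, OF assms(2)]]]
  by metis

lemma Ck_on_add:
  assumes "open S" "Ck_on k S f" "Ck_on k S g"
  shows "Ck_on k S (\<lambda>x. f x + g x)"
  using assms(2,3)
proof (induction k arbitrary: f g)
  case 0 then show ?case by (simp add: continuous_on_add)
next
  case (Suc k)
  note f = Ck_on_SucE[OF Suc.prems(1)] and g = Ck_on_SucE[OF Suc.prems(2)]
  show ?case
    by (intro Ck_on_SucI[OF assms(1), where D = "\<lambda>v x. dderiv f v x + dderiv g v x"] has_derivative_add f g Suc.IH)
qed

lemma Ck_on_mult: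
  fixes f g :: "'a::real_normed_vector \<Rightarrow> real"
  assumes "open S" "Ck_on k S f" "Ck_on k S g"
  shows "Ck_on k S (\<lambda>x. f x * g x)"
  using assms(2,3)
proof (induction k arbitrary: f g)
  case 0 then show ?case by (simp add: continuous_on_mult)
next
  case (Suc k)
  note f = Ck_on_SucE[OF Suc.prems(1)] and g = Ck_on_SucE[OF Suc.prems(2)]
  \<comment> \<open>The product rule leaves one factor undifferentiated, so \<open>f\<close> and
    \<open>g\<close> themselves are needed one class lower as well.\<close>
  note fg = Ck_on_SucD[OF Suc.prems(1)] Ck_on_SucD[OF Suc.prems(2)]
  show ?case
  proof (rule Ck_on_SucI[OF assms(1), where D = "\<lambda>v x. f x * dderiv g v x + dderiv f v x * g x"])
    show "((\<lambda>x. f x * g x) has_derivative (\<lambda>v. f x * dderiv g v x + dderiv f v x * g x)) (at x)" if "x \<in> S" for x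
      using f(1)[OF that] g(1)[OF that] by (rule has_derivative_mult)
    show "Ck_on k S (\<lambda>x. f x * dderiv g v x + dderiv f v x * g x)" for v
      by (intro Ck_on_add assms(1) Suc.IH f g fg)
  qed
qed

lemma Ck_on_sum:
  fixes f :: "'i \<Rightarrow> 'a::real_normed_vector \<Rightarrow> 'b::real_normed_vector"
  assumes "open S" "\<And>i. i \<in> I \<Longrightarrow> Ck_on k S (f i)"
  shows "Ck_on k S (\<lambda>x. \<Sum>i\<in>I. f i x)"
  using assms(2)
proof (induction I rule: infinite_finite_induct)
  case (insert j I)
  then show ?case using Ck_on_add[OF assms(1), of k "f j" "\<lambda>x. \<Sum>i\<in>I. f i x"] by simp
qed (simp_all add: Ck_on_const)

lemma smooth_on_cong:
  assumes "open S" "\<And>y. y \<in> S \<Longrightarrow> f y = g y"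
  shows "smooth_on S f \<longleftrightarrow> smooth_on S g"
  using Ck_on_cong[OF assms] by (simp add: smooth_on_def)

lemma smooth_on_subset: "smooth_on S f \<Longrightarrow> T \<subseteq> S \<Longrightarrow> smooth_on T f"
  by (auto simp: smooth_on_def intro: Ck_on_mono)

lemma smooth_on_const: "smooth_on S (\<lambda>x. c)"
  by (simp add: smooth_on_def Ck_on_const)

lemma smooth_on_add: "open S \<Longrightarrow> smooth_on S f \<Longrightarrow> smooth_on S g \<Longrightarrow> smooth_on S (\<lambda>x. f x + g x)"
  unfolding smooth_on_def using Ck_on_add by blast

lemma smooth_on_mult:
  fixes f g :: "'a::real_normed_vector \<Rightarrow> real"
  shows "open S \<Longrightarrow> smooth_on S f \<Longrightarrow> smooth_on S g \<Longrightarrow> smooth_on S (\<lambda>x. f x * g x)"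
  unfolding smooth_on_def using Ck_on_mult by blast

lemma smooth_on_minus:
  fixes f g :: "'a::real_normed_vector \<Rightarrow> real"
  shows "open S \<Longrightarrow> smooth_on S f \<Longrightarrow> smooth_on S g \<Longrightarrow> smooth_on S (\<lambda>x. f x - g x)"
  using smooth_on_add[of S f "\<lambda>x. (-1) * g x"] smooth_on_mult[of S "\<lambda>x. -1" g] smooth_on_const[of S "-1::real"]
  by simp

lemma smooth_on_sum:
  "open S \<Longrightarrow> (\<And>i. i \<in> I \<Longrightarrow> smooth_on S (f i)) \<Longrightarrow> smooth_on S (\<lambda>x. \<Sum>i\<in>I. f i x)"
  unfolding smooth_on_def by (intro allI Ck_on_sum) blast+

lemma smooth_on_prod:
  fixes f :: "'i \<Rightarrow> 'a::real_normed_vector \<Rightarrow> real"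
  assumes "open S" "\<And>i. i \<in> I \<Longrightarrow> smooth_on S (f i)"
  shows "smooth_on S (\<lambda>x. \<Prod>i\<in>I. f i x)"
  using assms(2)
proof (induction I rule: infinite_finite_induct)
  case (insert j I)
  then show ?case using smooth_on_mult[OF assms(1), of "f j" "\<lambda>x. \<Prod>i\<in>I. f i x"] by simp
qed (simp_all add: smooth_on_const)

lemma smooth_on_dderiv: "smooth_on S f \<Longrightarrow> smooth_on S (dderiv f v)"
  unfolding smooth_on_def using Ck_on.simps(2) by blast

lemma smooth_on_imp_continuous_on: "smooth_on S f \<Longrightarrow> continuous_on S f"
  unfolding smooth_on_def using Ck_on.simps(1) by blast

lemma smooth_on_imp_differentiable: "smooth_on S f \<Longrightarrow> x \<in> S \<Longrightarrow> f differentiable at x"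
  unfolding smooth_on_def using Ck_on.simps(2) by blast

lemma smooth_on_has_derivative:
  "smooth_on S f \<Longrightarrow> x \<in> S \<Longrightarrow> (f has_derivative frechet_derivative f (at x)) (at x)"
  using smooth_on_imp_differentiable frechet_derivative_works[THEN iffD1] by blast

text \<open>\<open>Ck_on\<close> takes derivatives at points and not within the set, so both of its
  clauses can be checked on small neighbourhoods. Functions extended by zero are glued with
  this.\<close>

lemma Ck_on_local:
  assumes "\<And>x. x \<in> S \<Longrightarrow> \<exists>T. open T \<and> x \<in> T \<and> Ck_on k T f"
  shows "Ck_on k S f"
  using assms
proof (induction k arbitrary: f)
  case 0
  have "isCont f x" if x: "x \<in> S" for x
  proof -
    obtain T where "open T" "x \<in> T" "continuous_on T f" using 0[OF x] by auto
    then show ?thesis using continuous_on_eq_continuous_at[of T f] by simp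
  qed
  then show ?case by (simp add: continuous_at_imp_continuous_on)
next
  case (Suc k)
  have "Ck_on k S (dderiv f v)" for v
  proof (rule Suc.IH)
    fix x assume "x \<in> S"
    from Suc.prems[OF this] show "\<exists>T. open T \<and> x \<in> T \<and> Ck_on k T (dderiv f v)"
      by auto
  qed
  moreover have "f differentiable at x" if "x \<in> S" for x
    using Suc.prems[OF that] by auto
  ultimately show ?case by simp
qed

lemma smooth_on_local:
  assumes "\<And>x. x \<in> S \<Longrightarrow> \<exists>T. open T \<and> x \<in> T \<and> smooth_on T f"
  shows "smooth_on S f"
  unfolding smooth_on_def
proof (intro allI Ck_on_local)
  fix k x assume "x \<in> S"
  from assms[OF this] show "\<exists>T. open T \<and> x \<in> T \<and> Ck_on k T f"
    unfolding smooth_on_def by auto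
qed

lemma smooth_on_bounded_linear:
  assumes "bounded_linear f"
  shows "smooth_on S f"
proof -
  have "Ck_on k S f" for k
  proof (cases k)
    case 0
    then show ?thesis using assms by (simp add: linear_continuous_on)
  next
    case (Suc k)
    have "frechet_derivative f (at x) = f" for x
      by (metis assms bounded_linear_imp_has_derivative frechet_derivative_at)
    then show ?thesis using Suc assms
      by (auto simp: Ck_on_const bounded_linear_imp_differentiable simp del: Ck_on.simps(1))
  qed
  then show ?thesis by (simp add: smooth_on_def)
qed

lemma smooth_on_vec_nth: "smooth_on S (\<lambda>x::real^'n. x $ i)"
  by (rule smooth_on_bounded_linear) (rule bounded_linear_vec_nth)

text \<open>The derivative -f' * (1/f) * (1/f) is built from 1/f itself and a smooth factor, so the
  class of 1/f can be raised step by step.\<close>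

lemma smooth_on_inverse:
  fixes f :: "'a::real_normed_vector \<Rightarrow> real"
  assumes "open S" "smooth_on S f" "\<And>x. x \<in> S \<Longrightarrow> f x \<noteq> 0"
  shows "smooth_on S (\<lambda>x. inverse (f x))"
proof -
  have "Ck_on k S (\<lambda>x. inverse (f x))" for k
  proof (induction k)
    case 0 then show ?case using assms by (simp add: continuous_on_inverse smooth_on_imp_continuous_on)
  next
    case (Suc k)
    show ?case
    proof (rule Ck_on_SucI[OF assms(1), where D = "\<lambda>v x. (-1) * dderiv f v x * (inverse (f x) * inverse (f x))"])
      show "((\<lambda>x. inverse (f x)) has_derivative (\<lambda>v. (-1) * dderiv f v x * (inverse (f x) * inverse (f x)))) (at x)"
        if "x \<in> S" for x
        using Deriv.has_derivative_inverse[OF assms(3) smooth_on_has_derivative[OF assms(2)], OF that that]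
        by (simp add: mult_ac)
      have "Ck_on k S (dderiv f v)" for v
        using smooth_on_dderiv[OF assms(2)] unfolding smooth_on_def by blast
      then show "Ck_on k S (\<lambda>x. (-1) * dderiv f v x * (inverse (f x) * inverse (f x)))" for v
        by (intro Ck_on_mult assms(1) Ck_on_const Suc.IH)
    qed
  qed
  then show ?thesis by (simp add: smooth_on_def)
qed

lemma dderiv_sqrt:
  fixes f :: "'a::real_normed_vector \<Rightarrow> real"
  assumes "f differentiable at x" "f x > 0"
  shows "((\<lambda>x. sqrt (f x)) has_derivative (\<lambda>v. dderiv f v x * (inverse (sqrt (f x)) * (1/2)))) (at x)"
  using has_derivative_real_sqrt[OF assms(2) frechet_derivative_works[THEN iffD1, OF assms(1)]]
  by (simp add: field_simps)

text \<open>The induction runs on g = 1 / sqrt f, because its derivative -f' / (2 f) * g reproduces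
  g with smooth factors. At the end sqrt f = f * g.\<close>

lemma smooth_on_sqrt:
  fixes f :: "'a::real_normed_vector \<Rightarrow> real"
  assumes "open S" "smooth_on S f" "\<And>x. x \<in> S \<Longrightarrow> f x > 0"
  shows "smooth_on S (\<lambda>x. sqrt (f x))"
proof -
  let ?g = "\<lambda>x. inverse (sqrt (f x))"
  note df = smooth_on_imp_differentiable[OF assms(2)]
  have d: "(?g has_derivative (\<lambda>v. dderiv f v x * ((-1/2) * inverse (f x)) * ?g x)) (at x)" if "x \<in> S" for x
  proof -
    have p: "f x > 0" and nz: "sqrt (f x) \<noteq> 0" using assms(3)[OF that] by auto
    have s: "?g x * ?g x = inverse (f x)" using p by (simp flip: inverse_mult_distrib)
    show ?thesis
      by (rule has_derivative_eq_rhs[OF Deriv.has_derivative_inverse[OF nz dderiv_sqrt[OF df[OF that] p]]])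
        (simp add: s[symmetric] mult_ac fun_eq_iff)
  qed
  have i: "smooth_on S (\<lambda>x. inverse (f x))"
    using assms(3) by (intro smooth_on_inverse assms(1,2)) (simp add: less_imp_neq[symmetric])
  have "Ck_on k S ?g" for k
  proof (induction k)
    case 0 
    have "continuous_on S (\<lambda>x. sqrt (f x))"
      by (intro continuous_on_real_sqrt smooth_on_imp_continuous_on assms)
    then show ?case using assms(3) by (force intro!: continuous_on_inverse)
  next
    case (Suc k)
    show ?case
    proof (rule Ck_on_SucI[OF assms(1) d])
      have "Ck_on k S (dderiv f v)" "Ck_on k S (\<lambda>x. inverse (f x))" for v
        using smooth_on_dderiv[OF assms(2)] i unfolding smooth_on_def by blast+
      then show "Ck_on k S (\<lambda>x. dderiv f v x * ((-1/2) * inverse (f x)) * ?g x)" for v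
        by (intro Ck_on_mult assms(1) Ck_on_const Suc.IH)
    qed
  qed
  then have "smooth_on S (\<lambda>x. f x * ?g x)" using assms by (intro smooth_on_mult) (auto simp: smooth_on_def)
  moreover have "f x * ?g x = sqrt (f x)" if "x \<in> S" for x
    using assms(3)[OF that] by (simp add: field_simps)
  ultimately show ?thesis
    using smooth_on_cong[OF assms(1), of "\<lambda>x. f x * ?g x" "\<lambda>x. sqrt (f x)"] by simp
qed

section \<open>Expansion of derivatives in a basis, and compositions\<close>

lemma linear_vec_expand:
  fixes f :: "real^'n \<Rightarrow> real"
  assumes "linear f"
  shows "f v = (\<Sum>i\<in>UNIV. v $ i * f (axis i 1))"
proof -
  have "f v = f (\<Sum>i\<in>UNIV. v $ i *\<^sub>R axis i 1)"
    using basis_expansion[of v] by (simp add: scalar_mult_eq_scaleR)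
  also have "\<dots> = (\<Sum>i\<in>UNIV. v $ i * f (axis i 1))"
    using assms by (simp add: linear_sum linear_scale)
  finally show ?thesis .
qed

lemma dderiv_expand:
  fixes f :: "real^'n \<Rightarrow> real"
  assumes "f differentiable at x"
  shows "dderiv f v x = (\<Sum>i\<in>UNIV. v $ i * dderiv f (axis i 1) x)"
  by (rule linear_vec_expand) (rule linear_frechet_derivative[OF assms])

lemma dderiv_comp:
  fixes g :: "'a::real_normed_vector \<Rightarrow> 'b::real_normed_vector"
  assumes "g differentiable at x" "f differentiable at (g x)"
  shows "dderiv (\<lambda>x. f (g x)) v x = dderiv f (dderiv g v x) (g x)"
proof -
  have "((f \<circ> g) has_derivative (frechet_derivative f (at (g x)) \<circ> frechet_derivative g (at x))) (at x)"
    by (intro diff_chain_at frechet_derivative_works[THEN iffD1] assms)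
  from frechet_derivative_at[OF this] show ?thesis unfolding o_def by metis
qed

lemma Ck_on_inner:
  assumes "open S" "Ck_on k S (g :: 'a::real_normed_vector \<Rightarrow> 'b::euclidean_space)"
  shows "Ck_on k S (\<lambda>x. g x \<bullet> b)"
  using assms(2)
proof (induction k arbitrary: g)
  case 0 then show ?case by (simp add: continuous_on_inner)
next
  case (Suc k)
  note g = Ck_on_SucE[OF Suc.prems]
  show ?case
    by (intro Ck_on_SucI[OF assms(1), where D = "\<lambda>v x. dderiv g v x \<bullet> b"]
      bounded_linear.has_derivative[OF bounded_linear_inner_left] g Suc.IH)
qed

lemma dderiv_Basis_expand:
  fixes f :: "'a::euclidean_space \<Rightarrow> real"
  assumes "f differentiable at x"
  shows "dderiv f v x = (\<Sum>b\<in>Basis. (v \<bullet> b) * dderiv f b x)"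
proof -
  have l: "linear (frechet_derivative f (at x))" by (rule linear_frechet_derivative[OF assms])
  have "dderiv f v x = dderiv f (\<Sum>b\<in>Basis. (v \<bullet> b) *\<^sub>R b) x" by (simp add: euclidean_representation)
  also have "\<dots> = (\<Sum>b\<in>Basis. (v \<bullet> b) * dderiv f b x)"
    using l by (simp add: linear_sum linear_scale)
  finally show ?thesis .
qed

text \<open>Written in a basis, the chain rule gives a finite sum of products in which the partial
  derivatives of \<open>f\<close> are again composed with \<open>g\<close>. They are smooth on
  \<open>T\<close>, so the induction hypothesis, generalised over \<open>f\<close>, covers
  them.\<close>

lemma smooth_on_compose:
  fixes f :: "'b::euclidean_space \<Rightarrow> real" and g :: "'a::real_normed_vector \<Rightarrow> 'b"
  assumes "open S" "smooth_on T f" "smooth_on S g" "g ` S \<subseteq> T"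
  shows "smooth_on S (\<lambda>x. f (g x))"
proof -
  have gT: "g x \<in> T" if "x \<in> S" for x using assms(4) that by auto
  have "Ck_on k S (\<lambda>x. f (g x))" if "smooth_on T f" for k and f :: "'b \<Rightarrow> real"
    using that
  proof (induction k arbitrary: f)
    case 0
    from continuous_on_compose2[OF smooth_on_imp_continuous_on[OF 0] smooth_on_imp_continuous_on[OF assms(3)] assms(4)]
    show ?case by simp
  next
    case (Suc k)
    note df = smooth_on_has_derivative[OF Suc.prems gT] and dg = smooth_on_has_derivative[OF assms(3)]
    show ?case
    proof (rule Ck_on_SucI[OF assms(1), where D = "\<lambda>v x. \<Sum>b\<in>Basis. (dderiv g v x \<bullet> b) * dderiv f b (g x)"])
      show "((\<lambda>x. f (g x)) has_derivative (\<lambda>v. \<Sum>b\<in>Basis. (dderiv g v x \<bullet> b) * dderiv f b (g x))) (at x)"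
        if "x \<in> S" for x
        using diff_chain_at[OF dg df, OF that that]
        unfolding o_def dderiv_Basis_expand[OF smooth_on_imp_differentiable[OF Suc.prems gT[OF that]], of "dderiv g _ x"] .
      show "Ck_on k S (\<lambda>x. \<Sum>b\<in>Basis. (dderiv g v x \<bullet> b) * dderiv f b (g x))" for v
      proof (intro Ck_on_sum Ck_on_mult Ck_on_inner Suc.IH assms(1))
        show "Ck_on k S (dderiv g v)" using smooth_on_dderiv[OF assms(3)] unfolding smooth_on_def by blast
        show "smooth_on T (dderiv f b)" for b using Suc.prems by (rule smooth_on_dderiv)
      qed
    qed
  qed
  then show ?thesis using assms(2) by (simp add: smooth_on_def)
qed


section \<open>Flat functions and bump functions\<close>

text \<open>The powers of \<open>1 / t\<close> make this family closed under differentiation.\<close>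

definition exp_flat :: "nat \<Rightarrow> real \<Rightarrow> real" where
  "exp_flat m t = (if t \<le> 0 then 0 else exp (- inverse t) * inverse t ^ m)"

text \<open>Only the origin is delicate: the difference quotient is 0 from the left, and from the
  right it tends to 0 because exp (-1/h) beats every power of 1/h.\<close>

lemma exp_flat_has_derivative:
  "(exp_flat m has_real_derivative (exp_flat (m + 2) t - real m * exp_flat (m + 1) t)) (at t)"
proof -
  consider "t < 0" | "t = 0" | "t > 0" by linarith
  then show ?thesis
  proof cases
    case 1
    have "((\<lambda>_. 0) has_real_derivative 0) (at t)" by simp
    moreover have "eventually (\<lambda>x. x < 0) (nhds t)" using 1 by (rule order_tendstoD(2)[OF filterlim_ident])
    then have "eventually (\<lambda>x. 0 = exp_flat m x) (nhds t)" by eventually_elim (simp add: exp_flat_def)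
    ultimately have "(exp_flat m has_real_derivative 0) (at t)"
      using DERIV_cong_ev[of t t "\<lambda>_. 0" "exp_flat m" 0 0] by simp
    then show ?thesis using 1 by (simp add: exp_flat_def)
  next
    case 2
    have "((\<lambda>h. exp_flat m h / h) \<longlongrightarrow> 0) (at 0)"
    proof (rule filterlim_split_at)
      have "eventually (\<lambda>h::real. h < 0) (at_left 0)" by (simp add: eventually_at_left_field) (use lt_ex in blast)
      then have "eventually (\<lambda>h. 0 = exp_flat m h / h) (at_left 0)" by eventually_elim (simp add: exp_flat_def)
      then show "((\<lambda>h. exp_flat m h / h) \<longlongrightarrow> 0) (at_left 0)"
        using tendsto_cong[of "\<lambda>h. 0" "\<lambda>h. exp_flat m h / h" "at_left 0" 0] tendsto_const by blast
      have "((\<lambda>h. exp (- inverse h) * inverse h ^ m / h) \<longlongrightarrow> 0) (at_right (0::real))" by real_asymp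
      moreover have "eventually (\<lambda>h::real. h > 0) (at_right 0)" by (simp add: eventually_at_right_less)
      then have "eventually (\<lambda>h. exp (- inverse h) * inverse h ^ m / h = exp_flat m h / h) (at_right 0)"
        by eventually_elim (simp add: exp_flat_def)
      ultimately show "((\<lambda>h. exp_flat m h / h) \<longlongrightarrow> 0) (at_right 0)"
        by (rule Lim_transform_eventually)
    qed
    then have "(exp_flat m has_real_derivative 0) (at 0)"
      unfolding has_field_derivative_iff by (simp add: exp_flat_def[of m 0])
    then show ?thesis using 2 by (simp add: exp_flat_def)
  next
    case 3
    have "((\<lambda>x. exp (- inverse x) * inverse x ^ m) has_real_derivative
        (exp (- inverse t) * inverse t ^ (m + 2) - real m * (exp (- inverse t) * inverse t ^ (m + 1)))) (at t)"
    proof (cases m)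
      case 0
      then show ?thesis using 3 by (auto intro!: derivative_eq_intros simp: power2_eq_square)
    next
      case (Suc k)
      have "k = 0 \<or> t ^ k = t * t ^ (k - Suc 0)" by (cases k) auto
      with Suc show ?thesis using 3
        by (auto intro!: derivative_eq_intros simp: power2_eq_square field_simps)
    qed
    moreover have "eventually (\<lambda>x. x > 0) (nhds t)" using 3 by (rule order_tendstoD(1)[OF filterlim_ident])
    then have "eventually (\<lambda>x. exp (- inverse x) * inverse x ^ m = exp_flat m x) (nhds t)"
      by eventually_elim (simp add: exp_flat_def)
    ultimately have "(exp_flat m has_real_derivative (exp (- inverse t) * inverse t ^ (m + 2) - real m * (exp (- inverse t) * inverse t ^ (m + 1)))) (at t)"
      using DERIV_cong_ev[of t t "\<lambda>x. exp (- inverse x) * inverse x ^ m" "exp_flat m"] by simp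
    then show ?thesis using 3 by (simp add: exp_flat_def)
  qed
qed

lemma smooth_exp_flat: "smooth_on UNIV (exp_flat m)"
proof -
  have "Ck_on k UNIV (exp_flat m)" for k
  proof (induction k arbitrary: m)
    case 0
    show ?case using exp_flat_has_derivative[of m]
      by (auto intro!: continuous_at_imp_continuous_on DERIV_isCont)
  next
    case (Suc k)
    show ?case
    proof (rule Ck_on_SucI[OF open_UNIV, where D = "\<lambda>v t. v * (exp_flat (m + 2) t + (- real m) * exp_flat (m + 1) t)"])
      show "(exp_flat m has_derivative (\<lambda>v. v * (exp_flat (m + 2) t + (- real m) * exp_flat (m + 1) t))) (at t)" for t
        using exp_flat_has_derivative[of m t] by (simp add: has_field_derivative_def mult.commute[of _ "_ - _"] mult_commute_abs)
      show "Ck_on k UNIV (\<lambda>t. v * (exp_flat (m + 2) t + (- real m) * exp_flat (m + 1) t))" for v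
        by (intro Ck_on_mult Ck_on_add Ck_on_const open_UNIV Suc.IH)
    qed
  qed
  then show ?thesis by (simp add: smooth_on_def)
qed

lemma smooth_bump_exists:
  fixes a :: "'a::euclidean_space"
  assumes "0 < r" "r < R"
  obtains \<beta> :: "'a \<Rightarrow> real" where "smooth_on UNIV \<beta>" "\<And>x. 0 \<le> \<beta> x" "\<And>x. \<beta> x \<le> 1"
    "\<And>x. dist a x \<le> r \<Longrightarrow> \<beta> x = 1" "\<And>x. R \<le> dist a x \<Longrightarrow> \<beta> x = 0"
proof -
  let ?e = "exp_flat 0"
  \<comment> \<open>A smooth step from 0 (for t \<le> 0) to 1 (for t \<ge> 1); the denominator is
    positive since t or 1 - t is.\<close>
  define \<sigma> where "\<sigma> t = ?e t * inverse (?e t + ?e (1 - t))" for t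
  have e0: "0 \<le> ?e t" for t by (simp add: exp_flat_def)
  have pos: "?e t + ?e (1 - t) > 0" for t by (simp add: exp_flat_def add_pos_pos)
  have s1: "smooth_on UNIV (\<lambda>t::real. 1 - t)"
    by (intro smooth_on_minus smooth_on_const smooth_on_bounded_linear open_UNIV) simp
  have "smooth_on UNIV (\<lambda>t. ?e (1 - t))"
    by (rule smooth_on_compose[OF open_UNIV smooth_exp_flat s1]) simp
  then have "smooth_on UNIV \<sigma>" unfolding \<sigma>_def
    using less_imp_neq[OF pos, symmetric] by (intro smooth_on_mult smooth_on_inverse smooth_on_add smooth_exp_flat open_UNIV)
  \<comment> \<open>At least 1 within distance r of \<open>a\<close> and at most 0 from distance R
    on. Squared distances make it a polynomial in the coordinates, hence smooth also at
    \<open>a\<close>.\<close>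
  define q where "q x = (R^2 - (\<Sum>b\<in>Basis. (x \<bullet> b - a \<bullet> b) * (x \<bullet> b - a \<bullet> b))) * inverse (R^2 - r^2)" for x
  have c: "smooth_on UNIV (\<lambda>x. x \<bullet> b - a \<bullet> b)" for b
    by (rule smooth_on_minus[OF open_UNIV smooth_on_bounded_linear[OF bounded_linear_inner_left] smooth_on_const])
  have "smooth_on UNIV (\<lambda>x. \<Sum>b\<in>Basis. (x \<bullet> b - a \<bullet> b) * (x \<bullet> b - a \<bullet> b))"
    by (rule smooth_on_sum[OF open_UNIV smooth_on_mult[OF open_UNIV c c]])
  from smooth_on_mult[OF open_UNIV smooth_on_minus[OF open_UNIV smooth_on_const this] smooth_on_const]
  have "smooth_on UNIV q" unfolding q_def by blast
  have d: "(\<Sum>b\<in>Basis. (x \<bullet> b - a \<bullet> b) * (x \<bullet> b - a \<bullet> b)) = (dist a x)^2" for x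
    using euclidean_inner[of "x - a" "x - a"] unfolding inner_diff_left
    by (simp add: dist_norm norm_minus_commute[of a] power2_norm_eq_inner inner_diff_left)
  have q: "q x = (R^2 - (dist a x)^2) / (R^2 - r^2)" for x
    unfolding q_def d divide_inverse ..
  have Rr: "R^2 - r^2 > 0" using assms by (simp add: power_strict_mono)
  show thesis
  proof
    show "smooth_on UNIV (\<lambda>x. \<sigma> (q x))"
      by (rule smooth_on_compose[OF open_UNIV \<open>smooth_on UNIV \<sigma>\<close> \<open>smooth_on UNIV q\<close>]) simp
    show "0 \<le> \<sigma> (q x)" for x unfolding \<sigma>_def using pos[of "q x"] e0 by simp
    show "\<sigma> (q x) \<le> 1" for x unfolding \<sigma>_def using pos[of "q x"] e0[of "1 - q x"] by (simp add: field_simps)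
    show "\<sigma> (q x) = 1" if "dist a x \<le> r" for x
    proof -
      have "(dist a x)^2 \<le> r^2" using that by (simp add: power_mono)
      then have "q x \<ge> 1" unfolding q using Rr by (simp add: field_simps)
      then show ?thesis using pos[of "q x"] by (simp add: \<sigma>_def exp_flat_def[of 0 "1 - q x"])
    qed
    show "\<sigma> (q x) = 0" if "R \<le> dist a x" for x
    proof -
      have "R^2 \<le> (dist a x)^2" using that assms by (simp add: power_mono)
      then have "q x \<le> 0" unfolding q using Rr by (simp add: field_simps)
      then show ?thesis by (simp add: \<sigma>_def exp_flat_def[of 0 "q x"])
    qed
  qed
qed

section \<open>Integrals along segments, Hadamard's lemma, and integrals of derivatives\<close>

lemma segment_in_ball:
  fixes a :: "'a::real_normed_vector"
  assumes "x \<in> ball a R" "0 \<le> s" "s \<le> 1"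
  shows "a + s *\<^sub>R (x - a) \<in> ball a R"
proof -
  have "norm (s *\<^sub>R (x - a)) \<le> norm (x - a)" using assms(2,3) by (simp add: mult_left_le_one_le)
  then show ?thesis using assms(1) by (simp add: dist_norm norm_minus_commute)
qed

text \<open>The weight \<open>s ^ m\<close> absorbs the factor \<open>s\<close> of the chain rule, so that the formula can be iterated.\<close>

lemma segment_integral_has_derivative:
  fixes f :: "'a::euclidean_space \<Rightarrow> real"
  assumes "smooth_on (ball a R) f" "x \<in> ball a R"
  shows "((\<lambda>x. integral {0..1} (\<lambda>s. s ^ m * f (a + s *\<^sub>R (x - a)))) has_derivative
    (\<lambda>v. integral {0..1} (\<lambda>s. s ^ Suc m * dderiv f v (a + s *\<^sub>R (x - a))))) (at x)"
proof -
  let ?p = "\<lambda>x s. a + s *\<^sub>R (x - a)"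
  \<comment> \<open>\<open>leibniz_rule\<close> expects the derivative as a continuous family of
    bounded linear maps, hence the packaging by \<open>Blinfun\<close>.\<close>
  define D where "D x s = Blinfun (\<lambda>v. s ^ Suc m * dderiv f v (?p x s))" for x and s :: real
  have pin: "?p x s \<in> ball a R" if "x \<in> ball a R" "s \<in> {0..1}" for x s
    using segment_in_ball[OF that(1)] that(2) by simp
  have Dap: "blinfun_apply (D x s) = (\<lambda>v. s ^ Suc m * dderiv f v (?p x s))" if "x \<in> ball a R" "s \<in> {0..1}" for x s
  proof -
    have "bounded_linear (frechet_derivative f (at (?p x s)))"
      using smooth_on_has_derivative[OF assms(1) pin[OF that]] has_derivative_bounded_linear by blast
    then show ?thesis unfolding D_def by (intro bounded_linear_Blinfun_apply bounded_linear_const_mult)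
  qed
  have cp: "continuous_on (ball a R \<times> {0..1}) (\<lambda>z. ?p (fst z) (snd z))"
    by (intro continuous_intros)
  have im: "(\<lambda>z. ?p (fst z) (snd z)) ` (ball a R \<times> {0..1}) \<subseteq> ball a R" using pin by force
  have "((\<lambda>x. integral (cbox 0 1) (\<lambda>s. s ^ m * f (?p x s))) has_derivative
     blinfun_apply (integral (cbox 0 1) (D x))) (at x within ball a R)"
  proof (rule leibniz_rule)
    fix x and s :: real assume xs: "x \<in> ball a R" "s \<in> cbox 0 1"
    then have s: "s \<in> {0..1}" by simp
    have "((\<lambda>x. ?p x s) has_derivative (\<lambda>v. s *\<^sub>R v)) (at x)"
      by (auto intro!: derivative_eq_intros)
    from diff_chain_at[OF this smooth_on_has_derivative[OF assms(1) pin[OF xs(1) s]]]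
    have d: "((\<lambda>x. f (?p x s)) has_derivative (\<lambda>v. dderiv f (s *\<^sub>R v) (?p x s))) (at x)" by (simp add: o_def)
    have "linear (frechet_derivative f (at (?p x s)))"
      by (rule linear_frechet_derivative[OF smooth_on_imp_differentiable[OF assms(1) pin[OF xs(1) s]]])
    then have "dderiv f (s *\<^sub>R v) (?p x s) = s * dderiv f v (?p x s)" for v by (simp add: linear_scale)
    with d have "((\<lambda>x. s ^ m * f (?p x s)) has_derivative blinfun_apply (D x s)) (at x)"
      unfolding Dap[OF xs(1) s] using has_derivative_mult_right[OF d, of "s ^ m"] by (simp add: mult_ac)
    then show "((\<lambda>x. s ^ m * f (?p x s)) has_derivative blinfun_apply (D x s)) (at x within ball a R)"
      by (rule has_derivative_at_withinI)
  next
    fix x assume x: "x \<in> ball a R"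
    have "continuous_on {0..1} (\<lambda>s. f (?p x s))"
      by (rule continuous_on_compose2[OF smooth_on_imp_continuous_on[OF assms(1)]])
        (use pin[OF x] in \<open>auto intro!: continuous_intros\<close>)
    then show "(\<lambda>s. s ^ m * f (?p x s)) integrable_on cbox 0 1"
      by (intro integrable_continuous) (auto intro!: continuous_intros)
  next
    have "continuous_on (ball a R \<times> cbox 0 1) (\<lambda>z. D (fst z) (snd z))"
    proof (rule continuous_on_blinfun_componentwise)
      fix i :: 'a
      have "continuous_on (ball a R \<times> {0..1}) (\<lambda>z. dderiv f i (?p (fst z) (snd z)))"
        by (rule continuous_on_compose2[OF smooth_on_imp_continuous_on[OF smooth_on_dderiv[OF assms(1)]] cp im])
      then have "continuous_on (ball a R \<times> {0..1}) (\<lambda>z. snd z ^ Suc m * dderiv f i (?p (fst z) (snd z)))"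
        by (intro continuous_intros)
      moreover have "blinfun_apply (D (fst z) (snd z)) i = snd z ^ Suc m * dderiv f i (?p (fst z) (snd z))"
        if "z \<in> ball a R \<times> {0..1}" for z using that Dap[of "fst z" "snd z"] by auto
      ultimately show "continuous_on (ball a R \<times> cbox 0 1) (\<lambda>z. blinfun_apply (D (fst z) (snd z)) i)"
        by (simp cong: continuous_on_cong)
    qed
    then show cD: "continuous_on (ball a R \<times> cbox 0 1) (\<lambda>(x, t). D x t)" by (simp add: case_prod_unfold)
  qed (use assms in auto)
  moreover have "blinfun_apply (integral (cbox 0 1) (D x)) v = integral {0..1} (\<lambda>s. s ^ Suc m * dderiv f v (?p x s))" for v
  proof -
    have "continuous_on (cbox 0 1) (D x)"
    proof (rule continuous_on_blinfun_componentwise)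
      fix i :: 'a
      have "continuous_on {0..1} (\<lambda>s. dderiv f i (?p x s))"
        by (rule continuous_on_compose2[OF smooth_on_imp_continuous_on[OF smooth_on_dderiv[OF assms(1)]]])
          (use pin[OF assms(2)] in \<open>auto intro!: continuous_intros\<close>)
      then have "continuous_on {0..1} (\<lambda>s. s ^ Suc m * dderiv f i (?p x s))"
        by (intro continuous_intros)
      then show "continuous_on (cbox 0 1) (\<lambda>s. blinfun_apply (D x s) i)"
        unfolding box_real by (rule continuous_on_eq) (simp add: Dap[OF assms(2)])
    qed
    then have "D x integrable_on cbox 0 1" by (rule integrable_continuous)
    from integral_linear[OF this bounded_bilinear.bounded_linear_left[OF bounded_bilinear_blinfun_apply, of v]]
    have "blinfun_apply (integral (cbox 0 1) (D x)) v = integral (cbox 0 1) (\<lambda>s. blinfun_apply (D x s) v)"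
      by (simp add: o_def)
    also have "\<dots> = integral {0..1} (\<lambda>s. s ^ Suc m * dderiv f v (?p x s))"
      using Dap[OF assms(2)] by (auto intro!: integral_cong)
    finally show ?thesis .
  qed
  then have "blinfun_apply (integral (cbox 0 1) (D x)) = (\<lambda>v. integral {0..1} (\<lambda>s. s ^ Suc m * dderiv f v (?p x s)))"
    by (rule ext)
  ultimately show ?thesis unfolding at_within_open[OF assms(2) open_ball] box_real by simp
qed

lemma smooth_on_segment_integral:
  fixes f :: "'a::euclidean_space \<Rightarrow> real"
  assumes "smooth_on (ball a R) f"
  shows "smooth_on (ball a R) (\<lambda>x. integral {0..1} (\<lambda>s. f (a + s *\<^sub>R (x - a))))"
proof -
  have "Ck_on k (ball a R) (\<lambda>x. integral {0..1} (\<lambda>s. s ^ m * f (a + s *\<^sub>R (x - a))))"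
    if "smooth_on (ball a R) f" for k m and f :: "'a \<Rightarrow> real"
    using that
  proof (induction k arbitrary: f m)
    case 0
    have "isCont (\<lambda>x. integral {0..1} (\<lambda>s. s ^ m * f (a + s *\<^sub>R (x - a)))) x" if "x \<in> ball a R" for x
      using segment_integral_has_derivative[OF 0 that] by (rule has_derivative_continuous)
    then show ?case by (simp add: continuous_at_imp_continuous_on)
  next
    case (Suc k)
    show ?case
      by (rule Ck_on_SucI[OF open_ball segment_integral_has_derivative[OF Suc.prems] Suc.IH[OF smooth_on_dderiv[OF Suc.prems]]])
  qed
  from this[OF assms, of _ 0] show ?thesis by (simp add: smooth_on_def)
qed

text \<open>The fundamental theorem of calculus on the segment from \<open>a\<close> to x writes f x
  - f a as the integral of the derivative in direction x - a. Expanding this direction in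
  coordinates leaves the averaged partial derivatives as \<open>h i\<close>. The lemma serves to
  show that every derivation comes from a coordinate vector.\<close>

lemma Hadamard_expansion:
  fixes f :: "real^'n \<Rightarrow> real"
  assumes f: "smooth_on (ball a R) f" and "R > 0"
  obtains h where "\<And>i. smooth_on (ball a R) (h i)"
    "\<And>x. x \<in> ball a R \<Longrightarrow> f x = f a + (\<Sum>i\<in>UNIV. (x $ i - a $ i) * h i x)"
    "\<And>i. h i a = dderiv f (axis i 1) a"
proof
  let ?p = "\<lambda>x s. a + s *\<^sub>R (x - a)"
  let ?h = "\<lambda>i x. integral {0..1} (\<lambda>s. dderiv f (axis i 1) (?p x s))"
  show "smooth_on (ball a R) (?h i)" for i
    by (rule smooth_on_segment_integral[OF smooth_on_dderiv[OF f]])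
  show "?h i a = dderiv f (axis i 1) a" for i by simp
  fix x assume x: "x \<in> ball a R"
  have pin: "?p x s \<in> ball a R" if "s \<in> {0..1}" for s
    using segment_in_ball[OF x] that by simp
  have "((\<lambda>s. dderiv f (x - a) (?p x s)) has_integral (f (?p x 1) - f (?p x 0))) {0..1}"
  proof (rule fundamental_theorem_of_calculus)
    fix s :: real assume s: "s \<in> {0..1}"
    have "((\<lambda>s. ?p x s) has_derivative (\<lambda>t. t *\<^sub>R (x - a))) (at s)"
      by (auto intro!: derivative_eq_intros)
    from diff_chain_at[OF this smooth_on_has_derivative[OF f pin[OF s]]]
    have d: "((\<lambda>s. f (?p x s)) has_derivative (\<lambda>t. dderiv f (t *\<^sub>R (x - a)) (?p x s))) (at s)" by (simp add: o_def)
    have "linear (frechet_derivative f (at (?p x s)))"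
      by (rule linear_frechet_derivative[OF smooth_on_imp_differentiable[OF f pin[OF s]]])
    then have "dderiv f (t *\<^sub>R (x - a)) (?p x s) = t *\<^sub>R dderiv f (x - a) (?p x s)" for t by (rule linear_scale)
    with d show "((\<lambda>s. f (?p x s)) has_vector_derivative dderiv f (x - a) (?p x s)) (at s within {0..1})"
      by (simp add: has_vector_derivative_def has_derivative_at_withinI)
  qed simp
  then have "f x - f a = integral {0..1} (\<lambda>s. dderiv f (x - a) (?p x s))" by (simp add: integral_unique)
  also have "\<dots> = integral {0..1} (\<lambda>s. \<Sum>i\<in>UNIV. (x $ i - a $ i) * dderiv f (axis i 1) (?p x s))"
  proof (rule integral_cong)
    fix s :: real assume s: "s \<in> {0..1}"
    show "dderiv f (x - a) (?p x s) = (\<Sum>i\<in>UNIV. (x $ i - a $ i) * dderiv f (axis i 1) (?p x s))"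
      using dderiv_expand[OF smooth_on_imp_differentiable[OF f pin[OF s]], of "x - a"] unfolding vector_minus_component .
  qed
  also have "\<dots> = (\<Sum>i\<in>UNIV. integral {0..1} (\<lambda>s. (x $ i - a $ i) * dderiv f (axis i 1) (?p x s)))"
  proof (rule integral_sum[OF finite])
    fix i
    have "continuous_on {0..1} (\<lambda>s. dderiv f (axis i 1) (?p x s))"
      by (rule continuous_on_compose2[OF smooth_on_imp_continuous_on[OF smooth_on_dderiv[OF f]]])
        (use pin in \<open>auto intro!: continuous_intros\<close>)
    then show "(\<lambda>s. (x $ i - a $ i) * dderiv f (axis i 1) (?p x s)) integrable_on {0..1}"
      by (intro integrable_continuous_real continuous_intros)
  qed
  also have "\<dots> = (\<Sum>i\<in>UNIV. (x $ i - a $ i) * ?h i x)" by simp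
  finally show "f x = f a + (\<Sum>i\<in>UNIV. (x $ i - a $ i) * ?h i x)" by simp
qed

text \<open>Translation invariance in place of Fubini: the integral of f (x + s v) over a large box
  does not depend on s for |s| \<le> 1, and differentiating under the integral at s = 0 gives the
  integral of the directional derivative.\<close>

lemma integral_dderiv_compact_support:
  fixes f :: "'a::euclidean_space \<Rightarrow> real"
  assumes f: "smooth_on UNIV f" and "compact K" and fK: "\<And>x. x \<notin> K \<Longrightarrow> f x = 0"
  shows "(dderiv f v has_integral 0) UNIV"
proof -
  have cf: "continuous_on S f" "continuous_on S (dderiv f v)" for S
    using smooth_on_imp_continuous_on[OF f] smooth_on_imp_continuous_on[OF smooth_on_dderiv[OF f]]
      continuous_on_subset by blast+
  \<comment> \<open>All translates of \<open>K\<close> by s v with |s| \<le> 1. A box around them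
    contains the support of every shifted function.\<close>
  define K' where "K' = (\<lambda>(s, x). x + s *\<^sub>R v) ` (cball 0 1 \<times> K)"
  have "compact K'" unfolding K'_def
    by (intro compact_continuous_image compact_Times assms compact_cball) (auto intro!: continuous_intros simp: case_prod_unfold)
  then obtain c where c: "K' \<subseteq> cbox (-c) c" using compact_imp_bounded bounded_subset_cbox_symmetric by blast
  have sub: "K \<subseteq> cbox (-c + s *\<^sub>R v) (c + s *\<^sub>R v)" if "\<bar>s\<bar> \<le> 1" for s
  proof
    fix x assume "x \<in> K"
    then have "x + (-s) *\<^sub>R v \<in> K'" unfolding K'_def using that by (force intro!: image_eqI[of _ _ "(-s, x)"])
    then have "x - s *\<^sub>R v \<in> cbox (-c) c" using c by auto
    then show "x \<in> cbox (-c + s *\<^sub>R v) (c + s *\<^sub>R v)" by (auto simp: mem_box inner_diff_left inner_add_left algebra_simps)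
  qed
  define I where "I s = integral (cbox (-c) c) (\<lambda>x. f (x + s *\<^sub>R v))" for s
  have I: "I s = integral UNIV f" if "\<bar>s\<bar> \<le> 1" for s
  proof -
    have "I s = integral (cbox (-c + s *\<^sub>R v) (c + s *\<^sub>R v)) f"
      using integral_shift_cbox_plus[of "-c" c f "s *\<^sub>R v"] by (simp add: I_def o_def add.commute)
    also have "\<dots> = integral UNIV f"
    proof -
      have "f integrable_on cbox (-c + s *\<^sub>R v) (c + s *\<^sub>R v)" by (intro integrable_continuous cf)
      then have "(f has_integral integral (cbox (-c + s *\<^sub>R v) (c + s *\<^sub>R v)) f) UNIV"
        by (intro has_integral_on_superset[OF integrable_integral]) (use fK sub[OF that] in auto)
      then show ?thesis by (rule integral_unique[symmetric])
    qed
    finally show ?thesis .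
  qed
  have "((\<lambda>s. integral (cbox (-c) c) (\<lambda>x. f (x + s *\<^sub>R v))) has_vector_derivative
      integral (cbox (-c) c) (\<lambda>x. dderiv f v (x + 0 *\<^sub>R v))) (at 0 within {-1..1})"
  proof (rule leibniz_rule_vector_derivative)
    fix s x
    have "((\<lambda>s. x + s *\<^sub>R v) has_derivative (\<lambda>t. t *\<^sub>R v)) (at s)"
      by (auto intro!: derivative_eq_intros)
    from diff_chain_at[OF this smooth_on_has_derivative[OF f UNIV_I]]
    have d: "((\<lambda>s. f (x + s *\<^sub>R v)) has_derivative (\<lambda>t. dderiv f (t *\<^sub>R v) (x + s *\<^sub>R v))) (at s)" by (simp add: o_def)
    have "linear (frechet_derivative f (at (x + s *\<^sub>R v)))"
      by (rule linear_frechet_derivative[OF smooth_on_imp_differentiable[OF f UNIV_I]])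
    then have "dderiv f (t *\<^sub>R v) (x + s *\<^sub>R v) = t *\<^sub>R dderiv f v (x + s *\<^sub>R v)" for t by (rule linear_scale)
    with d show "((\<lambda>s. f (x + s *\<^sub>R v)) has_vector_derivative dderiv f v (x + s *\<^sub>R v)) (at s within {-1..1})"
      by (simp add: has_vector_derivative_def has_derivative_at_withinI)
  next
    show "(\<lambda>x. f (x + s *\<^sub>R v)) integrable_on cbox (-c) c" for s
      by (intro integrable_continuous continuous_on_compose2[OF cf(1)[of UNIV]]) (auto intro!: continuous_intros)
  next
    show "continuous_on ({-1..1} \<times> cbox (-c) c) (\<lambda>(s, x). dderiv f v (x + s *\<^sub>R v))"
      unfolding case_prod_unfold
      by (intro continuous_on_compose2[OF cf(2)[of UNIV]]) (auto intro!: continuous_intros)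
  qed auto
  then have "(I has_vector_derivative integral (cbox (-c) c) (dderiv f v)) (at 0 within {-1..1})"
    by (simp add: I_def[abs_def])
  then have h1: "((\<lambda>s. integral UNIV f) has_vector_derivative integral (cbox (-c) c) (dderiv f v)) (at 0 within {-1..1})"
    by (rule has_vector_derivative_transform[rotated -1]) (auto simp: I)
  have h2: "((\<lambda>s. integral UNIV f) has_vector_derivative 0) (at 0 within {-1..1})" by simp
  have 0: "integral (cbox (-c) c) (dderiv f v) = 0"
    using vector_derivative_unique_within_closed_interval[of "-1::real" 1 0, unfolded box_real, OF _ _ h1 h2] by simp
  have "dderiv f v integrable_on cbox (-c) c" by (intro integrable_continuous cf)
  then have "(dderiv f v has_integral 0) (cbox (-c) c)" using integrable_integral[of "dderiv f v" "cbox (-c) c"] 0 by simp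
  then show ?thesis
  proof (rule has_integral_on_superset)
    fix x assume x: "x \<notin> cbox (-c) c"
    have o: "open (- K)" using compact_imp_closed[OF assms(2)] by (simp add: open_Compl)
    have "x \<in> - K" using x sub[of 0] by auto
    from frechet_derivative_cong_open[OF o this, of f "\<lambda>_. 0"] show "dderiv f v x = 0" using fK by simp
  qed simp
qed

section \<open>Tangent vectors in charts\<close>

definition cimg :: "'m set \<times> ('m \<Rightarrow> 'e) \<Rightarrow> 'e set" where
  "cimg c = snd c ` fst c"

definition cinv :: "'m set \<times> ('m \<Rightarrow> 'e) \<Rightarrow> 'e \<Rightarrow> 'm" where
  "cinv c = inv_into (fst c) (snd c)"

lemma smooth_fun_iff: "smooth_fun A f \<longleftrightarrow> (\<forall>c\<in>A. smooth_on (cimg c) (\<lambda>x. f (cinv c x)))"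
  by (auto simp: smooth_fun_def cimg_def cinv_def o_def split_beta)

text \<open>The model space is \<open>real^'n\<close>, so that matrices and determinants are at
  hand; other Euclidean model spaces are brought into this form by \<open>vec_atlas\<close>.\<close>

locale vec_manifold =
  fixes A :: "('m::{t2_space,second_countable_topology}, real^'n) atlas"
  assumes atlas: "smooth_atlas A"
begin

lemma chart:
  assumes "c \<in> A"
  shows open_dom: "open (fst c)" and open_cimg: "open (cimg c)"
    and cont_crd: "continuous_on (fst c) (snd c)" and cont_cinv: "continuous_on (cimg c) (cinv c)"
    and cinv_crd: "\<And>p. p \<in> fst c \<Longrightarrow> cinv c (snd c p) = p"
    and crd_cinv: "\<And>x. x \<in> cimg c \<Longrightarrow> snd c (cinv c x) = x"
proof -
  have "is_chart (fst c) (snd c)" using atlas assms by (auto simp: smooth_atlas_def split_beta)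
  then have h: "open (fst c)" "open (cimg c)" "homeomorphism (fst c) (cimg c) (snd c) (cinv c)"
    by (auto simp: is_chart_def cimg_def cinv_def)
  then show "open (fst c)" "open (cimg c)" "continuous_on (fst c) (snd c)" "continuous_on (cimg c) (cinv c)"
    "\<And>p. p \<in> fst c \<Longrightarrow> cinv c (snd c p) = p" "\<And>x. x \<in> cimg c \<Longrightarrow> snd c (cinv c x) = x"
    by (auto simp: homeomorphism_def)
qed

lemma crd_in: "p \<in> fst c \<Longrightarrow> snd c p \<in> cimg c"
  by (simp add: cimg_def)

lemma cinv_in: "x \<in> cimg c \<Longrightarrow> cinv c x \<in> fst c"
  unfolding cimg_def cinv_def by (rule inv_into_into)

lemma chart_at: obtains c where "c \<in> A" "p \<in> fst c"
proof -
  have "p \<in> (\<Union>(U, \<phi>)\<in>A. U)" using atlas by (simp add: smooth_atlas_def)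
  then show thesis using that by fastforce
qed

lemma open_crd_image:
  assumes "c \<in> A" "open V"
  shows "open (snd c ` (fst c \<inter> V))"
proof -
  have "snd c ` (fst c \<inter> V) = cinv c -` V \<inter> cimg c"
  proof (intro equalityI subsetI)
    show "x \<in> cinv c -` V \<inter> cimg c" if "x \<in> snd c ` (fst c \<inter> V)" for x
      using that cinv_crd[OF assms(1)] by (auto simp: cimg_def)
    show "x \<in> snd c ` (fst c \<inter> V)" if "x \<in> cinv c -` V \<inter> cimg c" for x
      using that cinv_in[of x c] crd_cinv[OF assms(1), of x] by (intro image_eqI[of _ _ "cinv c x"]) auto
  qed
  then show ?thesis
    using continuous_on_open_vimage[OF open_cimg[OF assms(1)], of "cinv c"] cont_cinv[OF assms(1)] assms(2) by simp
qed

lemma open_crd_vimage: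
  assumes "c \<in> A" "open S"
  shows "open {q \<in> fst c. snd c q \<in> S}"
proof -
  have "{q \<in> fst c. snd c q \<in> S} = snd c -` S \<inter> fst c" by auto
  then show ?thesis
    using continuous_on_open_vimage[OF open_dom[OF assms(1)], of "snd c"] cont_crd[OF assms(1)] assms(2) by simp
qed

lemma transition_smooth:
  assumes "c \<in> A" "d \<in> A"
  shows "smooth_on (snd c ` (fst c \<inter> fst d)) (\<lambda>x. snd d (cinv c x))"
  using atlas assms by (auto simp: smooth_atlas_def cinv_def o_def split_beta)

lemma smooth_fun_const: "smooth_fun A (\<lambda>_. k)"
  by (simp add: smooth_fun_iff smooth_on_const)

lemma smooth_fun_add: "smooth_fun A f \<Longrightarrow> smooth_fun A h \<Longrightarrow> smooth_fun A (\<lambda>x. f x + h x)"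
  unfolding smooth_fun_iff using open_cimg smooth_on_add by blast

lemma smooth_fun_mult: "smooth_fun A f \<Longrightarrow> smooth_fun A h \<Longrightarrow> smooth_fun A (\<lambda>x. f x * h x)"
  unfolding smooth_fun_iff using open_cimg smooth_on_mult by blast

lemma smooth_fun_minus: "smooth_fun A f \<Longrightarrow> smooth_fun A h \<Longrightarrow> smooth_fun A (\<lambda>x. f x - h x)"
  unfolding smooth_fun_iff using open_cimg smooth_on_minus by blast

lemma smooth_fun_sum:
  assumes "\<And>i. i \<in> I \<Longrightarrow> smooth_fun A (f i)"
  shows "smooth_fun A (\<lambda>x. \<Sum>i\<in>I. f i x)"
  using assms unfolding smooth_fun_iff by (intro ballI smooth_on_sum open_cimg) auto

lemma smooth_fun_prod:
  assumes "\<And>i. i \<in> I \<Longrightarrow> smooth_fun A (f i)"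
  shows "smooth_fun A (\<lambda>x. \<Prod>i\<in>I. f i x)"
  using assms unfolding smooth_fun_iff by (intro ballI smooth_on_prod open_cimg) auto

lemma smooth_fun_D: "smooth_fun A f \<Longrightarrow> c \<in> A \<Longrightarrow> smooth_on (cimg c) (\<lambda>x. f (cinv c x))"
  by (simp add: smooth_fun_iff)

lemma smooth_fun_continuous:
  assumes "smooth_fun A f" shows "continuous_on S f"
proof -
  have "isCont f p" for p
  proof -
    obtain c where c: "c \<in> A" "p \<in> fst c" by (rule chart_at)
    have "continuous_on (fst c) (\<lambda>q. f (cinv c (snd c q)))"
      by (rule continuous_on_compose2[OF smooth_on_imp_continuous_on[OF smooth_fun_D[OF assms c(1)]] cont_crd[OF c(1)]])
        (auto simp: cimg_def)
    then have "continuous_on (fst c) f" by (rule continuous_on_eq) (simp add: cinv_crd[OF c(1)])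
    then show ?thesis using c open_dom continuous_on_eq_continuous_at by blast
  qed
  then show ?thesis by (simp add: continuous_at_imp_continuous_on)
qed

text \<open>Two open sets cover the manifold: the complement of \<open>K\<close>, where
  \<open>h\<close> vanishes, and the part of the chart with coordinates in \<open>S\<close>, where
  \<open>h\<close> is \<open>F\<close> in coordinates. Seen from another chart the latter is
  \<open>F\<close> after a smooth transition map.\<close>

lemma smooth_fun_extend:
  assumes c: "c \<in> A" and S: "open S" "S \<subseteq> cimg c" "smooth_on S F" and K: "closed K" "K \<subseteq> cinv c ` S"
    and h: "\<And>p. p \<in> fst c \<Longrightarrow> snd c p \<in> S \<Longrightarrow> h p = F (snd c p)" "\<And>p. p \<notin> K \<Longrightarrow> h p = 0"
  shows "smooth_fun A h"
  unfolding smooth_fun_iff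
proof (intro ballI smooth_on_local)
  fix d x assume d: "d \<in> A" and x: "x \<in> cimg d"
  show "\<exists>T. open T \<and> x \<in> T \<and> smooth_on T (\<lambda>x. h (cinv d x))"
  proof (cases "cinv d x \<in> K")
    case False
    let ?T = "snd d ` (fst d \<inter> - K)"
    have T: "open ?T" using open_crd_image[OF d] K(1) by (simp add: open_Compl)
    have "x \<in> ?T" using False cinv_in[OF x] crd_cinv[OF d x] by (metis ComplI IntI image_eqI)
    moreover have "h (cinv d y) = 0" if "y \<in> ?T" for y using that cinv_crd[OF d] h(2) by auto
    then have "smooth_on ?T (\<lambda>x. h (cinv d x))"
      using smooth_on_cong[OF T, of "\<lambda>x. h (cinv d x)" "\<lambda>_. 0"] smooth_on_const[of ?T 0] by simp
    ultimately show ?thesis using T by blast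
  next
    case True
    let ?W = "{q \<in> fst c. snd c q \<in> S}"
    let ?T = "snd d ` (fst d \<inter> ?W)"
    have T: "open ?T" by (rule open_crd_image[OF d open_crd_vimage[OF c S(1)]])
    obtain y where "y \<in> S" "cinv d x = cinv c y" using True K(2) by blast
    then have W: "cinv d x \<in> ?W" using S(2) cinv_in[of y c] crd_cinv[OF c, of y] by auto
    then have "x \<in> ?T" using cinv_in[OF x] crd_cinv[OF d x] by (intro image_eqI[of _ _ "cinv d x"]) auto
    moreover have "smooth_on ?T (\<lambda>x. F (snd c (cinv d x)))"
    proof (rule smooth_on_compose[OF T S(3)])
      show "smooth_on ?T (\<lambda>x. snd c (cinv d x))"
        by (rule smooth_on_subset[OF transition_smooth[OF d c]]) auto
      show "(\<lambda>x. snd c (cinv d x)) ` ?T \<subseteq> S" using cinv_crd[OF d] by auto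
    qed
    moreover have "h (cinv d y) = F (snd c (cinv d y))" if "y \<in> ?T" for y
      using that cinv_crd[OF d] h(1) by auto
    ultimately show ?thesis
      using T smooth_on_cong[OF T, of "\<lambda>x. h (cinv d x)" "\<lambda>x. F (snd c (cinv d x))"] by blast
  qed
qed

text \<open>Two nested sets are recorded: on the open \<open>W\<close> the cut-off changes nothing,
  and the compact \<open>K\<close> inside the chart makes extension by zero smooth.\<close>

definition chart_bump :: "'m set \<times> ('m \<Rightarrow> real^'n) \<Rightarrow> 'm set \<Rightarrow> ('m \<Rightarrow> real) \<Rightarrow> 'm set \<Rightarrow> bool" where
  "chart_bump c W \<eta> K \<longleftrightarrow> smooth_fun A \<eta> \<and> (\<forall>q. 0 \<le> \<eta> q \<and> \<eta> q \<le> 1) \<and> open W \<and> W \<subseteq> K \<and> compact K \<and> K \<subseteq> fst c \<and>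
     (\<forall>q\<in>W. \<eta> q = 1) \<and> (\<forall>q. q \<notin> K \<longrightarrow> \<eta> q = 0)"

lemma chart_bump_exists:
  assumes c: "c \<in> A" and p: "p \<in> fst c" "open V" "p \<in> V"
  obtains W \<eta> K where "chart_bump c W \<eta> K" "p \<in> W" "K \<subseteq> V"
proof -
  let ?S = "snd c ` (fst c \<inter> V)"
  have S: "open ?S" "?S \<subseteq> cimg c" using open_crd_image[OF c p(2)] by (auto simp: cimg_def)
  let ?x = "snd c p"
  obtain R where R: "R > 0" "cball ?x R \<subseteq> ?S"
    using S(1) p open_contains_cball by (metis IntI image_eqI)
  obtain \<beta> :: "real^'n \<Rightarrow> real" where b: "smooth_on UNIV \<beta>" "\<And>x. 0 \<le> \<beta> x" "\<And>x. \<beta> x \<le> 1"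
    "\<And>x. dist ?x x \<le> R / 2 \<Longrightarrow> \<beta> x = 1" "\<And>x. R \<le> dist ?x x \<Longrightarrow> \<beta> x = 0"
    using smooth_bump_exists[of "R / 2" R ?x] R(1) by auto
  define K where "K = cinv c ` cball ?x R"
  define W where "W = {q \<in> fst c. snd c q \<in> ball ?x (R / 2)}"
  define \<eta> where "\<eta> q = (if q \<in> fst c then \<beta> (snd c q) else 0)" for q
  have cb: "cball ?x R \<subseteq> cimg c" using R S by blast
  have K: "compact K" unfolding K_def
    by (rule compact_continuous_image[OF continuous_on_subset[OF cont_cinv[OF c] cb] compact_cball])
  have KV: "K \<subseteq> fst c \<inter> V" unfolding K_def using R(2) cinv_crd[OF c] by auto
  have inK: "q \<in> K" if "q \<in> fst c" "dist ?x (snd c q) \<le> R" for q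
    unfolding K_def using that cinv_crd[OF c that(1)] by (metis imageI mem_cball)
  have z: "\<eta> q = 0" if "q \<notin> K" for q
    using inK[of q] that b(5)[of "snd c q"] linear[of R "dist ?x (snd c q)"] by (auto simp: \<eta>_def)
  have "smooth_fun A \<eta>"
  proof (rule smooth_fun_extend[OF c open_cimg[OF c] subset_refl _ compact_imp_closed[OF K]])
    show "smooth_on (cimg c) \<beta>" using b(1) by (rule smooth_on_subset) simp
    show "K \<subseteq> cinv c ` cimg c" unfolding K_def using cb by blast
    show "\<eta> q = \<beta> (snd c q)" if "q \<in> fst c" for q using that by (simp add: \<eta>_def)
  qed (rule z)
  moreover have "open W" unfolding W_def by (rule open_crd_vimage[OF c]) simp
  moreover have "W \<subseteq> K" unfolding W_def using inK R(1) by auto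
  moreover have "\<eta> q = 1" if "q \<in> W" for q using that b(4)[of "snd c q"] by (simp add: W_def \<eta>_def)
  ultimately have "chart_bump c W \<eta> K"
    unfolding chart_bump_def using K KV z b(2,3) by (auto simp: \<eta>_def)
  moreover have "p \<in> W" using p R(1) by (simp add: W_def)
  ultimately show thesis using that KV by blast
qed

text \<open>\<open>S\<close> may be smaller than the image of the chart because the functions from
  Hadamard's lemma exist only on a ball.\<close>

lemma smooth_fun_bump_extend:
  assumes c: "c \<in> A" and b: "smooth_fun A \<eta>" "compact K" "K \<subseteq> fst c" "\<And>q. q \<notin> K \<Longrightarrow> \<eta> q = 0"
    and S: "open S" "S \<subseteq> cimg c" "K \<subseteq> cinv c ` S" and F: "smooth_on S F"
  shows "smooth_fun A (\<lambda>q. if q \<in> fst c then \<eta> q * F (snd c q) else 0)"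
proof (rule smooth_fun_extend[OF c S(1,2) _ compact_imp_closed[OF b(2)] S(3)])
  show "smooth_on S (\<lambda>x. \<eta> (cinv c x) * F x)"
    by (rule smooth_on_mult[OF S(1) smooth_on_subset[OF smooth_fun_D[OF b(1) c] S(2)] F])
qed (auto simp: cinv_crd[OF c] b(4))

text \<open>Components of tensors in a chart are not global functions. Near each point they agree
  with the tensor evaluated on cut-off coordinate fields, and this suffices for smoothness in the
  chart.\<close>

lemma smooth_on_from_local_fun:
  assumes c: "c \<in> A" and "\<And>p. p \<in> fst c \<Longrightarrow> \<exists>W f. open W \<and> p \<in> W \<and> smooth_fun A f \<and> (\<forall>q\<in>W \<inter> fst c. Q q = f q)"
  shows "smooth_on (cimg c) (\<lambda>x. Q (cinv c x))"
proof (rule smooth_on_local)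
  fix x assume x: "x \<in> cimg c"
  obtain W f where W: "open W" "cinv c x \<in> W" "smooth_fun A f" "\<forall>q\<in>W \<inter> fst c. Q q = f q"
    using assms(2)[OF cinv_in[OF x]] by blast
  let ?T = "snd c ` (fst c \<inter> W)"
  have T: "open ?T" by (rule open_crd_image[OF c W(1)])
  have "x \<in> ?T" using W(2) cinv_in[OF x] crd_cinv[OF c x] by (metis IntI image_eqI)
  moreover have "smooth_on ?T (\<lambda>x. f (cinv c x))"
    by (rule smooth_on_subset[OF smooth_fun_D[OF W(3) c]]) (auto simp: cimg_def)
  moreover have "Q (cinv c y) = f (cinv c y)" if "y \<in> ?T" for y using that W(4) cinv_crd[OF c] by auto
  ultimately show "\<exists>T. open T \<and> x \<in> T \<and> smooth_on T (\<lambda>x. Q (cinv c x))"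
    using T smooth_on_cong[OF T, of "\<lambda>x. Q (cinv c x)" "\<lambda>x. f (cinv c x)"] by blast
qed

section \<open>Tangent vectors as derivations in coordinates\<close>

lemma tangent_add: "v \<in> tangent_space A p \<Longrightarrow> smooth_fun A f \<Longrightarrow> smooth_fun A h \<Longrightarrow> v (\<lambda>x. f x + h x) = v f + v h"
  and tangent_scale: "v \<in> tangent_space A p \<Longrightarrow> smooth_fun A f \<Longrightarrow> v (\<lambda>x. k * f x) = k * v f"
  and tangent_mult: "v \<in> tangent_space A p \<Longrightarrow> smooth_fun A f \<Longrightarrow> smooth_fun A h \<Longrightarrow> v (\<lambda>x. f x * h x) = f p * v h + v f * h p"
  and tangent_nonsmooth: "v \<in> tangent_space A p \<Longrightarrow> \<not> smooth_fun A f \<Longrightarrow> v f = 0"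
  by (auto simp: tangent_space_def)

lemma tangent_const:
  assumes "v \<in> tangent_space A p" shows "v (\<lambda>_. k) = 0"
proof -
  have "v (\<lambda>_. 1) = 0" using tangent_mult[OF assms smooth_fun_const[of 1] smooth_fun_const[of 1]] by simp
  then show ?thesis using tangent_scale[OF assms smooth_fun_const[of 1], of k] by simp
qed

lemma tangent_minus:
  assumes "v \<in> tangent_space A p" "smooth_fun A f" "smooth_fun A h"
  shows "v (\<lambda>x. f x - h x) = v f - v h"
  using tangent_add[OF assms(1,2) smooth_fun_mult[OF smooth_fun_const[of "-1"] assms(3)]]
    tangent_scale[OF assms(1,3), of "-1"] by simp

lemma tangent_sum:
  assumes v: "v \<in> tangent_space A p" and "\<And>i. i \<in> I \<Longrightarrow> smooth_fun A (f i)"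
  shows "v (\<lambda>x. \<Sum>i\<in>I. f i x) = (\<Sum>i\<in>I. v (f i))"
  using assms(2)
proof (induction I rule: infinite_finite_induct)
  case (insert j I)
  then show ?case using tangent_add[OF v, of "f j" "\<lambda>x. \<Sum>i\<in>I. f i x"] smooth_fun_sum[of I f] by simp
qed (simp_all add: tangent_const[OF v])

text \<open>Let \<eta> be a bump at p that vanishes off \<open>W\<close>. Then (f - h) * \<eta> is
  identically 0, and the Leibniz rule at p, where f - h is 0 and \<eta> is 1, leaves v (f - h) =
  0.\<close>

lemma tangent_local:
  assumes v: "v \<in> tangent_space A p" and f: "smooth_fun A f" "smooth_fun A h"
    and W: "open W" "p \<in> W" "\<And>q. q \<in> W \<Longrightarrow> f q = h q"
  shows "v f = v h"
proof -
  obtain c where c: "c \<in> A" "p \<in> fst c" by (rule chart_at)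
  obtain W' \<eta> K where b: "chart_bump c W' \<eta> K" "p \<in> W'" "K \<subseteq> W"
    using chart_bump_exists[OF c W(1,2)] .
  have \<eta>: "smooth_fun A \<eta>" "\<eta> p = 1" "\<And>q. q \<notin> K \<Longrightarrow> \<eta> q = 0" using b by (auto simp: chart_bump_def)
  let ?d = "\<lambda>q. f q - h q"
  have "(\<lambda>q. ?d q * \<eta> q) = (\<lambda>_. 0)" using \<eta>(3) b(3) W(3) by fastforce
  then have "0 = ?d p * v \<eta> + v ?d * \<eta> p"
    using tangent_mult[OF v smooth_fun_minus[OF f] \<eta>(1)] tangent_const[OF v, of 0] by simp
  then show ?thesis using \<eta>(2) W(3)[OF W(2)] tangent_minus[OF v f] by simp
qed

lemma tv_add_in: "u \<in> tangent_space A p \<Longrightarrow> v \<in> tangent_space A p \<Longrightarrow> tv_add u v \<in> tangent_space A p"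
  by (auto simp: tangent_space_def tv_add_def algebra_simps)

lemma tv_scale_in: "u \<in> tangent_space A p \<Longrightarrow> tv_scale k u \<in> tangent_space A p"
  by (auto simp: tangent_space_def tv_scale_def algebra_simps)

lemma tv_zero_in: "(\<lambda>f. 0) \<in> tangent_space A p"
  by (auto simp: tangent_space_def)

text \<open>The default 0 is the convention of \<open>tangent_space\<close> for non-smooth
  arguments; it turns equality of tangent vectors into HOL equality.\<close>

definition ctan :: "'m set \<times> ('m \<Rightarrow> real^'n) \<Rightarrow> 'm \<Rightarrow> real^'n \<Rightarrow> 'm tvec" where
  "ctan c p w = (\<lambda>f. if smooth_fun A f then dderiv (\<lambda>x. f (cinv c x)) w (snd c p) else 0)"

lemma ctan_differentiable:
  assumes "c \<in> A" "p \<in> fst c" "smooth_fun A f"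
  shows "(\<lambda>x. f (cinv c x)) differentiable at (snd c p)"
  by (rule smooth_on_imp_differentiable[OF smooth_fun_D[OF assms(3,1)] crd_in[OF assms(2)]])

lemma ctan_in:
  assumes "c \<in> A" "p \<in> fst c"
  shows "ctan c p w \<in> tangent_space A p"
proof -
  have add: "ctan c p w (\<lambda>x. f x + h x) = ctan c p w f + ctan c p w h" if "smooth_fun A f" "smooth_fun A h" for f h
    using fun_cong[OF frechet_derivative_at[OF has_derivative_add[OF
        frechet_derivative_works[THEN iffD1, OF ctan_differentiable[OF assms that(1)]]
        frechet_derivative_works[THEN iffD1, OF ctan_differentiable[OF assms that(2)]]]], of w]
      that smooth_fun_add[OF that]
    by (simp add: ctan_def)
  have mult: "ctan c p w (\<lambda>x. f x * h x) = f p * ctan c p w h + ctan c p w f * h p" if "smooth_fun A f" "smooth_fun A h" for f h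
    using dderiv_mult[OF ctan_differentiable[OF assms that(1)] ctan_differentiable[OF assms that(2)]]
      that smooth_fun_mult[OF that] cinv_crd[OF assms]
    by (simp add: ctan_def)
  have const: "ctan c p w (\<lambda>x. k) = 0" for k
    using smooth_fun_const by (simp add: ctan_def)
  have "ctan c p w (\<lambda>x. k * f x) = k * ctan c p w f" if "smooth_fun A f" for f k
    using mult[OF smooth_fun_const[of k] that] const[of k] by simp
  with add mult show ?thesis by (simp add: tangent_space_def) (simp add: ctan_def)
qed

lemma ctan_add:
  assumes "c \<in> A" "p \<in> fst c"
  shows "ctan c p (u + w) = tv_add (ctan c p u) (ctan c p w)"
  using linear_add[OF linear_frechet_derivative[OF ctan_differentiable[OF assms]]]
  by (auto simp: ctan_def tv_add_def fun_eq_iff)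

lemma ctan_scaleR:
  assumes "c \<in> A" "p \<in> fst c"
  shows "ctan c p (k *\<^sub>R w) = tv_scale k (ctan c p w)"
  using linear_scale[OF linear_frechet_derivative[OF ctan_differentiable[OF assms]]]
  by (auto simp: ctan_def tv_scale_def fun_eq_iff)

lemma ctan_expand:
  assumes "c \<in> A" "p \<in> fst c" "smooth_fun A f"
  shows "ctan c p w f = (\<Sum>i\<in>UNIV. w $ i * ctan c p (axis i 1) f)"
  using dderiv_expand[OF ctan_differentiable[OF assms], of w] assms(3) by (simp add: ctan_def)

lemma ctan_local:
  assumes c: "c \<in> A" "p \<in> fst c" and f: "smooth_fun A f" and W: "open W" "p \<in> W"
    and F: "\<And>q. q \<in> W \<Longrightarrow> q \<in> fst c \<Longrightarrow> f q = F (snd c q)"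
  shows "ctan c p w f = dderiv F w (snd c p)"
proof -
  let ?T = "snd c ` (fst c \<inter> W)"
  have T: "open ?T" by (rule open_crd_image[OF c(1) W(1)])
  have p: "snd c p \<in> ?T" using c W by blast
  have "f (cinv c y) = F y" if "y \<in> ?T" for y using that F cinv_crd[OF c(1)] by auto
  from frechet_derivative_cong_open[OF T p this] show ?thesis using f by (simp add: ctan_def)
qed

text \<open>A coordinate lives only on its chart, whereas tangent vectors take functions on the
  whole manifold. The cut-off keeps its derivatives on the set where the bump is 1, so components of
  a vector can be read off there.\<close>

definition coord_fun :: "'m set \<times> ('m \<Rightarrow> real^'n) \<Rightarrow> ('m \<Rightarrow> real) \<Rightarrow> 'n \<Rightarrow> 'm \<Rightarrow> real" where
  "coord_fun c \<eta> i = (\<lambda>q. if q \<in> fst c then \<eta> q * snd c q $ i else 0)"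

lemma coord_fun_smooth:
  assumes c: "c \<in> A" and b: "chart_bump c W \<eta> K"
  shows "smooth_fun A (coord_fun c \<eta> i)"
proof -
  have b': "smooth_fun A \<eta>" "compact K" "K \<subseteq> fst c" "\<And>q. q \<notin> K \<Longrightarrow> \<eta> q = 0"
    using b by (auto simp: chart_bump_def)
  have "K \<subseteq> cinv c ` cimg c" using b'(3) cinv_crd[OF c] crd_in[of _ c] by (force intro: image_eqI[rotated])
  from smooth_fun_bump_extend[OF c b' open_cimg[OF c] subset_refl this smooth_on_vec_nth]
  show ?thesis unfolding coord_fun_def .
qed

lemma dderiv_coord: "dderiv (\<lambda>x. x $ i) w x = w $ i"
  using fun_cong[OF frechet_derivative_at[OF bounded_linear_imp_has_derivative[OF bounded_linear_vec_nth[of i]]], of w x]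
  by simp

lemma ctan_coord_fun:
  assumes c: "c \<in> A" and b: "chart_bump c W \<eta> K" and q: "q \<in> W"
  shows "ctan c q w (coord_fun c \<eta> i) = w $ i"
proof -
  have W: "open W" "W \<subseteq> fst c" "\<And>q. q \<in> W \<Longrightarrow> \<eta> q = 1" using b by (auto simp: chart_bump_def)
  have "ctan c q w (coord_fun c \<eta> i) = dderiv (\<lambda>x. x $ i) w (snd c q)"
    by (rule ctan_local[OF c _ coord_fun_smooth[OF c b] W(1) q]) (use W q in \<open>auto simp: coord_fun_def\<close>)
  then show ?thesis using dderiv_coord by metis
qed

lemma ctan_inj:
  assumes "c \<in> A" "p \<in> fst c" "ctan c p u = ctan c p w"
  shows "u = w"
proof -
  obtain W \<eta> K where "chart_bump c W \<eta> K" "p \<in> W"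
    using chart_bump_exists[OF assms(1,2) open_UNIV UNIV_I] .
  then show ?thesis using ctan_coord_fun[OF assms(1)] assms(3) by (metis vec_eq_iff)
qed

text \<open>By Hadamard's lemma f = f p + (sum of y_i * z_i) near p with y_i p = 0. The Leibniz rule
  then leaves the sum of v y_i * z_i p, and z_i p is the i-th partial derivative of f at p.\<close>

lemma tangent_is_ctan:
  assumes c: "c \<in> A" "p \<in> fst c" and v: "v \<in> tangent_space A p"
  shows "\<exists>w. v = ctan c p w"
proof -
  let ?x = "snd c p"
  \<comment> \<open>Hadamard's lemma needs a ball, so the bump is chosen with support in the
    preimage of one.\<close>
  obtain R where R: "R > 0" "ball ?x R \<subseteq> cimg c"
    using open_cimg[OF c(1)] crd_in[OF c(2)] open_contains_ball by blast
  let ?V = "{q \<in> fst c. snd c q \<in> ball ?x R}"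
  have V: "open ?V" "p \<in> ?V" using open_crd_vimage[OF c(1) open_ball] c(2) R(1) by auto
  obtain W \<eta> K where b: "chart_bump c W \<eta> K" "p \<in> W" "K \<subseteq> ?V"
    using chart_bump_exists[OF c V] .
  have b': "smooth_fun A \<eta>" "compact K" "K \<subseteq> fst c" "\<And>q. q \<notin> K \<Longrightarrow> \<eta> q = 0" "open W" "W \<subseteq> fst c"
    "\<And>q. q \<in> W \<Longrightarrow> \<eta> q = 1" "W \<subseteq> K"
    using b(1) by (auto simp: chart_bump_def)
  have KS: "K \<subseteq> cinv c ` ball ?x R" using b(3) cinv_crd[OF c(1)] by force
  \<comment> \<open>Coordinates centred at p, so that all of them vanish there.\<close>
  define y where "y i = (\<lambda>q. if q \<in> fst c then \<eta> q * (snd c q $ i - ?x $ i) else 0)" for i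
  have ys: "smooth_fun A (y i)" for i unfolding y_def
    by (rule smooth_fun_bump_extend[OF c(1) b'(1-3) _ open_ball R(2) KS
        smooth_on_minus[OF open_ball smooth_on_vec_nth smooth_on_const]]) (rule b'(4))
  define w where "w = (\<chi> i. v (y i))"
  have "v f = ctan c p w f" if f: "smooth_fun A f" for f
  proof -
    obtain h where h: "\<And>i. smooth_on (ball ?x R) (h i)"
      "\<And>x. x \<in> ball ?x R \<Longrightarrow> f (cinv c x) = f (cinv c ?x) + (\<Sum>i\<in>UNIV. (x $ i - ?x $ i) * h i x)"
      "\<And>i. h i ?x = dderiv (\<lambda>x. f (cinv c x)) (axis i 1) ?x"
      using Hadamard_expansion[OF smooth_on_subset[OF smooth_fun_D[OF f c(1)] R(2)] R(1)] by blast
    define z where "z i = (\<lambda>q. if q \<in> fst c then \<eta> q * h i (snd c q) else 0)" for i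
    have zs: "smooth_fun A (z i)" for i unfolding z_def
      by (rule smooth_fun_bump_extend[OF c(1) b'(1-3) _ open_ball R(2) KS h(1)]) (rule b'(4))
    have yzs: "smooth_fun A (\<lambda>q. y i q * z i q)" for i by (rule smooth_fun_mult[OF ys zs])
    have "v f = v (\<lambda>q. f p + (\<Sum>i\<in>UNIV. y i q * z i q))"
    proof (rule tangent_local[OF v f _ b'(5) b(2)])
      show "smooth_fun A (\<lambda>q. f p + (\<Sum>i\<in>UNIV. y i q * z i q))"
        by (intro smooth_fun_add smooth_fun_const smooth_fun_sum yzs)
      fix q assume q: "q \<in> W"
      then have "q \<in> fst c" "snd c q \<in> ball ?x R" "\<eta> q = 1" using b'(7,8) b(3) by auto
      then show "f q = f p + (\<Sum>i\<in>UNIV. y i q * z i q)"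
        using h(2)[of "snd c q"] cinv_crd[OF c(1)] c(2) by (simp add: y_def z_def)
    qed
    also have "\<dots> = (\<Sum>i\<in>UNIV. v (\<lambda>q. y i q * z i q))"
    proof -
      have "smooth_fun A (\<lambda>q. \<Sum>i\<in>UNIV. y i q * z i q)" by (intro smooth_fun_sum yzs)
      from tangent_add[OF v smooth_fun_const[of "f p"] this] tangent_const[OF v, of "f p"]
      have "v (\<lambda>q. f p + (\<Sum>i\<in>UNIV. y i q * z i q)) = v (\<lambda>q. \<Sum>i\<in>UNIV. y i q * z i q)" by simp
      also have "\<dots> = (\<Sum>i\<in>UNIV. v (\<lambda>q. y i q * z i q))" by (rule tangent_sum[OF v yzs])
      finally show ?thesis .
    qed
    also have "\<dots> = (\<Sum>i\<in>UNIV. w $ i * ctan c p (axis i 1) f)"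
    proof (rule sum.cong[OF refl])
      fix i
      have "y i p = 0" by (simp add: y_def)
      moreover have "z i p = ctan c p (axis i 1) f" using c(2) b'(7)[OF b(2)] h(3)[of i] f by (simp add: z_def ctan_def)
      ultimately show "v (\<lambda>q. y i q * z i q) = w $ i * ctan c p (axis i 1) f"
        using tangent_mult[OF v ys zs, of i i] by (simp add: w_def)
    qed
    also have "\<dots> = ctan c p w f" by (rule ctan_expand[OF c f, symmetric])
    finally show ?thesis .
  qed
  moreover have "v f = ctan c p w f" if "\<not> smooth_fun A f" for f
    using tangent_nonsmooth[OF v that] that by (simp add: ctan_def)
  ultimately have "v = ctan c p w" by blast
  then show ?thesis by blast
qed

section \<open>Cut-off coordinate vector fields\<close>

definition coord_field :: "'m set \<times> ('m \<Rightarrow> real^'n) \<Rightarrow> ('m \<Rightarrow> real) \<Rightarrow> real^'n \<Rightarrow> 'm vfield" where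
  "coord_field c \<eta> w = (\<lambda>q. if q \<in> fst c then tv_scale (\<eta> q) (ctan c q w) else (\<lambda>f. 0))"

lemma coord_field_vector_field:
  assumes c: "c \<in> A" and b: "chart_bump c W \<eta> K"
  shows "vector_field A (coord_field c \<eta> w)"
  unfolding vector_field_def
proof (intro conjI allI impI)
  show "coord_field c \<eta> w p \<in> tangent_space A p" for p
    using tv_scale_in[OF ctan_in[OF c]] tv_zero_in by (simp add: coord_field_def)
  fix f assume f: "smooth_fun A f"
  have b': "smooth_fun A \<eta>" "compact K" "K \<subseteq> fst c" "\<And>q. q \<notin> K \<Longrightarrow> \<eta> q = 0"
    using b by (auto simp: chart_bump_def)
  have "K \<subseteq> cinv c ` cimg c" using b'(3) cinv_crd[OF c] crd_in[of _ c] by (force intro: image_eqI[rotated])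
  from smooth_fun_bump_extend[OF c b' open_cimg[OF c] subset_refl this smooth_on_dderiv[OF smooth_fun_D[OF f c]], of w]
  show "smooth_fun A (deriv_along (coord_field c \<eta> w) f)"
    using f by (simp add: deriv_along_def coord_field_def tv_scale_def ctan_def if_distrib[of "\<lambda>h. h f"] cong: if_cong)
qed

lemma coord_field_eq:
  assumes "chart_bump c W \<eta> K" "q \<in> W"
  shows "coord_field c \<eta> w q = ctan c q w"
  using assms by (auto simp: chart_bump_def coord_field_def tv_scale_def)

lemma vector_field_tangent: "vector_field A X \<Longrightarrow> X p \<in> tangent_space A p"
  by (simp add: vector_field_def)

text \<open>Definitions that quantify over vector fields yield pointwise statements through this
  extension, which has constant components near p.\<close>

lemma vector_field_at:
  assumes "v \<in> tangent_space A p"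
  obtains X where "vector_field A X" "X p = v"
proof -
  obtain c where c: "c \<in> A" "p \<in> fst c" by (rule chart_at)
  obtain w where w: "v = ctan c p w" using tangent_is_ctan[OF c assms] by blast
  obtain W \<eta> K where b: "chart_bump c W \<eta> K" "p \<in> W"
    using chart_bump_exists[OF c open_UNIV UNIV_I] .
  show thesis using that[OF coord_field_vector_field[OF c(1) b(1)]] coord_field_eq[OF b] w by blast
qed

end

section \<open>Riemannian metrics in charts\<close>

lemma smooth_on_det:
  fixes G :: "'a::real_normed_vector \<Rightarrow> real^'n^'n"
  assumes S: "open S" and G: "\<And>i j. smooth_on S (\<lambda>x. G x $ i $ j)"
  shows "smooth_on S (\<lambda>x. det (G x))"
  unfolding det_def
  by (rule smooth_on_sum[OF S smooth_on_mult[OF S smooth_on_const smooth_on_prod[OF S G]]])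

text \<open>With the derivative given in the form C G, the usual trace of G' times the inverse of G
  is simply the trace of C, and neither an inverse nor an adjugate enters the statement.\<close>

lemma Jacobi_formula:
  fixes G :: "'a::real_normed_vector \<Rightarrow> real^'n^'n"
  assumes G: "\<And>i j. (\<lambda>x. G x $ i $ j) differentiable at x"
    and C: "\<And>i j. dderiv (\<lambda>x. G x $ i $ j) v x = (C ** G x) $ i $ j"
  shows "dderiv (\<lambda>x. det (G x)) v x = trace C * det (G x)"
proof -
  let ?D = "\<lambda>i j v. dderiv (\<lambda>x. G x $ i $ j) v x"
  let ?P = "{p. p permutes (UNIV :: 'n set)}"
  have d: "((\<lambda>x. G x $ i $ j) has_derivative (\<lambda>v. ?D i j v)) (at x)" for i j
    using frechet_derivative_works[THEN iffD1, OF G[of i j]] .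
  have "((\<lambda>x. \<Prod>i\<in>UNIV. G x $ i $ p i) has_derivative
      (\<lambda>v. \<Sum>i\<in>UNIV. ?D i (p i) v * (\<Prod>j\<in>UNIV - {i}. G x $ j $ p j))) (at x)" for p
    using has_derivative_prod[of UNIV "\<lambda>i x. G x $ i $ p i" "\<lambda>i v. ?D i (p i) v" x UNIV] d by simp
  then have "((\<lambda>x. det (G x)) has_derivative
      (\<lambda>v. \<Sum>p\<in>?P. of_int (sign p) * (\<Sum>i\<in>UNIV. ?D i (p i) v * (\<Prod>j\<in>UNIV - {i}. G x $ j $ p j)))) (at x)"
    unfolding det_def by (intro has_derivative_sum has_derivative_mult_right)
  from fun_cong[OF frechet_derivative_at[OF this], of v]
  have "dderiv (\<lambda>x. det (G x)) v x =
      (\<Sum>p\<in>?P. of_int (sign p) * (\<Sum>i\<in>UNIV. ?D i (p i) v * (\<Prod>j\<in>UNIV - {i}. G x $ j $ p j)))" by simp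
  also have "\<dots> = (\<Sum>i\<in>UNIV. \<Sum>p\<in>?P. of_int (sign p) * (?D i (p i) v * (\<Prod>j\<in>UNIV - {i}. G x $ j $ p j)))"
    unfolding sum_distrib_left by (rule sum.swap)
  \<comment> \<open>Differentiating the i-th row replaces it by row i of C G, a combination of the
    rows of G. Only the multiple C_ii of row i itself survives in the determinant.\<close>
  also have "\<dots> = (\<Sum>i\<in>UNIV. det ((\<chi> k. if k = i then \<Sum>l\<in>UNIV. C $ i $ l *s row l (G x) else row k (G x)) :: real^'n^'n))"
  proof (intro sum.cong refl)
    fix i :: 'n
    let ?M = "(\<chi> k. if k = i then \<Sum>l\<in>UNIV. C $ i $ l *s row l (G x) else row k (G x)) :: real^'n^'n"
    have M1: "?M $ i $ j = ?D i j v" for j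
      unfolding C by (simp add: matrix_matrix_mult_def row_def)
    have M2: "?M $ k $ j = G x $ k $ j" if "k \<noteq> i" for k j using that by (simp add: row_def)
    have "(\<Prod>k\<in>UNIV. ?M $ k $ p k) = ?D i (p i) v * (\<Prod>j\<in>UNIV - {i}. G x $ j $ p j)" for p
    proof -
      have "(\<Prod>k\<in>UNIV. ?M $ k $ p k) = ?M $ i $ p i * (\<Prod>k\<in>UNIV - {i}. ?M $ k $ p k)"
        by (rule prod.remove) auto
      also have "(\<Prod>k\<in>UNIV - {i}. ?M $ k $ p k) = (\<Prod>k\<in>UNIV - {i}. G x $ k $ p k)"
        using M2 by (intro prod.cong) auto
      finally show ?thesis unfolding M1 .
    qed
    then show "(\<Sum>p\<in>?P. of_int (sign p) * (?D i (p i) v * (\<Prod>j\<in>UNIV - {i}. G x $ j $ p j))) = det ?M"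
      unfolding det_def by simp
  qed
  also have "\<dots> = (\<Sum>i\<in>UNIV. C $ i $ i * det (G x))"
    using cramer_lemma_transpose[of _ "C $ _" "G x"] by (simp add: cramer_lemma_transpose)
  finally show ?thesis by (simp add: trace_def sum_distrib_right)
qed

lemma symmetric_form_eq:
  fixes G :: "real^'n^'n"
  assumes "\<And>i j. G $ i $ j = G $ j $ i"
  shows "u \<bullet> (G *v w) = w \<bullet> (G *v u)"
proof -
  have "transpose G = G" using assms by (simp add: transpose_def vec_eq_iff)
  then show ?thesis by (metis dot_lmul_matrix inner_commute transpose_matrix_vector)
qed

section \<open>Gram matrices, Riemannian density and dual vector fields\<close>

locale riem_manifold = vec_manifold A
  for A :: "('m::{t2_space,second_countable_topology}, real^'n) atlas" +
  fixes g :: "'m form2"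
  assumes metric: "riemannian_metric A g"
begin

lemma g_add_right: "u \<in> tangent_space A p \<Longrightarrow> v \<in> tangent_space A p \<Longrightarrow> w \<in> tangent_space A p \<Longrightarrow>
    g p u (tv_add v w) = g p u v + g p u w"
  and g_scale_right: "u \<in> tangent_space A p \<Longrightarrow> v \<in> tangent_space A p \<Longrightarrow> g p u (tv_scale k v) = k * g p u v"
  and g_sym: "u \<in> tangent_space A p \<Longrightarrow> v \<in> tangent_space A p \<Longrightarrow> g p u v = g p v u"
  and g_pos: "u \<in> tangent_space A p \<Longrightarrow> u \<noteq> (\<lambda>f. 0) \<Longrightarrow> g p u u > 0"
  and g_smooth: "vector_field A X \<Longrightarrow> vector_field A Y \<Longrightarrow> smooth_fun A (eval2 g X Y)"
  using metric by (auto simp: riemannian_metric_def linear_form_at_def)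

lemma g_add_left: "u \<in> tangent_space A p \<Longrightarrow> v \<in> tangent_space A p \<Longrightarrow> w \<in> tangent_space A p \<Longrightarrow>
    g p (tv_add v w) u = g p v u + g p w u"
  using g_add_right[of u p v w] g_sym[of _ p u] tv_add_in by simp

lemma g_scale_left: "u \<in> tangent_space A p \<Longrightarrow> v \<in> tangent_space A p \<Longrightarrow> g p (tv_scale k v) u = k * g p v u"
  using g_scale_right[of u p v k] g_sym[of _ p u] tv_scale_in by simp

lemma g_eqI:
  assumes "u \<in> tangent_space A p" "v \<in> tangent_space A p" "\<And>w. w \<in> tangent_space A p \<Longrightarrow> g p u w = g p v w"
  shows "u = v"
proof (rule ccontr)
  let ?d = "tv_add u (tv_scale (-1) v)"
  assume "u \<noteq> v"
  then have "?d \<noteq> (\<lambda>f. 0)" by (auto simp: tv_add_def tv_scale_def fun_eq_iff)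
  moreover have d: "?d \<in> tangent_space A p" using assms tv_add_in tv_scale_in by blast
  moreover have "g p ?d ?d = 0"
    using g_add_left[OF d assms(1) tv_scale_in[OF assms(2)]] g_scale_left[OF d assms(2)] assms(3)[OF d] by simp
  ultimately show False using g_pos[OF d] by simp
qed

definition gmat :: "'m set \<times> ('m \<Rightarrow> real^'n) \<Rightarrow> real^'n \<Rightarrow> real^'n^'n" where
  "gmat c x = (\<chi> i j. g (cinv c x) (ctan c (cinv c x) (axis i 1)) (ctan c (cinv c x) (axis j 1)))"

lemma ctan_functional_expand:
  assumes c: "c \<in> A" "p \<in> fst c" and l: "linear_form_at A p l"
  shows "l (ctan c p w) = (\<Sum>i\<in>UNIV. w $ i * l (ctan c p (axis i 1)))"
proof (rule linear_vec_expand[of "\<lambda>w. l (ctan c p w)"], rule linearI)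
  show "l (ctan c p (u + v)) = l (ctan c p u) + l (ctan c p v)" for u v
    using l ctan_in[OF c] by (simp add: ctan_add[OF c] linear_form_at_def)
  show "l (ctan c p (k *\<^sub>R v)) = k *\<^sub>R l (ctan c p v)" for k v
    using l ctan_in[OF c] by (simp add: ctan_scaleR[OF c] linear_form_at_def)
qed

lemma g_ctan:
  assumes c: "c \<in> A" "p \<in> fst c"
  shows "g p (ctan c p u) (ctan c p w) = u \<bullet> (gmat c (snd c p) *v w)"
proof -
  have 1: "g p (ctan c p u) (ctan c p w) = (\<Sum>j\<in>UNIV. w $ j * g p (ctan c p u) (ctan c p (axis j 1)))" for u
    using metric ctan_in[OF c] by (intro ctan_functional_expand[OF c]) (simp add: riemannian_metric_def)
  have 2: "g p (ctan c p u) v = (\<Sum>i\<in>UNIV. u $ i * g p (ctan c p (axis i 1)) v)" if v: "v \<in> tangent_space A p" for v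
    by (rule ctan_functional_expand[OF c, where l = "\<lambda>u. g p u v"])
      (simp add: linear_form_at_def g_add_left[OF v] g_scale_left[OF v])
  show ?thesis
    unfolding 2[OF ctan_in[OF c]] 1[of "axis _ 1"]
    by (simp add: inner_vec_def matrix_vector_mult_def gmat_def cinv_crd[OF c] mult_ac)
qed

lemma gmat_sym: 
  assumes "c \<in> A" "x \<in> cimg c" shows "gmat c x $ i $ j = gmat c x $ j $ i"
  using g_sym[OF ctan_in[OF assms(1) cinv_in[OF assms(2)]] ctan_in[OF assms(1) cinv_in[OF assms(2)]]]
  by (simp add: gmat_def)

text \<open>A nonzero w in the kernel would give, by injectivity of \<open>ctan\<close>, a nonzero
  tangent vector of length 0.\<close>

lemma gmat_ker:
  assumes "c \<in> A" "x \<in> cimg c" "gmat c x *v w = 0"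
  shows "w = 0"
proof (rule ccontr)
  let ?p = "cinv c x"
  note c = assms(1) cinv_in[OF assms(2)]
  assume w: "w \<noteq> 0"
  have "ctan c ?p 0 = (\<lambda>f. 0)" using ctan_scaleR[OF c, of 0 0] by (simp add: tv_scale_def)
  then have "ctan c ?p w \<noteq> (\<lambda>f. 0)" using ctan_inj[OF c, of w 0] w by auto
  from g_pos[OF ctan_in[OF c] this] show False
    using g_ctan[OF c, of w w] assms(3) crd_cinv[OF assms(1,2)] by simp
qed

lemma gmat_invertible:
  assumes "c \<in> A" "x \<in> cimg c"
  shows "invertible (gmat c x)" "det (gmat c x) \<noteq> 0"
proof -
  show "invertible (gmat c x)"
    using gmat_ker[OF assms] matrix_left_invertible_ker invertible_left_inverse by blast
  then show "det (gmat c x) \<noteq> 0" by (simp add: invertible_det_nz)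
qed

lemma gmat_smooth:
  assumes c: "c \<in> A"
  shows "smooth_on (cimg c) (\<lambda>x. gmat c x $ i $ j)"
proof -
  let ?Q = "\<lambda>q. g q (ctan c q (axis i 1)) (ctan c q (axis j 1))"
  have "smooth_on (cimg c) (\<lambda>x. ?Q (cinv c x))"
  proof (rule smooth_on_from_local_fun[OF c])
    fix p assume p: "p \<in> fst c"
    obtain W \<eta> K where b: "chart_bump c W \<eta> K" "p \<in> W"
      using chart_bump_exists[OF c p open_UNIV UNIV_I] .
    note E = coord_field_vector_field[OF c b(1)]
    have "\<forall>q\<in>W \<inter> fst c. ?Q q = eval2 g (coord_field c \<eta> (axis i 1)) (coord_field c \<eta> (axis j 1)) q"
      using coord_field_eq[OF b(1)] by (simp add: eval2_def)
    moreover have "open W" using b(1) by (simp add: chart_bump_def)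
    ultimately show "\<exists>W f. open W \<and> p \<in> W \<and> smooth_fun A f \<and> (\<forall>q\<in>W \<inter> fst c. ?Q q = f q)"
      using g_smooth[OF E E] b(2) by blast
  qed
  then show ?thesis by (simp add: gmat_def)
qed

text \<open>The absolute value makes it unnecessary to know that Gram determinants are positive; it is
  smooth because \<open>|d|\<close> is the square root of \<open>d * d\<close>.\<close>

definition vol :: "'m set \<times> ('m \<Rightarrow> real^'n) \<Rightarrow> real^'n \<Rightarrow> real" where
  "vol c x = sqrt \<bar>det (gmat c x)\<bar>"

lemma vol_pos: "c \<in> A \<Longrightarrow> x \<in> cimg c \<Longrightarrow> vol c x > 0"
  using gmat_invertible(2) by (simp add: vol_def)

lemma det_gmat_smooth: "c \<in> A \<Longrightarrow> smooth_on (cimg c) (\<lambda>x. det (gmat c x))"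
  by (rule smooth_on_det[OF open_cimg gmat_smooth])

lemma vol_smooth:
  assumes c: "c \<in> A" shows "smooth_on (cimg c) (vol c)"
proof -
  let ?d = "\<lambda>x. det (gmat c x)"
  have "smooth_on (cimg c) (\<lambda>x. sqrt (sqrt (?d x * ?d x)))"
  proof (rule smooth_on_sqrt[OF open_cimg[OF c] smooth_on_sqrt[OF open_cimg[OF c] smooth_on_mult[OF open_cimg[OF c]]]])
    show "smooth_on (cimg c) ?d" by (rule det_gmat_smooth[OF c])
    then show "smooth_on (cimg c) ?d" .
    show "0 < ?d x * ?d x" "0 < sqrt (?d x * ?d x)" if "x \<in> cimg c" for x
      using gmat_invertible(2)[OF c that] by (auto simp: zero_less_mult_iff)
  qed
  moreover have "(\<lambda>x. sqrt (sqrt (?d x * ?d x))) = vol c"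
    by (simp add: vol_def fun_eq_iff power2_eq_square[symmetric])
  ultimately show ?thesis by simp
qed

text \<open>Neither the absolute value nor the root is differentiated: with V = \<open>vol c\<close>
  and d the Gram determinant, V^4 = d^2 gives 4 V^3 V' = 2 d d' = 2 k d^2 = 2 k V^4.\<close>

lemma dderiv_vol:
  assumes c: "c \<in> A" "x \<in> cimg c" and d: "dderiv (\<lambda>x. det (gmat c x)) v x = k * det (gmat c x)"
  shows "dderiv (vol c) v x = k / 2 * vol c x"
proof -
  let ?d = "\<lambda>x. det (gmat c x)"
  let ?V = "vol c"
  have V: "?V differentiable at x" by (rule smooth_on_imp_differentiable[OF vol_smooth[OF c(1)] c(2)])
  then have V2: "(\<lambda>x. ?V x * ?V x) differentiable at x" by simp
  have D: "?d differentiable at x" by (rule smooth_on_imp_differentiable[OF det_gmat_smooth[OF c(1)] c(2)])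
  have "(\<lambda>x. (?V x * ?V x) * (?V x * ?V x)) = (\<lambda>x. ?d x * ?d x)"
    by (simp add: vol_def fun_eq_iff)
  then have "dderiv (\<lambda>x. (?V x * ?V x) * (?V x * ?V x)) v x = dderiv (\<lambda>x. ?d x * ?d x) v x" by simp
  then have "4 * ?V x ^ 3 * dderiv ?V v x = 2 * k * (?d x * ?d x)"
    unfolding dderiv_mult[OF V2 V2] dderiv_mult[OF V V] dderiv_mult[OF D D] d
    by (simp add: power3_eq_cube algebra_simps)
  also have "?d x * ?d x = ?V x ^ 3 * ?V x"
    by (simp add: vol_def power3_eq_cube) (simp add: mult.assoc)
  finally show ?thesis using vol_pos[OF c] by simp
qed

text \<open>Cramer's rule for the components of the dual vector: column k of the Gram matrix is
  replaced by the components of \<theta>. As a quotient of determinants it is visibly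
  smooth.\<close>

definition sharp_coord :: "'m form1 \<Rightarrow> 'm set \<times> ('m \<Rightarrow> real^'n) \<Rightarrow> real^'n \<Rightarrow> real^'n" where
  "sharp_coord \<theta> c x = (\<chi> k. det (\<chi> i j. if j = k then \<theta> (cinv c x) (ctan c (cinv c x) (axis i 1)) else gmat c x $ i $ j)
     / det (gmat c x))"

text \<open>Fixed by duality and not by a chart, so that the component vectors in all charts
  describe one and the same field.\<close>

definition sharp :: "'m form1 \<Rightarrow> 'm vfield" where
  "sharp \<theta> p = (THE v. v \<in> tangent_space A p \<and> (\<forall>u\<in>tangent_space A p. g p v u = \<theta> p u))"

lemma one_form_comp_smooth:
  assumes \<theta>: "one_form A \<theta>" and c: "c \<in> A"
  shows "smooth_on (cimg c) (\<lambda>x. \<theta> (cinv c x) (ctan c (cinv c x) w))"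
proof (rule smooth_on_from_local_fun[OF c, of "\<lambda>q. \<theta> q (ctan c q w)"])
  fix p assume p: "p \<in> fst c"
  obtain W \<eta> K where b: "chart_bump c W \<eta> K" "p \<in> W"
    using chart_bump_exists[OF c p open_UNIV UNIV_I] .
  have "\<forall>q\<in>W \<inter> fst c. \<theta> q (ctan c q w) = eval1 \<theta> (coord_field c \<eta> w) q"
    using coord_field_eq[OF b(1)] by (simp add: eval1_def)
  moreover have "open W" using b(1) by (simp add: chart_bump_def)
  moreover have "smooth_fun A (eval1 \<theta> (coord_field c \<eta> w))"
    using \<theta> coord_field_vector_field[OF c b(1)] by (simp add: one_form_def)
  ultimately show "\<exists>W f. open W \<and> p \<in> W \<and> smooth_fun A f \<and> (\<forall>q\<in>W \<inter> fst c. \<theta> q (ctan c q w) = f q)"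
    using b(2) by blast
qed

lemma sharp_coord_smooth:
  assumes \<theta>: "one_form A \<theta>" and c: "c \<in> A"
  shows "smooth_on (cimg c) (\<lambda>x. sharp_coord \<theta> c x $ k)"
proof -
  note o = open_cimg[OF c]
  have "smooth_on (cimg c) (\<lambda>x. (\<chi> i j. if j = k then \<theta> (cinv c x) (ctan c (cinv c x) (axis i 1)) else gmat c x $ i $ j) $ i $ j)"
    for i j
    using one_form_comp_smooth[OF \<theta> c] gmat_smooth[OF c] by (cases "j = k") auto
  from smooth_on_mult[OF o smooth_on_det[OF o this] smooth_on_inverse[OF o det_gmat_smooth[OF c] gmat_invertible(2)[OF c]]]
  show ?thesis by (simp add: sharp_coord_def divide_inverse)
qed

lemma sharp_coord_eq:
  assumes c: "c \<in> A" "x \<in> cimg c"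
  shows "gmat c x *v sharp_coord \<theta> c x = (\<chi> i. \<theta> (cinv c x) (ctan c (cinv c x) (axis i 1)))"
  using cramer[OF gmat_invertible(2)[OF c], of "sharp_coord \<theta> c x" "\<chi> i. \<theta> (cinv c x) (ctan c (cinv c x) (axis i 1))"]
  unfolding sharp_coord_def vec_lambda_beta by simp

lemma sharp_unique:
  assumes "v \<in> tangent_space A p" "\<And>u. u \<in> tangent_space A p \<Longrightarrow> g p v u = \<theta> p u"
  shows "sharp \<theta> p = v"
  unfolding sharp_def
proof (rule the_equality)
  show "v' = v" if "v' \<in> tangent_space A p \<and> (\<forall>u\<in>tangent_space A p. g p v' u = \<theta> p u)" for v'
    using that assms by (intro g_eqI[of v' p v]) auto
qed (use assms in auto)

lemma g_sharp_coord:
  assumes \<theta>: "one_form A \<theta>" and c: "c \<in> A" "p \<in> fst c" and u: "u \<in> tangent_space A p"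
  shows "g p (ctan c p (sharp_coord \<theta> c (snd c p))) u = \<theta> p u"
proof -
  obtain w where w: "u = ctan c p w" using tangent_is_ctan[OF c u] by blast
  note x = c(1) crd_in[OF c(2)]
  have "g p (ctan c p (sharp_coord \<theta> c (snd c p))) u = w \<bullet> (gmat c (snd c p) *v sharp_coord \<theta> c (snd c p))"
    unfolding w g_ctan[OF c] by (rule symmetric_form_eq[OF gmat_sym[OF x]])
  also have "\<dots> = (\<Sum>i\<in>UNIV. w $ i * \<theta> p (ctan c p (axis i 1)))"
    unfolding sharp_coord_eq[OF x] by (simp add: inner_vec_def cinv_crd[OF c])
  also have "\<dots> = \<theta> p u" unfolding w
    by (rule ctan_functional_expand[OF c, symmetric]) (use \<theta> in \<open>simp add: one_form_def\<close>)
  finally show ?thesis .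
qed

lemma sharp_ctan:
  assumes "one_form A \<theta>" "c \<in> A" "p \<in> fst c"
  shows "sharp \<theta> p = ctan c p (sharp_coord \<theta> c (snd c p))"
  using assms by (intro sharp_unique ctan_in g_sharp_coord)

lemma sharp:
  assumes \<theta>: "one_form A \<theta>"
  shows "sharp \<theta> p \<in> tangent_space A p" "u \<in> tangent_space A p \<Longrightarrow> g p (sharp \<theta> p) u = \<theta> p u"
proof -
  obtain c where c: "c \<in> A" "p \<in> fst c" by (rule chart_at)
  show "sharp \<theta> p \<in> tangent_space A p" unfolding sharp_ctan[OF \<theta> c] by (rule ctan_in[OF c])
  show "u \<in> tangent_space A p \<Longrightarrow> g p (sharp \<theta> p) u = \<theta> p u"
    unfolding sharp_ctan[OF \<theta> c] by (rule g_sharp_coord[OF \<theta> c])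
qed

lemma sharp_vector_field:
  assumes \<theta>: "one_form A \<theta>"
  shows "vector_field A (sharp \<theta>)"
  unfolding vector_field_def
proof (intro conjI allI impI)
  show "sharp \<theta> p \<in> tangent_space A p" for p by (rule sharp(1)[OF \<theta>])
  fix f assume f: "smooth_fun A f"
  show "smooth_fun A (deriv_along (sharp \<theta>) f)"
    unfolding smooth_fun_iff
  proof
    fix c assume c: "c \<in> A"
    note o = open_cimg[OF c]
    have s: "smooth_on (cimg c) (\<lambda>x. \<Sum>i\<in>UNIV. sharp_coord \<theta> c x $ i * dderiv (\<lambda>x. f (cinv c x)) (axis i 1) x)"
      by (rule smooth_on_sum[OF o smooth_on_mult[OF o sharp_coord_smooth[OF \<theta> c] smooth_on_dderiv[OF smooth_fun_D[OF f c]]]])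
    have eq: "deriv_along (sharp \<theta>) f (cinv c x) =
        (\<Sum>i\<in>UNIV. sharp_coord \<theta> c x $ i * dderiv (\<lambda>x. f (cinv c x)) (axis i 1) x)" if "x \<in> cimg c" for x
    proof -
      have "deriv_along (sharp \<theta>) f (cinv c x) = ctan c (cinv c x) (sharp_coord \<theta> c x) f"
        by (simp add: deriv_along_def sharp_ctan[OF \<theta> c cinv_in[OF that]] crd_cinv[OF c that])
      also have "\<dots> = (\<Sum>i\<in>UNIV. sharp_coord \<theta> c x $ i * ctan c (cinv c x) (axis i 1) f)"
        by (rule ctan_expand[OF c cinv_in[OF that] f])
      finally show ?thesis using f by (simp add: ctan_def crd_cinv[OF c that])
    qed
    show "smooth_on (cimg c) (\<lambda>x. deriv_along (sharp \<theta>) f (cinv c x))"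
      by (rule smooth_on_cong[OF o eq, THEN iffD2, OF _ s])
  qed
qed

end

section \<open>The Lee field\<close>

lemma affine_connection_field:
  assumes "affine_connection A D" "vector_field A X" "vector_field A Y"
  shows "vector_field A (D X Y)"
  using assms(1)[unfolded affine_connection_def, THEN conjunct1] assms(2,3) by blast

lemma levi_civita_D:
  assumes "levi_civita A g D"
  shows levi_civita_affine: "affine_connection A D"
    and levi_civita_torsion_free: "vector_field A X \<Longrightarrow> vector_field A Y \<Longrightarrow> D X Y = vf_add (D Y X) (lie_bracket X Y)"
    and levi_civita_compatible: "vector_field A X \<Longrightarrow> vector_field A Y \<Longrightarrow> vector_field A Z \<Longrightarrow>
      X p (eval2 g Y Z) = eval2 g (D X Y) Z p + eval2 g Y (D X Z) p"
  using assms[unfolded levi_civita_def, THEN conjunct1] assms[unfolded levi_civita_def, THEN conjunct2, THEN conjunct1]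
    assms[unfolded levi_civita_def, THEN conjunct2, THEN conjunct2] by blast+

section \<open>The covariant derivative of the Lee form\<close>

locale lck_gauduchon = riem_manifold A g
  for A :: "('m::{t2_space,second_countable_topology}, real^'n) atlas" and g :: "'m form2" +
  fixes J :: "'m endo" and \<theta> :: "'m form1" and Dg D :: "'m connection" and t :: real
  assumes herm: "hermitian A J g" and lee: "lee_form A J g \<theta>" and lc: "levi_civita A g Dg"
    and gauduchon: "gauduchon_connection A J g Dg t D" and parallel: "parallel_form1 A D \<theta>"
begin

lemma theta: "one_form A \<theta>"
  using lee by (simp add: lee_form_def)

abbreviation T :: "'m vfield" where "T \<equiv> sharp \<theta>"

lemma J_in: "u \<in> tangent_space A p \<Longrightarrow> J p u \<in> tangent_space A p"
  and J_J: "u \<in> tangent_space A p \<Longrightarrow> J p (J p u) = tv_scale (-1) u"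
  and J_isometry: "u \<in> tangent_space A p \<Longrightarrow> v \<in> tangent_space A p \<Longrightarrow> g p (J p u) (J p v) = g p u v"
  and J_field: "vector_field A X \<Longrightarrow> vector_field A (on_field J X)"
  using herm by (simp_all add: hermitian_def complex_structure_def almost_complex_structure_def)

lemma J_skew: "u \<in> tangent_space A p \<Longrightarrow> v \<in> tangent_space A p \<Longrightarrow> g p (J p u) v = - g p u (J p v)"
  using J_isometry[of "J p u" p v] J_in[of u p] J_in[of v p] J_J[of u p] g_scale_left[of "J p v" p u "-1"] by simp

lemma theta_T: "u \<in> tangent_space A p \<Longrightarrow> g p (T p) u = \<theta> p u"
  and theta_T': "u \<in> tangent_space A p \<Longrightarrow> g p u (T p) = \<theta> p u"
  and T_in: "T p \<in> tangent_space A p"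
  using sharp[OF theta] g_sym by simp_all

lemma T_field: "vector_field A T"
  by (rule sharp_vector_field[OF theta])

lemma Dg_in: "vector_field A X \<Longrightarrow> vector_field A Y \<Longrightarrow> Dg X Y p \<in> tangent_space A p"
  by (rule vector_field_tangent[OF affine_connection_field[OF levi_civita_affine[OF lc]]])

lemma D_in: "vector_field A X \<Longrightarrow> vector_field A Y \<Longrightarrow> D X Y p \<in> tangent_space A p"
  by (rule vector_field_tangent[OF affine_connection_field[OF gauduchon[unfolded gauduchon_connection_def, THEN conjunct1]]])

text \<open>The value of the Levi-Civita derivative of \<theta>. Since \<theta> is closed, this is
  the Hessian of a local potential of \<theta>.\<close>

definition hess :: "'m vfield \<Rightarrow> 'm vfield \<Rightarrow> 'm \<Rightarrow> real" where
  "hess X Y p = (t + 1) / 4 * (\<theta> p (T p) * g p (X p) (Y p) - \<theta> p (X p) * \<theta> p (Y p)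
     - \<theta> p (J p (X p)) * \<theta> p (J p (Y p)))"

text \<open>Because \<theta> is the pairing with T, the derivatives of \<theta> under the two
  connections differ exactly by the d\<omega> terms at Z = T, and one of these derivatives is
  0.\<close>

lemma cov_deriv_theta:
  assumes X: "vector_field A X" and Y: "vector_field A Y"
  shows "cov_deriv1 Dg \<theta> X Y p = hess X Y p"
proof -
  let ?\<omega> = "fundamental_form J g"
  have x: "X p \<in> tangent_space A p" "Y p \<in> tangent_space A p" using X Y vector_field_tangent by blast+
  have DX: "D X Y p \<in> tangent_space A p" "Dg X Y p \<in> tangent_space A p"
    using D_in Dg_in X Y by blast+
  note JT = J_in[OF T_in] and JX = J_in[OF x(1)] and JY = J_in[OF x(2)]
  have d: "ext_d2 ?\<omega> U V W p = wedge12 \<theta> ?\<omega> U V W p"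
    if "vector_field A U" "vector_field A V" "vector_field A W" for U V W
    using lee that by (simp add: lee_form_def)
  have z: "\<theta> p (J p (T p)) = 0"
    using J_skew[OF T_in T_in, of p] theta_T[OF JT] g_sym[OF T_in JT] by simp
  \<comment> \<open>The first two terms of the wedge product are \<theta>(JX) \<theta>(JY) and
    -\<theta>(JY) \<theta>(JX); the third contains \<theta>(JT) = g(T, JT) = 0.\<close>
  have "ext_d2 ?\<omega> (on_field J X) (on_field J Y) (on_field J T) p = 0"
    unfolding d[OF J_field[OF X] J_field[OF Y] J_field[OF T_field]]
    using J_isometry[OF JY T_in] J_isometry[OF JT x(1)] theta_T'[OF JY] J_skew[OF T_in x(1)] theta_T[OF JX] z
    by (simp add: wedge12_def eval1_def eval2_def on_field_def fundamental_form_def)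
  moreover have "ext_d2 ?\<omega> (on_field J X) Y T p =
      \<theta> p (J p (X p)) * \<theta> p (J p (Y p)) + \<theta> p (Y p) * \<theta> p (X p) - \<theta> p (T p) * g p (X p) (Y p)"
    unfolding d[OF J_field[OF X] Y T_field]
    using theta_T'[OF JY] J_isometry[OF T_in x(1)] theta_T[OF x(1)] J_J[OF x(1)] g_scale_left[OF x(2,1), of "-1"]
    by (simp add: wedge12_def eval1_def eval2_def on_field_def fundamental_form_def)
  moreover have "eval2 g (D X Y) T p = eval2 g (Dg X Y) T p
      - (t - 1) / 4 * ext_d2 ?\<omega> (on_field J X) (on_field J Y) (on_field J T) p
      - (t + 1) / 4 * ext_d2 ?\<omega> (on_field J X) Y T p"
    using gauduchon X Y T_field by (simp add: gauduchon_connection_def)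
  moreover have "cov_deriv1 D \<theta> X Y p = 0" using parallel X Y by (simp add: parallel_form1_def)
  ultimately have "cov_deriv1 Dg \<theta> X Y p =
      - ((t + 1) / 4) * (\<theta> p (J p (X p)) * \<theta> p (J p (Y p)) + \<theta> p (Y p) * \<theta> p (X p) - \<theta> p (T p) * g p (X p) (Y p))"
    using theta_T'[OF DX(1)] theta_T'[OF DX(2)] by (simp add: cov_deriv1_def eval1_def eval2_def)
  then show ?thesis unfolding hess_def by (simp add: field_simps)
qed

text \<open>The bracket is a difference of two covariant derivatives; its tangency follows from
  theirs, without computing with derivations.\<close>

lemma lie_bracket_LC:
  assumes X: "vector_field A X" and Y: "vector_field A Y"
  shows "lie_bracket X Y p \<in> tangent_space A p" "Dg X Y p = tv_add (Dg Y X p) (lie_bracket X Y p)"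
proof -
  have DX: "Dg X Y p \<in> tangent_space A p" "Dg Y X p \<in> tangent_space A p"
    using Dg_in X Y by blast+
  from fun_cong[OF levi_civita_torsion_free[OF lc X Y], of p] show e: "Dg X Y p = tv_add (Dg Y X p) (lie_bracket X Y p)"
    by (simp add: vf_add_def)
  have "lie_bracket X Y p = tv_add (Dg X Y p) (tv_scale (-1) (Dg Y X p))"
    unfolding e by (simp add: tv_add_def tv_scale_def)
  then show "lie_bracket X Y p \<in> tangent_space A p" using DX tv_add_in tv_scale_in by simp
qed

text \<open>This is L_T g = 2 \<open>hess\<close>, symmetrised: metric compatibility differentiates
  g along T, the torsion condition trades \<open>Dg T Y\<close> for \<open>Dg Y T\<close> plus the
  bracket, and g(\<open>Dg Y T\<close>, Z) is the derivative of \<theta>.\<close>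

lemma lie_derivative_metric:
  assumes Y: "vector_field A Y" and Z: "vector_field A Z"
  shows "T p (eval2 g Y Z) = g p (lie_bracket T Y p) (Z p) + g p (Y p) (lie_bracket T Z p) + hess Y Z p + hess Z Y p"
proof -
  have y: "Y p \<in> tangent_space A p" "Z p \<in> tangent_space A p" using Y Z vector_field_tangent by blast+
  have comp: "U p (eval2 g V W) = g p (Dg U V p) (W p) + g p (V p) (Dg U W p)"
    if "vector_field A U" "vector_field A V" "vector_field A W" for U V W
    using levi_civita_compatible[OF lc that] by (simp add: eval2_def)
  have DT: "g p (Dg U T p) (V p) = hess U V p" if U: "vector_field A U" and V: "vector_field A V" for U V
  proof -
    have "eval2 g T V = eval1 \<theta> V"
      using theta_T[OF vector_field_tangent[OF V]] by (simp add: eval2_def eval1_def)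
    then show ?thesis
      using comp[OF U T_field V] cov_deriv_theta[OF U V, of p] theta_T[OF Dg_in[OF U V]]
      by (simp add: cov_deriv1_def eval1_def)
  qed
  have "T p (eval2 g Y Z) = g p (Dg T Y p) (Z p) + g p (Y p) (Dg T Z p)"
    by (rule comp[OF T_field Y Z])
  also have "g p (Dg T Y p) (Z p) = hess Y Z p + g p (lie_bracket T Y p) (Z p)"
    using lie_bracket_LC[OF T_field Y, of p] g_add_left[OF y(2) Dg_in[OF Y T_field]] DT[OF Y Z] by simp
  also have "g p (Y p) (Dg T Z p) = hess Z Y p + g p (Y p) (lie_bracket T Z p)"
    using lie_bracket_LC[OF T_field Z, of p] g_add_right[OF y(1) Dg_in[OF Z T_field]] DT[OF Z Y]
      g_sym[OF y(1) Dg_in[OF Z T_field]] by simp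
  finally show ?thesis by simp
qed

section \<open>The divergence of the Lee field in a chart\<close>

abbreviation \<tau> :: "'m set \<times> ('m \<Rightarrow> real^'n) \<Rightarrow> real^'n \<Rightarrow> real^'n" where "\<tau> \<equiv> sharp_coord \<theta>"

text \<open>The row index is the direction of differentiation, so this is the transpose of the usual
  Jacobian matrix of \<tau>.\<close>

definition jac :: "'m set \<times> ('m \<Rightarrow> real^'n) \<Rightarrow> real^'n \<Rightarrow> real^'n^'n" where
  "jac c x = (\<chi> i e. dderiv (\<lambda>x. \<tau> c x $ e) (axis i 1) x)"

text \<open>The components are read off by applying the bracket to cut-off coordinates: the
  coordinate field sends them to locally constant functions, which T kills, and T sends them to the
  components of \<tau>.\<close>

lemma lie_bracket_coord_field:
  assumes c: "c \<in> A" "p \<in> fst c" and b: "chart_bump c W \<eta> K" "p \<in> W"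
  shows "lie_bracket T (coord_field c \<eta> (axis i 1)) p = ctan c p (- (jac c (snd c p) $ i))"
proof -
  let ?E = "coord_field c \<eta> (axis i 1)"
  let ?y = "coord_fun c \<eta>"
  note E = coord_field_vector_field[OF c(1) b(1)]
  have W: "open W" "W \<subseteq> fst c" using b(1) by (auto simp: chart_bump_def)
  obtain w where w: "lie_bracket T ?E p = ctan c p w"
    using tangent_is_ctan[OF c lie_bracket_LC(1)[OF T_field E]] by blast
  have "w $ e = - dderiv (\<lambda>x. \<tau> c x $ e) (axis i 1) (snd c p)" for e
  proof -
    note y = coord_fun_smooth[OF c(1) b(1), of e]
    have dE: "smooth_fun A (deriv_along ?E (?y e))" "smooth_fun A (deriv_along T (?y e))"
      using E T_field y by (auto simp: vector_field_def)
    have "deriv_along ?E (?y e) q = axis i 1 $ e" if "q \<in> W" for q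
      using ctan_coord_fun[OF c(1) b(1) that] coord_field_eq[OF b(1) that] by (simp add: deriv_along_def)
    from tangent_local[OF T_in dE(1) smooth_fun_const W(1) b(2) this]
    have 1: "T p (deriv_along ?E (?y e)) = 0" using tangent_const[OF T_in] by simp
    have "deriv_along T (?y e) q = \<tau> c (snd c q) $ e" if "q \<in> W" "q \<in> fst c" for q
      using ctan_coord_fun[OF c(1) b(1) that(1)] sharp_ctan[OF theta c(1) that(2)] by (simp add: deriv_along_def)
    from ctan_local[OF c dE(2) W(1) b(2) this]
    have 2: "?E p (deriv_along T (?y e)) = dderiv (\<lambda>x. \<tau> c x $ e) (axis i 1) (snd c p)"
      using coord_field_eq[OF b] by simp
    have "w $ e = lie_bracket T ?E p (?y e)" using ctan_coord_fun[OF c(1) b] w by simp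
    then show ?thesis using 1 2 by (simp add: lie_bracket_def)
  qed
  then have "w = - (jac c (snd c p) $ i)" by (simp add: vec_eq_iff jac_def)
  then show ?thesis using w by simp
qed

text \<open>L_T g = 2 \<open>hess\<close> evaluated on coordinate fields; the two \<open>jac\<close>
  terms come from the brackets, one for each slot of the metric. \<open>hess\<close> is factored as
  C G in preparation for Jacobi's formula.\<close>

lemma dderiv_gmat:
  assumes c: "c \<in> A" "x \<in> cimg c"
  obtains C where "trace C = (t + 1) / 4 * (real CARD('n) - 2) * \<theta> (cinv c x) (T (cinv c x))"
    "\<And>i j. dderiv (\<lambda>x. gmat c x $ i $ j) (\<tau> c x) x =
       (2 *\<^sub>R (C ** gmat c x) - jac c x ** gmat c x - gmat c x ** transpose (jac c x)) $ i $ j"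
proof -
  define p where "p = cinv c x"
  have p: "p \<in> fst c" "snd c p = x" using cinv_in[OF c(2)] crd_cinv[OF c] by (auto simp: p_def)
  let ?G = "gmat c x"
  let ?\<tau> = "\<tau> c x"
  obtain W \<eta> K where b: "chart_bump c W \<eta> K" "p \<in> W"
    using chart_bump_exists[OF c(1) p(1) open_UNIV UNIV_I] .
  have W: "open W" "W \<subseteq> fst c" using b(1) by (auto simp: chart_bump_def)
  let ?E = "\<lambda>i. coord_field c \<eta> (axis i 1)"
  note E = coord_field_vector_field[OF c(1) b(1)]
  have Ep: "?E i q = ctan c q (axis i 1)" if "q \<in> W" for i q by (rule coord_field_eq[OF b(1) that])
  have Tp: "T p = ctan c p ?\<tau>" using sharp_ctan[OF theta c(1) p(1)] p(2) by simp
  obtain \<sigma> where \<sigma>: "J p (T p) = ctan c p \<sigma>" using tangent_is_ctan[OF c(1) p(1) J_in[OF T_in]] by blast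
  let ?k = "\<theta> p (T p)"
  have gG: "g p (ctan c p u) (ctan c p w) = u \<bullet> (?G *v w)" for u w using g_ctan[OF c(1) p(1)] p(2) by simp
  note Gs = gmat_sym[OF c]
  have ks: "?\<tau> \<bullet> (?G *v ?\<tau>) = ?k" using theta_T[OF T_in, of p] Tp gG by simp
  have kt: "\<sigma> \<bullet> (?G *v \<sigma>) = ?k" using J_isometry[OF T_in T_in, of p] theta_T[OF T_in, of p] \<sigma> gG by simp
  have Gi: "v \<bullet> (?G *v axis i 1) = (?G *v v) $ i" for v i
    using symmetric_form_eq[of ?G v "axis i 1", OF Gs] by (simp add: inner_axis' )
  have tE: "\<theta> p (?E i p) = (?G *v ?\<tau>) $ i" for i
  proof -
    have "g p (T p) (?E i p) = (?G *v ?\<tau>) $ i" unfolding Tp Ep[OF b(2)] gG Gi ..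
    then show ?thesis using theta_T[OF vector_field_tangent[OF E]] by simp
  qed
  have tJE: "\<theta> p (J p (?E i p)) = - (?G *v \<sigma>) $ i" for i
  proof -
    have "g p (J p (T p)) (?E i p) = (?G *v \<sigma>) $ i" unfolding \<sigma> Ep[OF b(2)] gG Gi ..
    then show ?thesis
      using theta_T[OF J_in[OF vector_field_tangent[OF E]]] J_skew[OF T_in vector_field_tangent[OF E]] by simp
  qed
  \<comment> \<open>\<open>hess\<close> with its second index raised: \<theta> becomes \<tau>, and
    \<theta> composed with J becomes -\<sigma>, where \<sigma> holds the components of JT. The two
    minus signs of the last product cancel.\<close>
  define C where "C = (\<chi> i l. (t + 1) / 4 * (?k * (if i = l then 1 else 0) - (?G *v ?\<tau>) $ i * ?\<tau> $ l - (?G *v \<sigma>) $ i * \<sigma> $ l))"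
  have GE: "g p (?E i p) (?E j p) = ?G $ i $ j" for i j
  proof -
    have "g p (?E i p) (?E j p) = (?G *v axis i 1) $ j" unfolding Ep[OF b(2)] gG Gi ..
    then show ?thesis by (simp add: matrix_vector_mult_basis column_def Gs)
  qed
  have tau_row: "(\<Sum>l\<in>UNIV. v $ l * ?G $ l $ j) = (?G *v v) $ j" for v j
    using Gs by (simp add: matrix_vector_mult_def mult_ac)
  have CG: "(C ** ?G) $ i $ j = hess (?E i) (?E j) p" for i j
  proof -
    have "(C ** ?G) $ i $ j = (t + 1) / 4 * (?k * (\<Sum>l\<in>UNIV. (if i = l then 1 else 0) * ?G $ l $ j)
        - (?G *v ?\<tau>) $ i * (\<Sum>l\<in>UNIV. ?\<tau> $ l * ?G $ l $ j) - (?G *v \<sigma>) $ i * (\<Sum>l\<in>UNIV. \<sigma> $ l * ?G $ l $ j))"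
      unfolding matrix_matrix_mult_def C_def vec_lambda_beta sum_distrib_left sum_subtractf[symmetric]
      by (intro sum.cong refl) (simp add: algebra_simps)
    also have "(\<Sum>l\<in>UNIV. (if i = l then 1 else 0) * ?G $ l $ j) = ?G $ i $ j"
      by (simp add: if_distrib[of "\<lambda>a. a * _"] cong: if_cong)
    finally show ?thesis unfolding hess_def GE tE tJE tau_row by simp
  qed
  have "trace C = (t + 1) / 4 * (\<Sum>i\<in>UNIV. ?k - (?G *v ?\<tau>) $ i * ?\<tau> $ i - (?G *v \<sigma>) $ i * \<sigma> $ i)"
    by (simp add: trace_def C_def sum_distrib_left)
  \<comment> \<open>The sums over the last two terms are the squared lengths of T and JT, which J
    being an isometry makes equal.\<close>
  also have "(\<Sum>i\<in>UNIV. ?k - (?G *v ?\<tau>) $ i * ?\<tau> $ i - (?G *v \<sigma>) $ i * \<sigma> $ i) = real CARD('n) * ?k - ?k - ?k"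
    using ks kt by (simp add: sum_subtractf inner_vec_def mult.commute)
  also have "(t + 1) / 4 * (real CARD('n) * ?k - ?k - ?k) = (t + 1) / 4 * (real CARD('n) - 2) * ?k"
    by (simp add: left_diff_distrib)
  finally have trC: "trace C = (t + 1) / 4 * (real CARD('n) - 2) * ?k" .
  have "dderiv (\<lambda>x. gmat c x $ i $ j) ?\<tau> x = (2 *\<^sub>R (C ** ?G) - jac c x ** ?G - ?G ** transpose (jac c x)) $ i $ j" for i j
  proof -
    have e: "eval2 g (?E i) (?E j) q = gmat c (snd c q) $ i $ j" if "q \<in> W" "q \<in> fst c" for q
      using that Ep by (simp add: eval2_def gmat_def cinv_crd[OF c(1)])
    have "dderiv (\<lambda>x. gmat c x $ i $ j) ?\<tau> x = T p (eval2 g (?E i) (?E j))"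
      using ctan_local[OF c(1) p(1) g_smooth[OF E E] W(1) b(2) e, of ?\<tau>] Tp p(2) by simp
    also have "\<dots> = g p (lie_bracket T (?E i) p) (?E j p) + g p (?E i p) (lie_bracket T (?E j) p) + hess (?E i) (?E j) p + hess (?E j) (?E i) p"
      by (rule lie_derivative_metric[OF E E])
    also have "g p (lie_bracket T (?E i) p) (?E j p) = - (jac c x ** ?G) $ i $ j"
      unfolding lie_bracket_coord_field[OF c(1) p(1) b] Ep[OF b(2)] gG p(2) Gi
      using tau_row[of "jac c x $ i" j] by (simp add: matrix_matrix_mult_def matrix_vector_mult_def sum_negf)
    also have "g p (?E i p) (lie_bracket T (?E j) p) = - (?G ** transpose (jac c x)) $ i $ j"
      unfolding lie_bracket_coord_field[OF c(1) p(1) b] Ep[OF b(2)] gG p(2)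
      by (simp add: inner_axis' matrix_matrix_mult_def matrix_vector_mult_def transpose_def sum_negf)
    also have "hess (?E j) (?E i) p = hess (?E i) (?E j) p"
      unfolding hess_def GE Gs[of j i] by (simp add: mult_ac)
    finally show ?thesis unfolding CG[symmetric] by simp
  qed
  then show thesis using that[of C] trC by (simp add: p_def)
qed

definition div_T :: "'m \<Rightarrow> real" where
  "div_T p = (t + 1) / 4 * (real CARD('n) - 2) * \<theta> p (T p)"

text \<open>The logarithmic derivative of the Gram determinant along T is twice that of its root: 2
  trace C comes from \<open>hess\<close>, and each bracket term contributes one -trace of
  \<open>jac\<close>.\<close>

lemma dderiv_vol_T:
  assumes c: "c \<in> A" "x \<in> cimg c"
  shows "dderiv (vol c) (\<tau> c x) x = (div_T (cinv c x) - trace (jac c x)) * vol c x"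
proof -
  let ?G = "gmat c x"
  let ?M = "jac c x"
  obtain C where C: "trace C = div_T (cinv c x)"
    "\<And>i j. dderiv (\<lambda>x. gmat c x $ i $ j) (\<tau> c x) x = (2 *\<^sub>R (C ** ?G) - ?M ** ?G - ?G ** transpose ?M) $ i $ j"
    using dderiv_gmat[OF c] unfolding div_T_def by blast
  obtain H where H: "?G ** H = mat 1" "H ** ?G = mat 1"
    using gmat_invertible(1)[OF c] by (auto simp: invertible_def)
  \<comment> \<open>Jacobi's formula wants the factor G on the right, so G M^T is rewritten as (G
    M^T H) G with H inverse to G. Cyclicity of the trace removes the conjugation again.\<close>
  define C' where "C' = 2 *\<^sub>R C - ?M - ?G ** transpose ?M ** H"
  have "C' ** ?G = 2 *\<^sub>R (C ** ?G) - ?M ** ?G - ?G ** transpose ?M ** (H ** ?G)"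
  proof -
    have "(P - Q) ** R = P ** R - Q ** R" for P Q R :: "real^'n^'n"
      by (simp add: matrix_matrix_mult_def vec_eq_iff left_diff_distrib sum_subtractf)
    moreover have "(2 *\<^sub>R P) ** R = 2 *\<^sub>R (P ** R)" for P R :: "real^'n^'n"
      by (simp add: matrix_matrix_mult_def vec_eq_iff sum_distrib_left mult.assoc)
    ultimately show ?thesis by (simp add: C'_def matrix_mul_assoc)
  qed
  then have "C' ** ?G = 2 *\<^sub>R (C ** ?G) - ?M ** ?G - ?G ** transpose ?M" by (simp add: H)
  then have "dderiv (\<lambda>x. det (gmat c x)) (\<tau> c x) x = trace C' * det ?G"
    using C(2) smooth_on_imp_differentiable[OF gmat_smooth[OF c(1)] c(2)] by (intro Jacobi_formula) auto
  moreover have "trace C' = 2 * (div_T (cinv c x) - trace ?M)"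
  proof -
    have "trace (?G ** transpose ?M ** H) = trace (H ** (?G ** transpose ?M))" by (rule trace_mul_sym)
    also have "\<dots> = trace ?M" by (simp add: matrix_mul_assoc H trace_def transpose_def)
    finally show ?thesis using C(1) by (simp add: C'_def trace_def sum_subtractf sum_distrib_left[symmetric])
  qed
  ultimately have "dderiv (vol c) (\<tau> c x) x = 2 * (div_T (cinv c x) - trace ?M) / 2 * vol c x"
    by (intro dderiv_vol[OF c]) simp
  then show ?thesis by (simp only: nonzero_mult_div_cancel_left zero_neq_numeral[symmetric] not_False_eq_True)
qed

text \<open>This is div (h T) times the density. The trace of \<open>jac\<close> from
  differentiating \<tau> cancels against the one in \<open>dderiv_vol_T\<close>.\<close>

lemma divergence_formula:
  assumes c: "c \<in> A" "x \<in> cimg c" and h: "smooth_fun A h"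
  shows "(\<Sum>i\<in>UNIV. dderiv (\<lambda>x. (h (cinv c x) * \<tau> c x $ i) * vol c x) (axis i 1) x) =
    (T (cinv c x) h + h (cinv c x) * div_T (cinv c x)) * vol c x"
proof -
  let ?h = "\<lambda>x. h (cinv c x)"
  note V = smooth_on_imp_differentiable[OF vol_smooth[OF c(1)] c(2)]
  note dh = smooth_on_imp_differentiable[OF smooth_fun_D[OF h c(1)] c(2)]
  note dt = smooth_on_imp_differentiable[OF sharp_coord_smooth[OF theta c(1)] c(2)]
  have "(\<Sum>i\<in>UNIV. dderiv (\<lambda>x. (?h x * \<tau> c x $ i) * vol c x) (axis i 1) x) =
      (\<Sum>i\<in>UNIV. ?h x * (\<tau> c x $ i * dderiv (vol c) (axis i 1) x) + (?h x * (jac c x $ i $ i) + \<tau> c x $ i * dderiv ?h (axis i 1) x) * vol c x)"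
    by (intro sum.cong refl, subst dderiv_mult[OF differentiable_mult[OF dh dt] V], subst dderiv_mult[OF dh dt])
      (simp add: jac_def algebra_simps)
  also have "\<dots> = ?h x * dderiv (vol c) (\<tau> c x) x + (?h x * trace (jac c x) + dderiv ?h (\<tau> c x) x) * vol c x"
    unfolding dderiv_expand[OF V, of "\<tau> c x"] dderiv_expand[OF dh, of "\<tau> c x"] trace_def
    by (simp add: sum.distrib sum_distrib_left sum_distrib_right algebra_simps)
  also have "dderiv ?h (\<tau> c x) x = T (cinv c x) h"
    using sharp_ctan[OF theta c(1) cinv_in[OF c(2)]] h by (simp add: ctan_def crd_cinv[OF c])
  finally show ?thesis unfolding dderiv_vol_T[OF c] by (simp add: algebra_simps)
qed

end

section \<open>The divergence theorem\<close>

lemma absolutely_integrable_continuous_compact: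
  fixes f :: "'a::euclidean_space \<Rightarrow> 'b::euclidean_space"
  assumes "compact S" "continuous_on S f"
  shows "f absolutely_integrable_on S"
proof -
  have i: "integrable lborel (\<lambda>x. indicator S x *\<^sub>R f x)" by (rule borel_integrable_compact[OF assms])
  then show ?thesis
    unfolding set_integrable_def using integrable_completion[OF borel_measurable_integrable[OF i]] by simp
qed

text \<open>The library theorem integrates functions with values in a space of vectors, so
  \<open>f\<close> passes through \<open>real^1\<close>; its integrability condition holds by
  continuity on a compact set.\<close>

lemma integral_change_of_variables_compact_real:
  fixes f :: "real^'n::{finite,wellorder} \<Rightarrow> real"
  assumes S: "compact S" and d: "\<And>x. x \<in> S \<Longrightarrow> (h has_derivative h' x) (at x within S)"
    and inj: "inj_on h S" and f: "continuous_on (h ` S) f"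
  shows "integral (h ` S) f = integral S (\<lambda>x. \<bar>det (matrix (h' x))\<bar> * f (h x))"
proof -
  let ?v = "\<lambda>a::real. vec a :: real^1"
  have bl: "bounded_linear (\<lambda>w::real^1. w $ 1)" by (rule bounded_linear_vec_nth)
  have "continuous_on S h" using d has_derivative_continuous_on by blast
  then have hS: "compact (h ` S)" by (rule compact_continuous_image[OF _ S])
  have "continuous_on (h ` S) (\<lambda>y. ?v (f y))"
    unfolding vec_def by (intro continuous_on_vec_lambda f)
  then have ai: "(\<lambda>y. ?v (f y)) absolutely_integrable_on h ` S"
    by (rule absolutely_integrable_continuous_compact[OF hS])
  have leb: "S \<in> sets lebesgue" using S by (simp add: compact_imp_closed borel_closed)
  note cv = has_absolute_integral_change_of_variables[OF leb d inj, where f = "\<lambda>y. ?v (f y)" and b = "integral (h ` S) (\<lambda>y. ?v (f y))"]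
  have ai': "(\<lambda>x. \<bar>det (matrix (h' x))\<bar> *\<^sub>R ?v (f (h x))) absolutely_integrable_on S"
    and eq: "integral S (\<lambda>x. \<bar>det (matrix (h' x))\<bar> *\<^sub>R ?v (f (h x))) = integral (h ` S) (\<lambda>y. ?v (f y))"
    using cv ai by blast+
  have "integral (h ` S) f = integral (h ` S) (\<lambda>y. ?v (f y)) $ 1"
    using integral_linear[OF set_lebesgue_integral_eq_integral(1)[OF ai] bl] by (simp add: o_def)
  also have "\<dots> = integral S (\<lambda>x. \<bar>det (matrix (h' x))\<bar> * f (h x))"
    unfolding eq[symmetric]
    using integral_linear[OF set_lebesgue_integral_eq_integral(1)[OF ai'] bl] by (simp add: o_def)
  finally show ?thesis .
qed

lemma det_congruence:
  fixes M G :: "real^'n^'n"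
  shows "det (transpose M ** G ** M) = (det M)\<^sup>2 * det G"
  by (simp add: det_mul power2_eq_square mult_ac)

section \<open>Partitions of unity and transition of tangent vectors\<close>

context vec_manifold
begin

text \<open>No order on the index set is needed: in the inductive step the new function is multiplied
  by the product of the \<open>1 - f j\<close> that are already there.\<close>

lemma partition_of_unity_finite:
  assumes "finite I" "\<And>i. i \<in> I \<Longrightarrow> smooth_fun A (f i)" "\<And>i q. i \<in> I \<Longrightarrow> 0 \<le> f i q \<and> f i q \<le> 1"
  shows "\<exists>\<rho>. (\<forall>i\<in>I. smooth_fun A (\<rho> i) \<and> (\<forall>q. 0 \<le> \<rho> i q) \<and> (\<forall>q. f i q = 0 \<longrightarrow> \<rho> i q = 0)) \<and>
    (\<forall>q. (\<Sum>i\<in>I. \<rho> i q) = 1 - (\<Prod>i\<in>I. 1 - f i q))"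
  using assms
proof (induction I)
  case empty then show ?case by simp
next
  case (insert k I)
  then obtain \<rho> where r: "\<forall>i\<in>I. smooth_fun A (\<rho> i) \<and> (\<forall>q. 0 \<le> \<rho> i q) \<and> (\<forall>q. f i q = 0 \<longrightarrow> \<rho> i q = 0)"
    "\<forall>q. (\<Sum>i\<in>I. \<rho> i q) = 1 - (\<Prod>i\<in>I. 1 - f i q)" by auto
  let ?r = "\<rho>(k := \<lambda>q. f k q * (\<Prod>i\<in>I. 1 - f i q))"
  have "smooth_fun A (\<lambda>q. f k q * (\<Prod>i\<in>I. 1 - f i q))"
    using insert.prems by (intro smooth_fun_mult smooth_fun_prod smooth_fun_minus smooth_fun_const) auto
  moreover have "0 \<le> f k q * (\<Prod>i\<in>I. 1 - f i q)" for q
    using insert.prems(2) by (intro mult_nonneg_nonneg prod_nonneg) auto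
  ultimately have "\<forall>i\<in>insert k I. smooth_fun A (?r i) \<and> (\<forall>q. 0 \<le> ?r i q) \<and> (\<forall>q. f i q = 0 \<longrightarrow> ?r i q = 0)"
    using r(1) insert.hyps by auto
  moreover have "(\<Sum>i\<in>insert k I. ?r i q) = 1 - (\<Prod>i\<in>insert k I. 1 - f i q)" for q
  proof -
    have "(\<Sum>i\<in>I. ?r i q) = (\<Sum>i\<in>I. \<rho> i q)" using insert.hyps by (intro sum.cong) auto
    then show ?thesis using r(2) insert.hyps by (simp add: algebra_simps)
  qed
  ultimately show ?case by blast
qed

text \<open>Every point carries a chart with a bump around it, so the index set can be a finite set
  of points, namely those whose sets \<open>W\<close> already cover the manifold.\<close>

lemma partition_of_unity:
  assumes "compact (UNIV :: 'm set)"
  shows "\<exists>(I :: 'm set) c K \<rho>. finite I \<and> (\<forall>i\<in>I. c i \<in> A \<and> compact (K i) \<and> K i \<subseteq> fst (c i) \<and>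
    smooth_fun A (\<rho> i) \<and> (\<forall>q. 0 \<le> \<rho> i q) \<and> (\<forall>q. q \<notin> K i \<longrightarrow> \<rho> i q = 0)) \<and> (\<forall>q. (\<Sum>i\<in>I. \<rho> i q) = 1)"
proof -
  have "\<forall>p. \<exists>z. fst z \<in> A \<and> chart_bump (fst z) (fst (snd z)) (fst (snd (snd z))) (snd (snd (snd z))) \<and> p \<in> fst (snd z)"
  proof
    fix p
    obtain c where c: "c \<in> A" "p \<in> fst c" by (rule chart_at)
    obtain W \<eta> K where "chart_bump c W \<eta> K" "p \<in> W"
      using chart_bump_exists[OF c open_UNIV UNIV_I] .
    with c(1) show "\<exists>z. fst z \<in> A \<and> chart_bump (fst z) (fst (snd z)) (fst (snd (snd z))) (snd (snd (snd z))) \<and> p \<in> fst (snd z)"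
      by (intro exI[of _ "(c, W, \<eta>, K)"]) simp
  qed
  from choice[OF this] obtain z where z: "\<forall>p. fst (z p) \<in> A \<and>
      chart_bump (fst (z p)) (fst (snd (z p))) (fst (snd (snd (z p)))) (snd (snd (snd (z p)))) \<and> p \<in> fst (snd (z p))" ..
  define c W \<eta> K where "c p = fst (z p)" and "W p = fst (snd (z p))" and "\<eta> p = fst (snd (snd (z p)))"
    and "K p = snd (snd (snd (z p)))" for p
  have b: "\<And>p. c p \<in> A" "\<And>p. chart_bump (c p) (W p) (\<eta> p) (K p)" "\<And>p. p \<in> W p"
    using z unfolding c_def W_def \<eta>_def K_def by blast+
  have W: "open (W p)" for p using b(2)[of p] unfolding chart_bump_def by blast
  have "UNIV \<subseteq> (\<Union>p\<in>UNIV. W p)" using b(3) by blast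
  then obtain I where I: "finite I" "UNIV \<subseteq> (\<Union>p\<in>I. W p)"
    using compactE_image[OF assms, of UNIV W] W by auto
  have \<eta>: "smooth_fun A (\<eta> i)" "0 \<le> \<eta> i q \<and> \<eta> i q \<le> 1" for i q
    using b(2)[of i] by (auto simp: chart_bump_def)
  obtain \<rho> where r: "\<forall>i\<in>I. smooth_fun A (\<rho> i) \<and> (\<forall>q. 0 \<le> \<rho> i q) \<and> (\<forall>q. \<eta> i q = 0 \<longrightarrow> \<rho> i q = 0)"
    "\<forall>q. (\<Sum>i\<in>I. \<rho> i q) = 1 - (\<Prod>i\<in>I. 1 - \<eta> i q)"
    using partition_of_unity_finite[OF I(1), of \<eta>] \<eta> by blast
  \<comment> \<open>Some \<open>W i\<close> contains q, and there \<eta> i is 1, so one factor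
    vanishes.\<close>
  have "(\<Prod>i\<in>I. 1 - \<eta> i q) = 0" for q
  proof -
    obtain i where "i \<in> I" "q \<in> W i" using I(2) by blast
    then show ?thesis using b(2)[of i] I(1) by (auto simp: chart_bump_def intro!: prod_zero bexI[of _ i])
  qed
  then have one: "(\<Sum>i\<in>I. \<rho> i q) = 1" for q using r(2) by simp
  have K: "compact (K i)" "K i \<subseteq> fst (c i)" "q \<notin> K i \<Longrightarrow> \<eta> i q = 0" for i q
    using b(2)[of i] by (auto simp: chart_bump_def)
  show ?thesis
  proof (intro exI conjI ballI allI impI)
    show "finite I" by (rule I(1))
    show "c i \<in> A" "compact (K i)" "K i \<subseteq> fst (c i)" for i by (rule b(1) K)+
    show "smooth_fun A (\<rho> i)" "0 \<le> \<rho> i q" "q \<notin> K i \<Longrightarrow> \<rho> i q = 0" if "i \<in> I" for i q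
      using r(1) that K(3) by simp_all
    show "(\<Sum>i\<in>I. \<rho> i q) = 1" for q by (rule one)
  qed
qed

lemma ctan_transition:
  assumes c: "c \<in> A" "p \<in> fst c" and d: "d \<in> A" "p \<in> fst d"
  shows "ctan c p w = ctan d p (dderiv (\<lambda>x. snd d (cinv c x)) w (snd c p))"
proof
  fix f
  let ?t = "\<lambda>x. snd d (cinv c x)"
  let ?S = "snd c ` (fst c \<inter> fst d)"
  have S: "open ?S" "snd c p \<in> ?S" using open_crd_image[OF c(1) open_dom[OF d(1)]] c(2) d(2) by auto
  show "ctan c p w f = ctan d p (dderiv ?t w (snd c p)) f"
  proof (cases "smooth_fun A f")
    case True
    have t: "?t differentiable at (snd c p)" by (rule smooth_on_imp_differentiable[OF transition_smooth[OF c(1) d(1)] S(2)])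
    have tp: "?t (snd c p) = snd d p" using cinv_crd[OF c] by simp
    have "f (cinv c y) = f (cinv d (?t y))" if "y \<in> ?S" for y
      using that cinv_crd[OF c(1)] cinv_crd[OF d(1)] by auto
    from frechet_derivative_cong_open[OF S this]
    have "ctan c p w f = dderiv (\<lambda>x. f (cinv d (?t x))) w (snd c p)" using True by (simp add: ctan_def)
    also have "\<dots> = dderiv (\<lambda>x. f (cinv d x)) (dderiv ?t w (snd c p)) (?t (snd c p))"
      by (rule dderiv_comp[OF t]) (use ctan_differentiable[OF d True] tp in simp)
    finally show ?thesis using True tp by (simp add: ctan_def)
  qed (simp add: ctan_def)
qed

end

section \<open>Integrals of functions supported in one chart\<close>

context riem_manifold
begin

definition chart_int :: "'m set \<times> ('m \<Rightarrow> real^'n) \<Rightarrow> ('m \<Rightarrow> real) \<Rightarrow> real" where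
  "chart_int c f = integral (cimg c) (\<lambda>x. f (cinv c x) * vol c x)"

text \<open>The image of a chart is open and possibly unbounded, but the integrand vanishes off the
  compact set \<open>snd c\<close> + "K"; integrability and all computations reduce to that
  set.\<close>

lemma chart_integrand:
  assumes c: "c \<in> A" and K: "compact K" "K \<subseteq> fst c" and f: "continuous_on UNIV f" "\<And>q. q \<notin> K \<Longrightarrow> f q = 0"
  shows chart_integrand_compact: "compact (snd c ` K)"
    and chart_integrand_continuous: "continuous_on (cimg c) (\<lambda>x. f (cinv c x) * vol c x)"
    and chart_integrand_integrable: "(\<lambda>x. f (cinv c x) * vol c x) integrable_on (cimg c)"
    and chart_int_compact: "chart_int c f = integral (snd c ` K) (\<lambda>x. f (cinv c x) * vol c x)"
proof -
  let ?F = "\<lambda>x. f (cinv c x) * vol c x"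
  let ?K = "snd c ` K"
  show K': "compact ?K"
    by (rule compact_continuous_image[OF continuous_on_subset[OF cont_crd[OF c] K(2)] K(1)])
  have sub: "?K \<subseteq> cimg c" using K(2) by (auto simp: cimg_def)
  show cF: "continuous_on (cimg c) ?F"
    by (intro continuous_on_mult continuous_on_compose2[OF f(1) cont_cinv[OF c]] smooth_on_imp_continuous_on[OF vol_smooth[OF c]]) simp
  have z: "?F x = 0" if "x \<in> cimg c" "x \<notin> ?K" for x
  proof -
    have "cinv c x \<notin> K" using that crd_cinv[OF c that(1)] by force
    then show ?thesis using f(2) by simp
  qed
  have "?F integrable_on ?K"
    by (rule set_lebesgue_integral_eq_integral(1)[OF absolutely_integrable_continuous_compact[OF K' continuous_on_subset[OF cF sub]]])
  then have "(?F has_integral integral ?K ?F) ?K" by (rule integrable_integral)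
  then have "((\<lambda>x. if x \<in> ?K then ?F x else 0) has_integral integral ?K ?F) (cimg c)"
    using has_integral_restrict[OF sub, of ?F] by simp
  then have "(?F has_integral integral ?K ?F) (cimg c)"
    by (rule has_integral_eq[rotated]) (use z in auto)
  then show "?F integrable_on (cimg c)" "chart_int c f = integral ?K ?F"
    unfolding chart_int_def by (auto intro: integral_unique)
qed

lemma chart_int_cmult: "chart_int c (\<lambda>q. a * f q) = a * chart_int c f"
  by (simp add: chart_int_def mult.assoc)

lemma chart_int_sum:
  assumes c: "c \<in> A" and K: "compact K" "K \<subseteq> fst c" and I: "finite I"
    and f: "\<And>i. i \<in> I \<Longrightarrow> continuous_on UNIV (f i)" "\<And>i q. i \<in> I \<Longrightarrow> q \<notin> K \<Longrightarrow> f i q = 0"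
  shows "chart_int c (\<lambda>q. \<Sum>i\<in>I. f i q) = (\<Sum>i\<in>I. chart_int c (f i))"
  unfolding chart_int_def sum_distrib_right
  by (rule integral_sum[OF I]) (rule chart_integrand_integrable[OF c K f])

lemma chart_int_nonneg:
  assumes c: "c \<in> A" and K: "compact K" "K \<subseteq> fst c" and f: "continuous_on UNIV f" "\<And>q. q \<notin> K \<Longrightarrow> f q = 0"
    and pos: "\<And>q. 0 \<le> f q"
  shows "0 \<le> chart_int c f" "chart_int c f = 0 \<Longrightarrow> f q = 0"
proof -
  let ?F = "\<lambda>x. f (cinv c x) * vol c x"
  have int: "?F integrable_on cimg c" by (rule chart_integrand_integrable[OF c K f])
  have F0: "0 \<le> ?F x" if "x \<in> cimg c" for x using pos vol_pos[OF c that] by simp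
  show "0 \<le> chart_int c f" unfolding chart_int_def by (rule integral_nonneg[OF int F0])
  assume 0: "chart_int c f = 0"
  show "f q = 0"
  proof (cases "q \<in> K")
    case True
    then have q: "q \<in> fst c" using K(2) by blast
    \<comment> \<open>On a box around the point the integrand is continuous and nonnegative with
      integral 0, hence 0; dividing by the positive density gives f q = 0.\<close>
    obtain a b where ab: "snd c q \<in> box a b" "cbox a b \<subseteq> cimg c"
      by (rule open_contains_cbox[OF open_cimg[OF c] crd_in[OF q]])
    have cab: "continuous_on (cbox a b) ?F" by (rule continuous_on_subset[OF chart_integrand_continuous[OF c K f] ab(2)])
    have iab: "?F integrable_on cbox a b" by (rule integrable_continuous[OF cab])
    have "integral (cbox a b) ?F \<le> chart_int c f" unfolding chart_int_def
      by (rule integral_subset_le[OF ab(2) iab int]) (simp add: F0)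
    moreover have "0 \<le> integral (cbox a b) ?F" using ab(2) by (intro integral_nonneg[OF iab] F0) auto
    ultimately have "(?F has_integral 0) (cbox a b)" using 0 integrable_integral[OF iab] by simp
    then have "?F (snd c q) = 0"
    proof (rule has_integral_0_cbox_imp_0[OF cab, rotated])
      show "0 \<le> ?F x" if "x \<in> box a b" for x using that ab(2) box_subset_cbox[of a b] by (intro F0) blast
      show "snd c q \<in> cbox a b" "box a b \<noteq> {}" using ab(1) box_subset_cbox[of a b] by blast+
    qed
    then show ?thesis using vol_pos[OF c crd_in[OF q]] cinv_crd[OF c q] by simp
  qed (rule f(2))
qed

end

text \<open>The same setting over a well-ordered index type, as the change of variables theorem
  demands.\<close>

locale lck_gauduchon_wo = lck_gauduchon A g J \<theta> Dg D t
  for A :: "('m::{t2_space,second_countable_topology}, real^'n::{finite,wellorder}) atlas"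
    and g :: "'m form2" and J :: "'m endo" and \<theta> :: "'m form1" and Dg D :: "'m connection" and t :: real
begin

text \<open>The Gram matrices of two charts are congruent through the Jacobian matrix M of the
  transition map, so their determinants differ by (det M)^2, and the root of this is |det
  M|.\<close>

lemma vol_transition:
  assumes c: "c \<in> A" "p \<in> fst c" and d: "d \<in> A" "p \<in> fst d"
  shows "vol c (snd c p) = \<bar>det (matrix (frechet_derivative (\<lambda>x. snd d (cinv c x)) (at (snd c p))))\<bar> * vol d (snd d p)"
proof -
  let ?D = "frechet_derivative (\<lambda>x. snd d (cinv c x)) (at (snd c p))"
  let ?M = "matrix ?D"
  have "gmat c (snd c p) $ i $ j = (transpose ?M ** gmat d (snd d p) ** ?M) $ i $ j" for i j
  proof -
    have "gmat c (snd c p) $ i $ j = g p (ctan c p (axis i 1)) (ctan c p (axis j 1))"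
      by (simp add: gmat_def cinv_crd[OF c])
    also have "\<dots> = ?D (axis i 1) \<bullet> (gmat d (snd d p) *v ?D (axis j 1))"
      unfolding ctan_transition[OF c d] g_ctan[OF d] ..
    also have "\<dots> = (transpose ?M ** (gmat d (snd d p) ** ?M)) $ i $ j"
      by (simp add: inner_vec_def matrix_matrix_mult_def matrix_vector_mult_def transpose_def matrix_def)
    finally show ?thesis by (simp add: matrix_mul_assoc)
  qed
  then have "gmat c (snd c p) = transpose ?M ** gmat d (snd d p) ** ?M" by (simp add: vec_eq_iff)
  then show ?thesis unfolding vol_def by (simp add: det_congruence abs_mult real_sqrt_mult)
qed

text \<open>On the coordinate image of \<open>K\<close> the transition map is defined and injective,
  and \<open>vol_transition\<close> absorbs the Jacobian factor from the change of
  variables.\<close>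

lemma chart_int_transition:
  assumes c: "c \<in> A" and d: "d \<in> A" and K: "compact K" "K \<subseteq> fst c \<inter> fst d"
    and f: "continuous_on UNIV f" "\<And>q. q \<notin> K \<Longrightarrow> f q = 0"
  shows "chart_int c f = chart_int d f"
proof -
  let ?t = "\<lambda>x. snd d (cinv c x)"
  let ?S = "snd c ` K"
  have Kc: "K \<subseteq> fst c" and Kd: "K \<subseteq> fst d" using K by auto
  have tS: "?t ` ?S = snd d ` K" using cinv_crd[OF c] Kc by (force simp: image_iff)
  have der: "(?t has_derivative frechet_derivative ?t (at x)) (at x within ?S)" if "x \<in> ?S" for x
    by (rule has_derivative_at_withinI[OF smooth_on_has_derivative[OF transition_smooth[OF c d]]]) (use that K in auto)
  have inj: "inj_on ?t ?S"
  proof (rule inj_onI)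
    fix x y assume xy: "x \<in> ?S" "y \<in> ?S" "?t x = ?t y"
    then obtain p q where pq: "p \<in> K" "q \<in> K" "x = snd c p" "y = snd c q" by blast
    then have pq': "p \<in> fst c" "q \<in> fst c" using Kc by auto
    have "snd d p = snd d q" using xy(3) unfolding pq(3,4) cinv_crd[OF c pq'(1)] cinv_crd[OF c pq'(2)] .
    then have "p = q" using cinv_crd[OF d, of p] cinv_crd[OF d, of q] pq Kd by auto
    then show "x = y" using pq by simp
  qed
  have sub: "snd d ` K \<subseteq> cimg d" using Kd by (auto simp: cimg_def)
  have "continuous_on (?t ` ?S) (\<lambda>x. f (cinv d x) * vol d x)"
    unfolding tS by (rule continuous_on_subset[OF chart_integrand_continuous[OF d K(1) Kd f] sub])
  with chart_integrand_compact[OF c K(1) Kc f] der inj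
  have "integral (?t ` ?S) (\<lambda>x. f (cinv d x) * vol d x) =
      integral ?S (\<lambda>x. \<bar>det (matrix (frechet_derivative ?t (at x)))\<bar> * (f (cinv d (?t x)) * vol d (?t x)))"
    by (intro integral_change_of_variables_compact_real)
  moreover have "chart_int d f = integral (?t ` ?S) (\<lambda>x. f (cinv d x) * vol d x)"
    unfolding tS by (rule chart_int_compact[OF d K(1) Kd f])
  ultimately have "chart_int d f =
      integral ?S (\<lambda>x. \<bar>det (matrix (frechet_derivative ?t (at x)))\<bar> * (f (cinv d (?t x)) * vol d (?t x)))"
    by simp
  also have "\<dots> = integral ?S (\<lambda>x. f (cinv c x) * vol c x)"
  proof (rule integral_cong)
    fix x assume "x \<in> ?S"
    then obtain p where p: "x = snd c p" "p \<in> fst c" "p \<in> fst d" using K by auto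
    show "\<bar>det (matrix (frechet_derivative ?t (at x)))\<bar> * (f (cinv d (?t x)) * vol d (?t x)) = f (cinv c x) * vol c x"
      unfolding p(1) vol_transition[OF c p(2) d p(3)] cinv_crd[OF c p(2)] cinv_crd[OF d p(3)] by simp
  qed
  also have "\<dots> = chart_int c f" by (rule chart_int_compact[OF c K(1) Kc f, symmetric])
  finally show ?thesis by (rule sym)
qed

text \<open>The components \<open>\<Phi> i\<close> of h T times the density, extended by zero, are
  smooth with compact support on the whole of \<open>real^'n\<close>, so the integrals of their
  partial derivatives vanish.\<close>

lemma chart_int_divergence:
  assumes c: "c \<in> A" and K: "compact K" "K \<subseteq> fst c" and h: "smooth_fun A h" "\<And>q. q \<notin> K \<Longrightarrow> h q = 0"
  shows "chart_int c (\<lambda>q. T q h + h q * div_T q) = 0"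
proof -
  define \<Phi> where "\<Phi> i x = (if x \<in> cimg c then (h (cinv c x) * \<tau> c x $ i) * vol c x else 0)" for i x
  let ?K = "snd c ` K"
  have K': "compact ?K"
    by (rule compact_continuous_image[OF continuous_on_subset[OF cont_crd[OF c] K(2)] K(1)])
  have o: "open (- ?K)" using compact_imp_closed[OF K'] by (simp add: open_Compl)
  have z: "\<Phi> i x = 0" if "x \<in> - ?K" for i x
  proof (cases "x \<in> cimg c")
    case True
    then have "cinv c x \<notin> K" using that crd_cinv[OF c True] by force
    then show ?thesis using h(2) by (simp add: \<Phi>_def)
  qed (simp add: \<Phi>_def)
  have sub: "?K \<subseteq> cimg c" using K(2) by (auto simp: cimg_def)
  have smooth: "smooth_on UNIV (\<Phi> i)" for i
  proof (rule smooth_on_local)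
    fix x
    show "\<exists>S. open S \<and> x \<in> S \<and> smooth_on S (\<Phi> i)"
    proof (cases "x \<in> cimg c")
      case True
      note oc = open_cimg[OF c]
      have "smooth_on (cimg c) (\<lambda>x. (h (cinv c x) * \<tau> c x $ i) * vol c x)"
        by (rule smooth_on_mult[OF oc smooth_on_mult[OF oc smooth_fun_D[OF h(1) c] sharp_coord_smooth[OF theta c]] vol_smooth[OF c]])
      moreover have "smooth_on (cimg c) (\<Phi> i) \<longleftrightarrow> smooth_on (cimg c) (\<lambda>x. (h (cinv c x) * \<tau> c x $ i) * vol c x)"
        by (rule smooth_on_cong[OF oc]) (simp add: \<Phi>_def)
      ultimately show ?thesis using oc True by blast
    next
      case False
      have "smooth_on (- ?K) (\<Phi> i) \<longleftrightarrow> smooth_on (- ?K) (\<lambda>x. 0 :: real)"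
        by (rule smooth_on_cong[OF o z])
      then show ?thesis using o False sub smooth_on_const by blast
    qed
  qed
  have "(dderiv (\<Phi> i) (axis i 1) has_integral 0) UNIV" for i
    by (rule integral_dderiv_compact_support[OF smooth K']) (simp add: z)
  then have "((\<lambda>x. \<Sum>i\<in>UNIV. dderiv (\<Phi> i) (axis i 1) x) has_integral (\<Sum>i\<in>(UNIV :: 'n set). 0)) UNIV"
    by (intro has_integral_sum) auto
  moreover have "(\<Sum>i\<in>UNIV. dderiv (\<Phi> i) (axis i 1) x) =
      (if x \<in> cimg c then (T (cinv c x) h + h (cinv c x) * div_T (cinv c x)) * vol c x else 0)" for x
  proof (cases "x \<in> cimg c")
    case True
    have "dderiv (\<Phi> i) (axis i 1) x = dderiv (\<lambda>x. (h (cinv c x) * \<tau> c x $ i) * vol c x) (axis i 1) x" for i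
    proof -
      have "frechet_derivative (\<Phi> i) (at x) = frechet_derivative (\<lambda>x. (h (cinv c x) * \<tau> c x $ i) * vol c x) (at x)"
        by (rule frechet_derivative_cong_open[OF open_cimg[OF c] True]) (simp add: \<Phi>_def)
      then show ?thesis by simp
    qed
    then show ?thesis using divergence_formula[OF c True h(1)] True by simp
  next
    case False
    then have x: "x \<in> - ?K" using sub by blast
    have "frechet_derivative (\<Phi> i) (at x) = frechet_derivative (\<lambda>x. 0) (at x)" for i
      by (rule frechet_derivative_cong_open[OF o x z])
    then show ?thesis using False by simp
  qed
  ultimately have "((\<lambda>x. if x \<in> cimg c then (T (cinv c x) h + h (cinv c x) * div_T (cinv c x)) * vol c x else 0) has_integral 0) UNIV"
    by simp
  then have "((\<lambda>x. (T (cinv c x) h + h (cinv c x) * div_T (cinv c x)) * vol c x) has_integral 0) (cimg c)"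
    by (simp add: has_integral_restrict_UNIV)
  then show ?thesis unfolding chart_int_def by (rule integral_unique)
qed

lemma lee_form_zero:
  assumes comp: "compact (UNIV :: 'm set)" and n: "CARD('n) \<ge> 3" and t: "t \<noteq> -1"
  shows "zero_form A \<theta>"
proof -
  obtain I :: "'m set" and c K \<rho> where I: "finite I" and P: "\<forall>i\<in>I. c i \<in> A \<and> compact (K i) \<and> K i \<subseteq> fst (c i) \<and>
      smooth_fun A (\<rho> i) \<and> (\<forall>q. 0 \<le> \<rho> i q) \<and> (\<forall>q. q \<notin> K i \<longrightarrow> \<rho> i q = 0)"
    and one: "\<And>q. (\<Sum>i\<in>I. \<rho> i q) = 1"
    using partition_of_unity[OF comp] by (elim exE conjE) simp
  have c: "\<And>i. i \<in> I \<Longrightarrow> c i \<in> A" and K: "\<And>i. i \<in> I \<Longrightarrow> compact (K i)" "\<And>i. i \<in> I \<Longrightarrow> K i \<subseteq> fst (c i)"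
    and r: "\<And>i. i \<in> I \<Longrightarrow> smooth_fun A (\<rho> i)" "\<And>i q. i \<in> I \<Longrightarrow> 0 \<le> \<rho> i q" "\<And>i q. i \<in> I \<Longrightarrow> q \<notin> K i \<Longrightarrow> \<rho> i q = 0"
    using P by simp_all
  define k where "k q = \<theta> q (T q)" for q
  \<comment> \<open>The divergence of the field \<open>\<rho> i\<close> T.\<close>
  define d where "d i q = T q (\<rho> i) + \<rho> i q * div_T q" for i q
  have k0: "0 \<le> k q" for q
  proof (cases "T q = (\<lambda>f. 0)")
    case True
    then have "k q = g q (tv_scale 0 (T q)) (T q)" using theta_T[OF T_in, of q] by (simp add: k_def tv_scale_def)
    then show ?thesis using g_scale_left[OF T_in T_in] by simp
  qed (use g_pos[OF T_in] theta_T[OF T_in] in \<open>simp add: k_def less_imp_le\<close>)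
  have ks: "smooth_fun A k" using theta T_field by (simp add: k_def[abs_def] one_form_def eval1_def)
  \<comment> \<open>The constant with div T = \<kappa> |\<theta>|^2. It vanishes only for t = -1 or
    in real dimension 2.\<close>
  define \<kappa> where "\<kappa> = (t + 1) / 4 * (real CARD('n) - 2)"
  have \<kappa>: "\<kappa> \<noteq> 0" using n t by (simp add: \<kappa>_def)
  have div: "div_T q = \<kappa> * k q" for q by (simp add: div_T_def \<kappa>_def k_def)
  have ds: "smooth_fun A (d i)" if "i \<in> I" for i
    unfolding d_def[abs_def] div using T_field r(1)[OF that] ks
    by (intro smooth_fun_add smooth_fun_mult smooth_fun_const) (auto simp: vector_field_def deriv_along_def)
  have dz: "d i q = 0" if "i \<in> I" "q \<notin> K i" for i q
  proof -
    have o: "open (- K i)" using compact_imp_closed[OF K(1)[OF that(1)]] by (simp add: open_Compl)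
    have "T q (\<rho> i) = T q (\<lambda>_. 0)"
      by (rule tangent_local[OF T_in r(1)[OF that(1)] smooth_fun_const o]) (use that r(3) in auto)
    then show ?thesis using tangent_const[OF T_in] r(3)[OF that] by (simp add: d_def)
  qed
  have dsum: "(\<Sum>i\<in>I. d i q) = \<kappa> * k q" for q
  proof -
    have "(\<Sum>i\<in>I. T q (\<rho> i)) = T q (\<lambda>q. \<Sum>i\<in>I. \<rho> i q)" by (rule tangent_sum[OF T_in r(1), symmetric])
    also have "\<dots> = 0" unfolding one by (rule tangent_const[OF T_in])
    finally have "(\<Sum>i\<in>I. d i q) = (\<Sum>i\<in>I. \<rho> i q * div_T q)" by (simp add: d_def sum.distrib)
    also have "\<dots> = \<kappa> * k q" unfolding sum_distrib_right[symmetric] one div by simp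
    finally show ?thesis .
  qed
  have cont: "continuous_on UNIV (\<lambda>q. \<rho> i q * d j q)" if "i \<in> I" "j \<in> I" for i j
    by (rule smooth_fun_continuous[OF smooth_fun_mult[OF r(1) ds]]) (use that in auto)
  have "\<kappa> * (\<Sum>i\<in>I. chart_int (c i) (\<lambda>q. \<rho> i q * k q)) = (\<Sum>i\<in>I. chart_int (c i) (\<lambda>q. \<Sum>j\<in>I. \<rho> i q * d j q))"
    unfolding sum_distrib_left sum_distrib_left[symmetric, of "\<rho> _ _"] dsum
    by (intro sum.cong refl, subst chart_int_cmult[symmetric]) (simp add: mult_ac)
  also have "\<dots> = (\<Sum>i\<in>I. \<Sum>j\<in>I. chart_int (c i) (\<lambda>q. \<rho> i q * d j q))"
    by (intro sum.cong refl chart_int_sum[OF c K I] cont) (simp_all add: r(3))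
  \<comment> \<open>Each product is supported in both \<open>K i\<close> and \<open>K j\<close>, so
    it may be integrated in either chart. Afterwards the sum over i can be taken first and the
    \<open>\<rho> i\<close> add up to 1.\<close>
  also have "\<dots> = (\<Sum>i\<in>I. \<Sum>j\<in>I. chart_int (c j) (\<lambda>q. \<rho> i q * d j q))"
  proof (intro sum.cong refl)
    fix i j assume ij: "i \<in> I" "j \<in> I"
    show "chart_int (c i) (\<lambda>q. \<rho> i q * d j q) = chart_int (c j) (\<lambda>q. \<rho> i q * d j q)"
    proof (rule chart_int_transition[OF c[OF ij(1)] c[OF ij(2)] _ _ cont[OF ij]])
      show "compact (K i \<inter> K j)" using K(1) ij by (simp add: compact_Int)
      show "K i \<inter> K j \<subseteq> fst (c i) \<inter> fst (c j)" using K(2) ij by blast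
      show "\<rho> i q * d j q = 0" if "q \<notin> K i \<inter> K j" for q using that r(3) dz ij by auto
    qed
  qed
  also have "\<dots> = (\<Sum>j\<in>I. chart_int (c j) (\<lambda>q. \<Sum>i\<in>I. \<rho> i q * d j q))"
    by (subst sum.swap, intro sum.cong refl chart_int_sum[OF c K I, symmetric] cont) (simp_all add: dz)
  also have "\<dots> = (\<Sum>j\<in>I. chart_int (c j) (d j))"
    unfolding sum_distrib_right[symmetric] one by simp
  also have "\<dots> = 0"
  proof (rule sum.neutral, rule ballI)
    fix j assume j: "j \<in> I"
    show "chart_int (c j) (d j) = 0"
      unfolding d_def[abs_def] by (rule chart_int_divergence[OF c[OF j] K(1)[OF j] K(2)[OF j] r(1)[OF j] r(3)[OF j]])
  qed
  finally have 0: "(\<Sum>i\<in>I. chart_int (c i) (\<lambda>q. \<rho> i q * k q)) = 0" using \<kappa> by simp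
  have rk: "continuous_on UNIV (\<lambda>q. \<rho> i q * k q)" if "i \<in> I" for i
    by (rule smooth_fun_continuous[OF smooth_fun_mult[OF r(1)[OF that] ks]])
  have rz: "\<rho> i q * k q = 0" if "i \<in> I" "q \<notin> K i" for i q using r(3)[OF that] by simp
  have rp: "0 \<le> \<rho> i q * k q" if "i \<in> I" for i q using r(2)[OF that] k0 by simp
  \<comment> \<open>A vanishing sum of nonnegative numbers: each chart integral is 0, and then so is
    its continuous nonnegative integrand.\<close>
  have "chart_int (c i) (\<lambda>q. \<rho> i q * k q) = 0" if "i \<in> I" for i
    using 0 sum_nonneg_eq_0_iff[OF I, of "\<lambda>i. chart_int (c i) (\<lambda>q. \<rho> i q * k q)"]
      chart_int_nonneg(1)[OF c K rk rz rp] that by simp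
  then have "\<rho> i q * k q = 0" if "i \<in> I" for i q
    using chart_int_nonneg(2)[OF c K rk rz rp] that by blast
  then have "(\<Sum>i\<in>I. \<rho> i q * k q) = 0" for q by (rule sum.neutral[OF ballI])
  then have "k q = 0" for q unfolding sum_distrib_right[symmetric] one by simp
  then have "T q = (\<lambda>f. 0)" for q
    using g_pos[OF T_in, of q] theta_T[OF T_in, of q] by (force simp: k_def)
  then have "\<theta> q u = 0" if "u \<in> tangent_space A q" for q u
    using theta_T[OF that] g_scale_left[OF that T_in, of 0] by (simp add: tv_scale_def)
  then show ?thesis by (simp add: zero_form_def)
qed

end

section \<open>The dichotomy\<close>

text \<open>The case split is on t and not on \<theta>: for t = -1 the factor t + 1 of
  \<open>hess\<close> vanishes, which gives the second alternative even if \<theta> = 0.\<close>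

lemma theorem7p1_vec:
  fixes A :: "('m::{t2_space,second_countable_topology}, real^'n::{finite,wellorder}) atlas"
  assumes A: "smooth_atlas A" and n: "CARD('n) \<ge> 3"
    and comp: "compact (UNIV :: 'm set)"
    and lck: "lck A J g" and lee: "lee_form A J g \<theta>"
    and lc: "levi_civita A g Dg"
    and gau: "\<And>s. gauduchon_connection A J g Dg s (nabla s)"
    and par: "parallel_form1 A (nabla t) \<theta>"
  shows "(zero_form A \<theta> \<and> kaehler A J g \<and>
           (\<forall>s X Y. vector_field A X \<longrightarrow> vector_field A Y \<longrightarrow> nabla s X Y = Dg X Y)) \<or>
         (vaisman A J g \<and> t = -1 \<and> bismut_connection A J g Dg (nabla t))"
proof -
  have herm: "hermitian A J g" using lck by (simp add: lck_def)
  then have metric: "riemannian_metric A g" by (simp add: hermitian_def)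
  interpret lck_gauduchon_wo A g J \<theta> Dg "nabla t" t
    by (intro lck_gauduchon_wo.intro lck_gauduchon.intro riem_manifold.intro vec_manifold.intro
        riem_manifold_axioms.intro lck_gauduchon_axioms.intro A metric herm lee lc gau par)
  show ?thesis
  proof (cases "t = -1")
    case True
    have "hess X Y p = 0" for X Y p unfolding hess_def using True by simp
    then have "parallel_form1 A Dg \<theta>" using cov_deriv_theta by (simp add: parallel_form1_def)
    then have "vaisman A J g" using herm lee lc unfolding vaisman_def by blast
    then show ?thesis using True gau[of t] by (simp add: bismut_connection_def)
  next
    case False
    have z: "zero_form A \<theta>" by (rule lee_form_zero[OF comp n False])
    have d: "ext_d2 (fundamental_form J g) X Y Z p = 0"
      if "vector_field A X" "vector_field A Y" "vector_field A Z" for X Y Z p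
    proof -
      have "\<theta> p (X p) = 0" "\<theta> p (Y p) = 0" "\<theta> p (Z p) = 0"
        using z vector_field_tangent that by (auto simp: zero_form_def)
      moreover have "ext_d2 (fundamental_form J g) X Y Z p = wedge12 \<theta> (fundamental_form J g) X Y Z p"
        using lee that by (simp add: lee_form_def)
      ultimately show ?thesis by (simp add: wedge12_def eval1_def)
    qed
    \<comment> \<open>Both correction terms of the Gauduchon formula contain d\<omega> = 0;
      non-degeneracy of g, tested on fields through arbitrary tangent vectors, then identifies the
      connections.\<close>
    have "nabla s X Y = Dg X Y" if X: "vector_field A X" and Y: "vector_field A Y" for s X Y
    proof
      fix p
      have D: "nabla s X Y p \<in> tangent_space A p"
        by (rule vector_field_tangent[OF affine_connection_field[OF gau[unfolded gauduchon_connection_def, THEN conjunct1] X Y]])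
      show "nabla s X Y p = Dg X Y p"
      proof (rule g_eqI[OF D Dg_in[OF X Y]])
        fix w assume "w \<in> tangent_space A p"
        then obtain Z where Z: "vector_field A Z" "Z p = w" by (rule vector_field_at)
        have "eval2 g (nabla s X Y) Z p = eval2 g (Dg X Y) Z p
          - (s - 1) / 4 * ext_d2 (fundamental_form J g) (on_field J X) (on_field J Y) (on_field J Z) p
          - (s + 1) / 4 * ext_d2 (fundamental_form J g) (on_field J X) Y Z p"
          using gau[of s] X Y Z(1) by (simp add: gauduchon_connection_def)
        then show "g p (nabla s X Y p) w = g p (Dg X Y p) w"
          using d[OF J_field[OF X] J_field[OF Y] J_field[OF Z(1)]] d[OF J_field[OF X] Y Z(1)] Z(2)
          by (simp add: eval2_def)
      qed
    qed
    moreover have "kaehler A J g" using herm d by (simp add: kaehler_def)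
    ultimately show ?thesis using z by blast
  qed
qed

text \<open>The change of variables theorem of the library is only available for \<open>real^'n\<close> with a
  well-ordered index type; \<open>'e basis_index\<close> provides such a type with \<open>DIM('e)\<close> elements.\<close>

typedef (overloaded) 'e basis_index = "Basis :: 'e::euclidean_space set"
  using nonempty_Basis by blast

lemma basis_index_UNIV: "(UNIV :: 'e::euclidean_space basis_index set) = Abs_basis_index ` Basis"
  using type_definition.Abs_image[OF type_definition_basis_index] by blast

instance basis_index :: (euclidean_space) finite
  by standard (simp add: basis_index_UNIV)

text \<open>An arbitrary injection, along which the order of the natural numbers is pulled
  back.\<close>

definition basis_index_rank :: "'e::euclidean_space basis_index \<Rightarrow> nat" where
  "basis_index_rank = (SOME f. inj f)"

lemma inj_basis_index_rank: "inj (basis_index_rank :: 'e::euclidean_space basis_index \<Rightarrow> nat)"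
  unfolding basis_index_rank_def
proof (rule someI_ex[of inj])
  show "\<exists>f :: 'e basis_index \<Rightarrow> nat. inj f"
    using finite_imp_inj_to_nat_seg[OF finite[of "UNIV :: 'e basis_index set"]] by blast
qed

instantiation basis_index :: (euclidean_space) wellorder
begin

definition less_eq_basis_index :: "'a basis_index \<Rightarrow> 'a basis_index \<Rightarrow> bool" where
  "less_eq_basis_index i j \<longleftrightarrow> basis_index_rank i \<le> basis_index_rank j"

definition less_basis_index :: "'a basis_index \<Rightarrow> 'a basis_index \<Rightarrow> bool" where
  "less_basis_index i j \<longleftrightarrow> basis_index_rank i < basis_index_rank j"

instance
proof
  fix P :: "'a basis_index \<Rightarrow> bool" and a
  assume step: "\<And>x. (\<And>y. y < x \<Longrightarrow> P y) \<Longrightarrow> P x"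
  show "P a"
    by (induction a rule: measure_induct_rule[of basis_index_rank]) (rule step, simp add: less_basis_index_def)
next
  fix i j :: "'a basis_index"
  show "i = j" if "i \<le> j" "j \<le> i"
    using that by (intro injD[OF inj_basis_index_rank]) (simp add: less_eq_basis_index_def)
qed (auto simp: less_eq_basis_index_def less_basis_index_def)

end

lemma card_basis_index: "CARD('e::euclidean_space basis_index) = DIM('e)"
  by (rule type_definition.card[OF type_definition_basis_index])

section \<open>Linear identification of the model space with a space of vectors\<close>

definition to_vec :: "'e::euclidean_space \<Rightarrow> real^'e basis_index" where
  "to_vec x = (\<chi> i. x \<bullet> Rep_basis_index i)"

definition of_vec :: "real^'e basis_index \<Rightarrow> 'e::euclidean_space" where
  "of_vec v = (\<Sum>i\<in>UNIV. v $ i *\<^sub>R Rep_basis_index i)"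

lemma sum_basis_index: "(\<Sum>i\<in>UNIV. f (Rep_basis_index (i :: 'e basis_index))) = (\<Sum>b\<in>(Basis :: 'e::euclidean_space set). f b)"
proof -
  have "inj (Rep_basis_index :: 'e basis_index \<Rightarrow> 'e)" by (simp add: inj_on_def Rep_basis_index_inject)
  from sum.reindex[OF this, of f] show ?thesis
    by (simp add: type_definition.Rep_range[OF type_definition_basis_index])
qed

lemma of_vec_to_vec [simp]: "of_vec (to_vec x) = x"
  by (simp add: of_vec_def to_vec_def sum_basis_index[of "\<lambda>b. (x \<bullet> b) *\<^sub>R b"] euclidean_representation)

lemma to_vec_of_vec [simp]: "to_vec (of_vec v) = v"
proof -
  have R: "Rep_basis_index i \<bullet> Rep_basis_index j = (if i = j then 1 else 0)" for i j :: "'e::euclidean_space basis_index"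
    using inner_Basis[OF Rep_basis_index[of i] Rep_basis_index[of j]] by (simp add: Rep_basis_index_inject)
  show ?thesis
    by (simp add: to_vec_def of_vec_def vec_eq_iff inner_sum_left R if_distrib cong: if_cong)
qed

lemma bounded_linear_to_vec: "bounded_linear (to_vec :: 'e::euclidean_space \<Rightarrow> real^'e basis_index)"
  by (rule linear_conv_bounded_linear[THEN iffD1], rule linearI)
    (simp_all add: to_vec_def vec_eq_iff inner_add_left)

lemma bounded_linear_of_vec: "bounded_linear (of_vec :: real^'e basis_index \<Rightarrow> 'e::euclidean_space)"
  by (rule linear_conv_bounded_linear[THEN iffD1], rule linearI)
    (simp_all add: of_vec_def scaleR_add_left sum.distrib scaleR_sum_right)

text \<open>Differentiation keeps the shape L F R, with F replaced by a directional derivative.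
  \<open>F\<close> is vector-valued here so that transition maps are covered, beyond the real-valued
  outer functions of \<open>smooth_on_compose\<close>.\<close>

lemma smooth_on_linear_conjugate:
  fixes F :: "'a::real_normed_vector \<Rightarrow> 'b::real_normed_vector"
  assumes S: "open S" and F: "smooth_on S F" and L: "bounded_linear L" and R: "bounded_linear R"
  shows "smooth_on (R -` S) (\<lambda>x. L (F (R x)))"
proof -
  have cR: "continuous_on UNIV R" using R by (simp add: linear_continuous_on)
  have o: "open (R -` S)" by (rule open_vimage[OF S cR])
  have "Ck_on k (R -` S) (\<lambda>x. L (F (R x)))" if "smooth_on S F" for k and F :: "'a \<Rightarrow> 'b"
    using that
  proof (induction k arbitrary: F)
    case 0
    have "continuous_on (R -` S) (\<lambda>x. F (R x))"
      by (rule continuous_on_compose2[OF smooth_on_imp_continuous_on[OF 0] continuous_on_subset[OF cR]]) auto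
    then show ?case using bounded_linear.continuous_on[OF L] by simp
  next
    case (Suc k)
    show ?case
    proof (rule Ck_on_SucI[OF o, where D = "\<lambda>v x. L (dderiv F (R v) (R x))"])
      show "((\<lambda>x. L (F (R x))) has_derivative (\<lambda>v. L (dderiv F (R v) (R x)))) (at x)" if "x \<in> R -` S" for x
      proof -
        have "R x \<in> S" using that by simp
        from diff_chain_at[OF bounded_linear_imp_has_derivative[OF R] smooth_on_has_derivative[OF Suc.prems this]]
        have "((\<lambda>x. F (R x)) has_derivative (\<lambda>v. dderiv F (R v) (R x))) (at x)" by (simp add: o_def)
        then show ?thesis by (rule bounded_linear.has_derivative[OF L])
      qed
      show "Ck_on k (R -` S) (\<lambda>x. L (dderiv F (R v) (R x)))" for v
        by (rule Suc.IH[OF smooth_on_dderiv[OF Suc.prems]])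
    qed
  qed
  then show ?thesis using F by (simp add: smooth_on_def)
qed

section \<open>The transported atlas\<close>

definition vec_atlas :: "('m, 'e::euclidean_space) atlas \<Rightarrow> ('m, real^'e basis_index) atlas" where
  "vec_atlas A = (\<lambda>(U, \<phi>). (U, to_vec \<circ> \<phi>)) ` A"

lemma to_vec_image: "to_vec ` S = of_vec -` S"
  by (auto intro: image_eqI[of _ _ "of_vec _"])

context
  fixes A :: "('m::{t2_space,second_countable_topology}, 'e::euclidean_space) atlas"
  assumes A: "smooth_atlas A"
begin

lemma atlas_chart:
  assumes "(U, \<phi>) \<in> A"
  shows "open U" "open (\<phi> ` U)" "homeomorphism U (\<phi> ` U) \<phi> (inv_into U \<phi>)" "inj_on \<phi> U"
proof -
  have c: "is_chart U \<phi>" using A assms by (auto simp: smooth_atlas_def)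
  then show "open U" "open (\<phi> ` U)" "homeomorphism U (\<phi> ` U) \<phi> (inv_into U \<phi>)" by (auto simp: is_chart_def)
  then show "inj_on \<phi> U" by (auto simp: homeomorphism_def intro: inj_on_inverseI)
qed

lemma inv_into_to_vec:
  assumes "(U, \<phi>) \<in> A" "x \<in> of_vec -` \<phi> ` U"
  shows "inv_into U (to_vec \<circ> \<phi>) x = inv_into U \<phi> (of_vec x)"
proof -
  obtain p where p: "p \<in> U" "of_vec x = \<phi> p" using assms(2) by auto
  have x: "x = (to_vec \<circ> \<phi>) p" using arg_cong[OF p(2), of to_vec] by simp
  have "inj_on (to_vec \<circ> \<phi>) U"
    using atlas_chart(4)[OF assms(1)] by (auto simp: inj_on_def dest: arg_cong[of _ _ of_vec])
  then have "inv_into U (to_vec \<circ> \<phi>) x = p" using p(1) unfolding x by (rule inv_into_f_f)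
  moreover have "inv_into U \<phi> (of_vec x) = p" unfolding p(2) by (rule inv_into_f_f[OF atlas_chart(4)[OF assms(1)] p(1)])
  ultimately show ?thesis by simp
qed

lemma smooth_fun_vec_atlas: "smooth_fun (vec_atlas A) f \<longleftrightarrow> smooth_fun A f"
proof -
  have "smooth_on ((to_vec \<circ> \<phi>) ` U) (f \<circ> inv_into U (to_vec \<circ> \<phi>)) \<longleftrightarrow> smooth_on (\<phi> ` U) (f \<circ> inv_into U \<phi>)"
    if c: "(U, \<phi>) \<in> A" for U \<phi>
  proof -
    let ?S = "\<phi> ` U"
    let ?F = "f \<circ> inv_into U \<phi>"
    note o = atlas_chart(2)[OF c]
    have im: "(to_vec \<circ> \<phi>) ` U = of_vec -` ?S" by (simp only: image_comp[symmetric] to_vec_image)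
    have ov: "open (of_vec -` ?S)"
      by (rule open_vimage[OF o]) (simp add: linear_continuous_on bounded_linear_of_vec)
    have "smooth_on (of_vec -` ?S) (f \<circ> inv_into U (to_vec \<circ> \<phi>)) \<longleftrightarrow> smooth_on (of_vec -` ?S) (\<lambda>x. ?F (of_vec x))"
      by (rule smooth_on_cong[OF ov]) (simp add: inv_into_to_vec[OF c])
    also have "\<dots> \<longleftrightarrow> smooth_on ?S ?F"
    proof
      assume "smooth_on ?S ?F"
      from smooth_on_linear_conjugate[OF o this bounded_linear_ident bounded_linear_of_vec]
      show "smooth_on (of_vec -` ?S) (\<lambda>x. ?F (of_vec x))" .
    next
      assume "smooth_on (of_vec -` ?S) (\<lambda>x. ?F (of_vec x))"
      from smooth_on_linear_conjugate[OF ov this bounded_linear_ident bounded_linear_to_vec]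
      have "smooth_on (to_vec -` of_vec -` ?S) ?F" by (simp add: o_def)
      moreover have "to_vec -` of_vec -` ?S = ?S" by auto
      ultimately show "smooth_on ?S ?F" by simp
    qed
    finally show ?thesis unfolding im .
  qed
  then show ?thesis unfolding smooth_fun_def vec_atlas_def by (auto simp: split_beta)
qed

lemma smooth_atlas_vec_atlas: "smooth_atlas (vec_atlas A)"
proof -
  have chart: "is_chart U (to_vec \<circ> \<phi>)" if c: "(U, \<phi>) \<in> A" for U \<phi>
  proof -
    let ?S = "\<phi> ` U"
    have im: "(to_vec \<circ> \<phi>) ` U = of_vec -` ?S" by (simp only: image_comp[symmetric] to_vec_image)
    have ov: "open (of_vec -` ?S)"
      by (rule open_vimage[OF atlas_chart(2)[OF c]]) (simp add: linear_continuous_on bounded_linear_of_vec)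
    have h1: "homeomorphism ?S (of_vec -` ?S) to_vec of_vec"
      by (rule homeomorphismI)
        (auto simp: linear_continuous_on bounded_linear_of_vec bounded_linear_to_vec)
    have "homeomorphism U (of_vec -` ?S) (to_vec \<circ> \<phi>) (inv_into U \<phi> \<circ> of_vec)"
      by (rule homeomorphism_compose[OF atlas_chart(3)[OF c] h1])
    then have "homeomorphism U (of_vec -` ?S) (to_vec \<circ> \<phi>) (inv_into U (to_vec \<circ> \<phi>))"
      by (rule homeomorphism_cong) (simp_all add: inv_into_to_vec[OF c])
    then show ?thesis unfolding is_chart_def im using atlas_chart(1)[OF c] ov by blast
  qed
  have trans: "smooth_on ((to_vec \<circ> \<phi>) ` (U \<inter> V)) ((to_vec \<circ> \<psi>) \<circ> inv_into U (to_vec \<circ> \<phi>))"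
    if c: "(U, \<phi>) \<in> A" and d: "(V, \<psi>) \<in> A" for U \<phi> V \<psi>
  proof -
    let ?S = "\<phi> ` (U \<inter> V)"
    have im: "(to_vec \<circ> \<phi>) ` (U \<inter> V) = of_vec -` ?S" by (simp only: image_comp[symmetric] to_vec_image)
    have "openin (top_of_set (\<phi> ` U)) ?S"
      using homeomorphism_imp_open_map[OF atlas_chart(3)[OF c]] atlas_chart(1)[OF c] atlas_chart(1)[OF d]
      by (simp add: openin_open_Int)
    then have o: "open ?S" using openin_open_trans atlas_chart(2)[OF c] by blast
    have ov: "open (of_vec -` ?S)"
      by (rule open_vimage[OF o]) (simp add: linear_continuous_on bounded_linear_of_vec)
    have "smooth_on ?S (\<psi> \<circ> inv_into U \<phi>)" using A c d unfolding smooth_atlas_def by fastforce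
    from smooth_on_linear_conjugate[OF o this bounded_linear_to_vec bounded_linear_of_vec]
    have s: "smooth_on (of_vec -` ?S) (\<lambda>x. to_vec ((\<psi> \<circ> inv_into U \<phi>) (of_vec x)))" .
    show ?thesis unfolding im
      by (rule smooth_on_cong[OF ov, THEN iffD2, OF _ s]) (auto simp: inv_into_to_vec[OF c])
  qed
  have "(\<Union>(U, \<phi>)\<in>vec_atlas A. U) = UNIV"
    using A by (simp add: smooth_atlas_def vec_atlas_def case_prod_unfold)
  moreover have "\<forall>(U, \<phi>)\<in>vec_atlas A. is_chart U \<phi>" using chart by (auto simp: vec_atlas_def)
  moreover have "\<forall>(U, \<phi>)\<in>vec_atlas A. \<forall>(V, \<psi>)\<in>vec_atlas A. smooth_on (\<phi> ` (U \<inter> V)) (\<psi> \<circ> inv_into U \<phi>)"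
    unfolding vec_atlas_def using trans by auto
  ultimately show ?thesis unfolding smooth_atlas_def by blast
qed

end

theorem theorem7p1:
  fixes A :: "('m::{t2_space,second_countable_topology}, 'e::euclidean_space) atlas"
    and J :: "'m endo" and g :: "'m form2" and \<theta> :: "'m form1"
    and Dg :: "'m connection" and nabla :: "real \<Rightarrow> 'm connection" and t :: real
  assumes "smooth_atlas A" and "DIM('e) \<ge> 4"
    and "compact (UNIV :: 'm set)" and "connected (UNIV :: 'm set)"
    and "lck A J g" and "lee_form A J g \<theta>"
    and "levi_civita A g Dg"
    and "\<And>s. gauduchon_connection A J g Dg s (nabla s)"
    and "parallel_form1 A (nabla t) \<theta>"
  shows "(zero_form A \<theta> \<and> kaehler A J g \<and>
           (\<forall>s X Y. vector_field A X \<longrightarrow> vector_field A Y \<longrightarrow> nabla s X Y = Dg X Y)) \<or>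
         (vaisman A J g \<and> t = -1 \<and> bismut_connection A J g Dg (nabla t))"
proof -
  let ?B = "vec_atlas A"
  \<comment> \<open>Apart from \<open>smooth_atlas\<close>, every notion sees the atlas only through
    its smooth functions. Once these agree for the two atlases, all hypotheses and the conclusion
    carry over.\<close>
  have sf: "smooth_fun ?B = smooth_fun A"
    using smooth_fun_vec_atlas[OF assms(1)] by (intro ext) simp
  have ts: "tangent_space ?B = tangent_space A"
    by (intro ext) (simp add: tangent_space_def sf)
  have vf: "vector_field ?B = vector_field A"
    by (intro ext) (simp add: vector_field_def sf ts)
  have lf: "linear_form_at ?B = linear_form_at A"
    by (intro ext) (simp add: linear_form_at_def ts)
  have rm: "riemannian_metric ?B = riemannian_metric A"
    by (intro ext) (simp add: riemannian_metric_def sf ts vf lf)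
  have h: "hermitian ?B = hermitian A"
    by (intro ext) (simp add: hermitian_def complex_structure_def almost_complex_structure_def rm ts vf)
  have l: "lee_form ?B = lee_form A"
    by (intro ext) (simp add: lee_form_def one_form_def closed_form1_def sf vf lf)
  have ac: "affine_connection ?B = affine_connection A"
    by (intro ext) (simp only: affine_connection_def sf vf)
  have lc: "levi_civita ?B = levi_civita A"
    by (intro ext) (simp only: levi_civita_def ac vf)
  have gc: "gauduchon_connection ?B = gauduchon_connection A"
    by (intro ext) (simp only: gauduchon_connection_def ac vf)
  have pf: "parallel_form1 ?B = parallel_form1 A"
    by (intro ext) (simp only: parallel_form1_def vf)
  have "(zero_form ?B \<theta> \<and> kaehler ?B J g \<and>
           (\<forall>s X Y. vector_field ?B X \<longrightarrow> vector_field ?B Y \<longrightarrow> nabla s X Y = Dg X Y)) \<or>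
         (vaisman ?B J g \<and> t = -1 \<and> bismut_connection ?B J g Dg (nabla t))"
  proof (rule theorem7p1_vec)
    show "smooth_atlas ?B" by (rule smooth_atlas_vec_atlas[OF assms(1)])
    show "3 \<le> CARD('e basis_index)" using assms(2) by (simp add: card_basis_index)
    show "compact (UNIV :: 'm set)" by (rule assms(3))
    show "lck ?B J g" using assms(5) by (simp add: lck_def h l)
    show "lee_form ?B J g \<theta>" using assms(6) by (simp add: l)
    show "levi_civita ?B g Dg" using assms(7) by (simp only: lc)
    show "gauduchon_connection ?B J g Dg s (nabla s)" for s using assms(8) by (simp only: gc)
    show "parallel_form1 ?B (nabla t) \<theta>" using assms(9) by (simp only: pf)
  qed
  then show ?thesis
    by (simp only: zero_form_def kaehler_def vaisman_def bismut_connection_def h l lc gc pf vf ts)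
qed

end
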